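(* Let $\theta>0$ and let $G_\theta=\mathbb{R}^2\rtimes_\tau\mathbb{R}$ be the Grélaud group with parameter $\theta$. Let $v_1\in L^1(\mathbb{R}^2)$ be such that $\hat{v}_1\in A_c(\mathbb{R}^2)$, let $v_2\in\mathcal{C}_c(\mathbb{R})$, and let $v(x,s)=v_1(x)v_2(s)$. Let $X\in\operatorname{span}\{X_1,X_2\}$. Then there is $S=S_{X,v}\in VN(G_\theta\times G_\theta)$ such that \[ S(u)=\int_{G_\theta}\partial_{(X,0)}u(g,g^{-1})\,v(g)\,dg \] for every $u\in\mathcal{D}(G_\theta\times G_\theta)$.
   Context: For $s\in\mathbb{R}$ let $\tau(s)=\exp\left(s\begin{bmatrix}1&-\theta\\ \theta&1\end{bmatrix}\right)=e^s\begin{bmatrix}\cos s\theta&-\sin s\theta\\ \sin s\theta&\cos s\theta\end{bmatrix}$. The group $G_\theta=\mathbb{R}^2\rtimes_\tau\mathbb{R}$ has multiplication $(x,s)(x',s')=(x+\tau(s)x',s+s')$ and inverse $(x,s)^{-1}=(-\tau(-s)x,-s)$. Its left Haar integral (denoted $dg$) is $\int_{\mathbb{R}^2}\int_{\mathbb{R}}u(x,s)e^{-2s}\,ds\,dx$. $X_1,X_2$ are the elements of its Lie algebra with $\exp(hX_j)=(he_j,0)$ for $h\in\mathbb{R}$, where $(e_1,e_2)$ is the standard basis of $\mathbb{R}^2$. $\hat{v}_1$ is the Fourier transform on $\mathbb{R}^2$, and $\mathcal{C}_c(\mathbb{R})$ is the space of compactly supported continuous functions. For a locally compact group $G$, the Fourier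 algebra $A(G)$ (Eymard) is the Banach algebra of all functions $u(g)=\langle\lambda(g)\xi|\eta\rangle$ with $\xi,\eta\in L^2(G)$, where $\lambda$ is the left regular representation of $G$ on $L^2(G)$; its norm is $\|u\|_A=\inf\{\|\xi\|_2\|\eta\|_2: u=\langle\lambda(\cdot)\xi|\eta\rangle\}$. $A_c(G)$ is the set of compactly supported elements of $A(G)$. The dual of $A(G)$ is the group von Neumann algebra $VN(G)=\lambda(G)''\subset\mathcal{B}(L^2(G))$ via $T(u)=\langle T\xi|\eta\rangle$ for $u=\langle\lambda(\cdot)\xi|\eta\rangle$. For a Lie group $G$, $\mathcal{D}(G)$ is the space of compactly supported smooth functions on $G$; it is contained in $A(G)$. For $X$ in the Lie algebra of $G$ and $u\in\mathcal{D}(G\times G)$, $\partial_{(X,0)}u(g,h)=\frac{d}{dt}u(g\exp(tX),h)|_{t=0}$. *)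

theory Defs
  imports "HOL-Analysis.Analysis" "HOL-Algebra.Group"
begin

section \<open>Compact support and smoothness\<close>

definition compactly_supported :: "('a::topological_space \<Rightarrow> 'b::zero) \<Rightarrow> bool" where
  "compactly_supported f \<longleftrightarrow> compact (closure {x. f x \<noteq> 0})"

text \<open>In finite dimension, being C^k is equivalent to the existence and continuity of all
  iterated directional derivatives up to order k, which avoids higher derivatives as
  multilinear maps.\<close>

primrec Ck :: "nat \<Rightarrow> ('a::euclidean_space \<Rightarrow> 'b::real_normed_vector) \<Rightarrow> bool" where
  "Ck 0 f \<longleftrightarrow> continuous_on UNIV f"
| "Ck (Suc k) f \<longleftrightarrow>
     (\<forall>x. f differentiable at x) \<and> (\<forall>v. Ck k (\<lambda>x. frechet_derivative f (at x) v))"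

definition smooth :: "('a::euclidean_space \<Rightarrow> 'b::real_normed_vector) \<Rightarrow> bool" where
  "smooth f \<longleftrightarrow> (\<forall>k. Ck k f)"

text \<open>The space \<open>\<D>(G)\<close> for a Lie group \<open>G\<close> whose underlying manifold is a
  Euclidean space.\<close>

definition test_functions :: "('a::euclidean_space \<Rightarrow> complex) set" where
  "test_functions = {u. smooth u \<and> compactly_supported u}"

section \<open>Square-integrable functions and bounded operators\<close>

text \<open>Elements of \<open>L\<^sup>2(\<mu>)\<close> are represented by functions, and equality of elements by
  equality almost everywhere.\<close>

definition square_integrable :: "'a measure \<Rightarrow> ('a \<Rightarrow> complex) set" where
  "square_integrable \<mu> =
     {f \<in> borel_measurable \<mu>. integrable \<mu> (\<lambda>x. (cmod (f x))\<^sup>2)}"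

definition l2_inner :: "'a measure \<Rightarrow> ('a \<Rightarrow> complex) \<Rightarrow> ('a \<Rightarrow> complex) \<Rightarrow> complex" where
  "l2_inner \<mu> f h = (LINT x|\<mu>. f x * cnj (h x))"

definition l2_norm :: "'a measure \<Rightarrow> ('a \<Rightarrow> complex) \<Rightarrow> real" where
  "l2_norm \<mu> f = sqrt (LINT x|\<mu>. (cmod (f x))\<^sup>2)"

text \<open>Linearity together with boundedness forces an operator on representatives to
  respect equality almost everywhere, so that it descends to \<open>L\<^sup>2(\<mu>)\<close>; its values outside the
  square-integrable functions are irrelevant.\<close>

definition bounded_operators :: "'a measure \<Rightarrow> (('a \<Rightarrow> complex) \<Rightarrow> ('a \<Rightarrow> complex)) set" where
  "bounded_operators \<mu> = {T.
     (\<forall>f\<in>square_integrable \<mu>. T f \<in> square_integrable \<mu>) \<and>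
     (\<forall>f\<in>square_integrable \<mu>. \<forall>h\<in>square_integrable \<mu>.
        AE x in \<mu>. T (\<lambda>y. f y + h y) x = T f x + T h x) \<and>
     (\<forall>c. \<forall>f\<in>square_integrable \<mu>. AE x in \<mu>. T (\<lambda>y. c * f y) x = c * T f x) \<and>
     (\<exists>C. \<forall>f\<in>square_integrable \<mu>. l2_norm \<mu> (T f) \<le> C * l2_norm \<mu> f)}"

definition commutant ::
  "'a measure \<Rightarrow> (('a \<Rightarrow> complex) \<Rightarrow> ('a \<Rightarrow> complex)) set
    \<Rightarrow> (('a \<Rightarrow> complex) \<Rightarrow> ('a \<Rightarrow> complex)) set" where
  "commutant \<mu> M = {T \<in> bounded_operators \<mu>.
     \<forall>R\<in>M. \<forall>f\<in>square_integrable \<mu>. AE x in \<mu>. T (R f) x = R (T f) x}"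

section \<open>The Fourier algebra and the group von Neumann algebra\<close>

text \<open>In this section \<open>\<mu>\<close> is a left Haar measure of the group \<open>G\<close>.\<close>

definition left_regular :: "('g, 'm) monoid_scheme \<Rightarrow> 'g \<Rightarrow> ('g \<Rightarrow> complex) \<Rightarrow> ('g \<Rightarrow> complex)" where
  "left_regular G g \<xi> = (\<lambda>t. \<xi> (inv\<^bsub>G\<^esub> g \<otimes>\<^bsub>G\<^esub> t))"

definition represents ::
  "('g, 'm) monoid_scheme \<Rightarrow> 'g measure \<Rightarrow> ('g \<Rightarrow> complex) \<Rightarrow> ('g \<Rightarrow> complex)
    \<Rightarrow> ('g \<Rightarrow> complex) \<Rightarrow> bool" where
  "represents G \<mu> \<xi> \<eta> u \<longleftrightarrow>
     \<xi> \<in> square_integrable \<mu> \<and> \<eta> \<in> square_integrable \<mu> \<and>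
     (\<forall>g\<in>carrier G. u g = l2_inner \<mu> (left_regular G g \<xi>) \<eta>)"

definition fourier_algebra :: "('g, 'm) monoid_scheme \<Rightarrow> 'g measure \<Rightarrow> ('g \<Rightarrow> complex) set" where
  "fourier_algebra G \<mu> = {u. \<exists>\<xi> \<eta>. represents G \<mu> \<xi> \<eta> u}"

definition fourier_algebra_c ::
  "('g::topological_space, 'm) monoid_scheme \<Rightarrow> 'g measure \<Rightarrow> ('g \<Rightarrow> complex) set" where
  "fourier_algebra_c G \<mu> = {u \<in> fourier_algebra G \<mu>. compactly_supported u}"

definition group_vN ::
  "('g, 'm) monoid_scheme \<Rightarrow> 'g measure \<Rightarrow> (('g \<Rightarrow> complex) \<Rightarrow> ('g \<Rightarrow> complex)) set" where
  "group_vN G \<mu> = commutant \<mu> (commutant \<mu> (left_regular G ` carrier G))"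

text \<open>The duality \<open>T(u) = \<langle>T\<xi>|\<eta>\<rangle>\<close> between the group von Neumann algebra and the Fourier
  algebra. The value does not depend on the representation of \<open>u\<close>; it is unspecified when \<open>u\<close> is
  not in the Fourier algebra.\<close>

definition vN_pairing ::
  "('g, 'm) monoid_scheme \<Rightarrow> 'g measure \<Rightarrow> (('g \<Rightarrow> complex) \<Rightarrow> ('g \<Rightarrow> complex))
    \<Rightarrow> ('g \<Rightarrow> complex) \<Rightarrow> complex" where
  "vN_pairing G \<mu> T u =
     (THE c. \<exists>\<xi> \<eta>. represents G \<mu> \<xi> \<eta> u \<and> c = l2_inner \<mu> (T \<xi>) \<eta>)"

section \<open>The additive group of a Euclidean space and its Fourier transform\<close>

definition additive_group :: "('a::euclidean_space) monoid" where
  "additive_group = \<lparr>carrier = UNIV, monoid.mult = (+), one = 0\<rparr>"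

text \<open>Other normalisations of the Fourier transform differ by a scalar factor and a linear
  change of the variable, under which the compactly supported part of the Fourier algebra of
  \<open>additive_group\<close> is invariant.\<close>

definition fourier_transform :: "('a::euclidean_space \<Rightarrow> complex) \<Rightarrow> 'a \<Rightarrow> complex" where
  "fourier_transform f y = (LINT x|lborel. cis (- (x \<bullet> y)) * f x)"

section \<open>Exponential map and derivative of functions on a product group\<close>

text \<open>For a Lie group with a Euclidean space as underlying manifold, the Lie algebra is
  identified with that Euclidean space, as the tangent space at the identity.
  The exponential of \<open>X\<close> is the value at 1 of the one-parameter subgroup
  with initial velocity \<open>X\<close>.\<close>

definition one_parameter_subgroup ::
  "('g::real_normed_vector, 'm) monoid_scheme \<Rightarrow> 'g \<Rightarrow> (real \<Rightarrow> 'g) \<Rightarrow> bool" where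
  "one_parameter_subgroup G X \<phi> \<longleftrightarrow>
     (\<forall>t. \<phi> t \<in> carrier G) \<and> (\<forall>s t. \<phi> (s + t) = \<phi> s \<otimes>\<^bsub>G\<^esub> \<phi> t) \<and> \<phi> 0 = \<one>\<^bsub>G\<^esub> \<and>
     (\<phi> has_vector_derivative X) (at 0)"

definition lie_exp :: "('g::real_normed_vector, 'm) monoid_scheme \<Rightarrow> 'g \<Rightarrow> 'g" where
  "lie_exp G X = (THE \<phi>. one_parameter_subgroup G X \<phi>) 1"

text \<open>The derivative \<open>\<partial>\<^bsub>(X,0)\<^esub>\<close>.\<close>

definition deriv_fst ::
  "('g::real_normed_vector, 'm) monoid_scheme \<Rightarrow> 'g \<Rightarrow> ('g \<times> 'h \<Rightarrow> complex) \<Rightarrow> 'g \<times> 'h \<Rightarrow> complex" where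
  "deriv_fst G X u = (\<lambda>(g, h).
     vector_derivative (\<lambda>t. u (g \<otimes>\<^bsub>G\<^esub> lie_exp G (t *\<^sub>R X), h)) (at 0))"

section \<open>The Grelaud groups\<close>

definition grelaud_tau :: "real \<Rightarrow> real \<Rightarrow> real^2^2" where
  "grelaud_tau \<theta> s = exp s *\<^sub>R
     vector [vector [cos (s * \<theta>), - sin (s * \<theta>)],
             vector [sin (s * \<theta>),   cos (s * \<theta>)]]"

definition grelaud :: "real \<Rightarrow> ((real^2) \<times> real) monoid" where
  "grelaud \<theta> =
     \<lparr>carrier = UNIV,
      monoid.mult = (\<lambda>(x, s) (x', s'). (x + grelaud_tau \<theta> s *v x', s + s')),
      one = (0, 0)\<rparr>"

definition grelaud_haar :: "((real^2) \<times> real) measure" where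
  "grelaud_haar = density lborel (\<lambda>(x, s). ennreal (exp (- 2 * s)))"

text \<open>The elements \<open>X\<^sub>1\<close> and \<open>X\<^sub>2\<close> of the Lie algebra; see \<open>lie_exp_grelaud_X\<close>.\<close>

definition grelaud_X :: "2 \<Rightarrow> (real^2) \<times> real" where
  "grelaud_X j = (axis j 1, 0)"

lemma grelaud_simps [simp]:
  "carrier (grelaud \<theta>) = UNIV"
  "(x, s) \<otimes>\<^bsub>grelaud \<theta>\<^esub> (x', s') = (x + grelaud_tau \<theta> s *v x', s + s')"
  "\<one>\<^bsub>grelaud \<theta>\<^esub> = (0, 0)"
  by (simp_all add: grelaud_def)

lemma grelaud_tau_0 [simp]: "grelaud_tau \<theta> 0 = mat 1"
  by (simp add: grelaud_tau_def vec_eq_iff forall_2 mat_def)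

lemma grelaud_tau_add: "grelaud_tau \<theta> (s + t) = grelaud_tau \<theta> s ** grelaud_tau \<theta> t"
  by (simp add: grelaud_tau_def vec_eq_iff forall_2 matrix_matrix_mult_def sum_2
      exp_add cos_add sin_add algebra_simps)

lemma grelaud_group: "group (grelaud \<theta>)"
proof (rule groupI)
  fix g assume "g \<in> carrier (grelaud \<theta>)"
  obtain x s where g: "g = (x, s)" by fastforce
  have "(- (grelaud_tau \<theta> (- s) *v x), - s) \<otimes>\<^bsub>grelaud \<theta>\<^esub> g = \<one>\<^bsub>grelaud \<theta>\<^esub>"
    by (simp add: g)
  then show "\<exists>h\<in>carrier (grelaud \<theta>). h \<otimes>\<^bsub>grelaud \<theta>\<^esub> g = \<one>\<^bsub>grelaud \<theta>\<^esub>"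
    by (metis UNIV_I grelaud_simps(1))
qed (auto simp: grelaud_tau_add matrix_vector_right_distrib matrix_vector_mul_assoc
      add.assoc)

lemma grelaud_inv: "inv\<^bsub>grelaud \<theta>\<^esub> (x, s) = (- (grelaud_tau \<theta> (- s) *v x), - s)"
  by (rule group.inv_equality[OF grelaud_group]) simp_all

lemma lie_exp_grelaud: "lie_exp (grelaud \<theta>) (x, 0) = (x, 0)"
proof -
  let ?\<phi> = "\<lambda>t::real. (t *\<^sub>R x, 0 :: real)"
  have ex: "one_parameter_subgroup (grelaud \<theta>) (x, 0) ?\<phi>"
    unfolding one_parameter_subgroup_def
    by (auto simp: scaleR_add_left intro!: derivative_eq_intros has_vector_derivative_Pair)
  have "\<phi> = ?\<phi>" if "one_parameter_subgroup (grelaud \<theta>) (x, 0) \<phi>" for \<phi>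
  proof -
    define a b where "a = (\<lambda>t. fst (\<phi> t))" and "b = (\<lambda>t. snd (\<phi> t))"
    have \<phi>: "\<phi> t = (a t, b t)" for t by (simp add: a_def b_def)
    have add: "a (s + t) = a s + grelaud_tau \<theta> (b s) *v a t" "b (s + t) = b s + b t" for s t
      using that unfolding one_parameter_subgroup_def by (auto simp: \<phi>)
    have zero: "a 0 = 0" "b 0 = 0"
      using that unfolding one_parameter_subgroup_def by (auto simp: \<phi>)
    have d: "(\<phi> has_vector_derivative (x, 0)) (at 0)"
      using that unfolding one_parameter_subgroup_def by auto
    have da: "(a has_vector_derivative x) (at 0)" and db: "(b has_vector_derivative 0) (at 0)"
      using has_derivative_fst[OF d[unfolded has_vector_derivative_def]]
        has_derivative_snd[OF d[unfolded has_vector_derivative_def]]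
      by (simp_all add: a_def b_def has_vector_derivative_def)
    have shift: "(f has_vector_derivative D) (at s)"
      if f: "\<And>t. f (s + t) = f s + f t" and df: "(f has_vector_derivative D) (at 0)"
      for f :: "real \<Rightarrow> 'c::real_normed_vector" and D s
    proof -
      have "((\<lambda>t. f s + f t) has_vector_derivative D) (at 0)"
        using has_vector_derivative_add[OF has_vector_derivative_const df, of "f s"] by simp
      then have "((\<lambda>t. f (s + t)) has_vector_derivative D) (at (s - s))"
        by (simp add: f)
      then have "((\<lambda>t. f (s + (t - s))) has_vector_derivative 1 *\<^sub>R D) (at s)"
        by (intro vector_diff_chain_at[where f = "\<lambda>t. t - s" and g = "\<lambda>t. f (s + t)",
              unfolded o_def]) (auto intro!: derivative_eq_intros)
      then show ?thesis by simp
    qed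
    have const: "f t = f 0" if "\<And>s. (f has_vector_derivative 0) (at s)"
      for f :: "real \<Rightarrow> 'c::real_inner" and t
      using has_derivative_zero_unique[of UNIV f 0 t] that
      by (auto simp: has_vector_derivative_def has_derivative_zero_constant
          dest!: has_derivative_zero_constant[OF convex_UNIV])
    have b: "b t = 0" for t
      using const[OF shift[OF add(2) db]] zero by simp
    have "((\<lambda>t. a t - t *\<^sub>R x) has_vector_derivative 0) (at s)" for s
    proof -
      have "(a has_vector_derivative x) (at s)"
        by (rule shift[OF _ da]) (simp add: add(1) b)
      then show ?thesis by (auto intro!: derivative_eq_intros)
    qed
    from const[OF this] have "a t = t *\<^sub>R x" for t using zero by simp
    then show ?thesis by (auto simp: \<phi> b)
  qed
  with ex have "(THE \<phi>. one_parameter_subgroup (grelaud \<theta>) (x, 0) \<phi>) = ?\<phi>" by blast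
  then show ?thesis by (simp add: lie_exp_def)
qed

lemma lie_exp_grelaud_X: "lie_exp (grelaud \<theta>) (h *\<^sub>R grelaud_X j) = (h *\<^sub>R axis j 1, 0)"
  by (simp add: grelaud_X_def lie_exp_grelaud)

end

theory Submission
  imports Defs "HOL-Probability.Characteristic_Functions"
begin

text \<open>The functional is the limit, as \<open>h\<close> tends to 0, of functionals in which \<open>\<partial>\<^bsub>(X,0)\<^esub>\<close> is replaced by a
  difference quotient. On a coefficient \<open>\<langle>\<lambda>(\<cdot>)\<xi>|\<eta>\<rangle>\<close> these are bounded by \<open>C \<parallel>\<xi>\<parallel> \<parallel>\<eta>\<parallel>\<close> uniformly in \<open>h\<close>:
  by Parseval's identity on the normal subgroup of pairs of planes, the integral against \<open>v1\<close> at a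
  fixed \<open>s\<close> becomes multiplication by a function that vanishes unless \<open>|p - \<tau>(- s)\<^sup>T q| \<le> R\<close> and is
  at most of order \<open>|p|\<close>. Since \<open>|\<tau>(- s)\<^sup>T q| = exp (- s) |q|\<close>, the first condition confines \<open>s\<close> to a set
  of measure of order \<open>1 / |p|\<close>, and Schur's test applies. A pointwise cluster point of the resulting
  bounded forms is given by an operator in the von Neumann algebra. Test functions are coefficients,
  and on them the difference quotients converge to the derivative.\<close>

section \<open>Square-integrable functions\<close>

text \<open>A general coefficient is not differentiable, so the functional has no direct formula on
  the whole Fourier algebra. A difference quotient makes sense on every coefficient and, for fixed
  h, is bounded with a crude constant of order 1 / |h|. This crude bound is what extends the uniform
  estimate from the dense space \<open>Cc\<close>, on which Parseval's identity can be applied to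
  each fibre separately. For general vectors convergence as h tends to 0 is not claimed, hence a
  cluster point; it agrees with the limit wherever that exists, in particular on test functions.

  The obstacle is the factor |p|: for a single s it is unbounded, and smoothness of the vectors must
  not enter the estimate. The integration over s pays for it, because the dilation sweeps |q|
  through a window of fixed width R, and the larger |p| is, the shorter it stays there. Evaluation
  at a pair of g and its inverse moves the two real coordinates by -s and s. The transport of the
  fibres therefore preserves the weighted measure, and no modular factor disturbs Schur's
  test.\<close>

lemma le_mult_from_weighted_amgm:
  fixes x a b :: real
  assumes "0 \<le> a" "0 \<le> b" and le: "\<And>c. 0 < c \<Longrightarrow> x \<le> (c * a\<^sup>2 + b\<^sup>2 / c) / 2"
  shows "x \<le> a * b"
proof (cases "a = 0 \<or> b = 0")
  case False
  then have "0 < a" "0 < b" using assms by auto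
  then show ?thesis using le[of "b / a"] by (simp add: field_simps power2_eq_square)
next
  case True
  then have ab: "a * b = 0" by auto
  show ?thesis
  proof (rule ccontr)
    assume "\<not> ?thesis"
    then have x: "0 < x" using ab by simp
    have *: "y * x / (y + 1) / 2 < x" if "0 \<le> y" for y
      using x that by (simp add: field_simps add_nonneg_pos)
    from True show False
    proof
      assume "a = 0"
      then have "x \<le> b\<^sup>2 * x / (b\<^sup>2 + 1) / 2"
        using le[of "(b\<^sup>2 + 1) / x"] x by (simp add: add_nonneg_pos)
      then show False using *[OF zero_le_power2, of b] by linarith
    next
      assume "b = 0"
      then have "x \<le> a\<^sup>2 * x / (a\<^sup>2 + 1) / 2"
        using le[of "x / (a\<^sup>2 + 1)"] x by (simp add: add_nonneg_pos mult.commute[of x])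
      then show False using *[OF zero_le_power2, of a] by linarith
    qed
  qed
qed

section \<open>Inner product and norm of square-integrable functions\<close>

lemma borel_measurable_cnj [measurable (raw)]:
  "f \<in> borel_measurable M \<Longrightarrow> (\<lambda>x. cnj (f x)) \<in> borel_measurable M"
  by (rule borel_measurable_continuous_on[of cnj]) (intro continuous_intros)

lemma square_integrable_measurable:
  "f \<in> square_integrable M \<Longrightarrow> f \<in> borel_measurable M"
  by (simp add: square_integrable_def)

lemma square_integrable_integrable:
  "f \<in> square_integrable M \<Longrightarrow> integrable M (\<lambda>x. (cmod (f x))\<^sup>2)"
  by (simp add: square_integrable_def)

lemma square_integrable_scale:
  assumes "f \<in> square_integrable M"
  shows "(\<lambda>x. c * f x) \<in> square_integrable M"
  using assms by (auto simp: square_integrable_def norm_mult power_mult_distrib)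

lemma square_integrable_add:
  assumes f: "f \<in> square_integrable M" and h: "h \<in> square_integrable M"
  shows "(\<lambda>x. f x + h x) \<in> square_integrable M"
proof -
  have [measurable]: "f \<in> borel_measurable M" "h \<in> borel_measurable M"
    using f h by (auto simp: square_integrable_def)
  have "(cmod (a + b))\<^sup>2 \<le> 2 * (cmod a)\<^sup>2 + 2 * (cmod b)\<^sup>2" for a b :: complex
  proof -
    have "(cmod (a + b))\<^sup>2 \<le> (cmod a + cmod b)\<^sup>2"
      by (intro power_mono norm_triangle_ineq) auto
    also have "\<dots> \<le> 2 * (cmod a)\<^sup>2 + 2 * (cmod b)\<^sup>2"
      using sum_squares_ge_zero[of "cmod a - cmod b" 0] by (simp add: power2_eq_square algebra_simps)
    finally show ?thesis .
  qed
  note le = this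
  have "integrable M (\<lambda>x. (cmod (f x + h x))\<^sup>2)"
  proof (rule Bochner_Integration.integrable_bound)
    show "integrable M (\<lambda>x. 2 * (cmod (f x))\<^sup>2 + 2 * (cmod (h x))\<^sup>2)"
      using f h by (simp add: square_integrable_def)
    show "AE x in M. norm ((cmod (f x + h x))\<^sup>2) \<le> norm (2 * (cmod (f x))\<^sup>2 + 2 * (cmod (h x))\<^sup>2)"
      by (simp add: le)
  qed simp
  then show ?thesis by (simp add: square_integrable_def)
qed

lemma square_integrable_diff:
  assumes "f \<in> square_integrable M" "h \<in> square_integrable M"
  shows "(\<lambda>x. f x - h x) \<in> square_integrable M"
  using square_integrable_add[OF assms(1) square_integrable_scale[OF assms(2), of "-1"]] by simp

lemma square_integrable_sum:
  assumes "\<And>i. i \<in> I \<Longrightarrow> f i \<in> square_integrable M"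
  shows "(\<lambda>x. \<Sum>i\<in>I. f i x) \<in> square_integrable M"
  using assms
proof (induction I rule: infinite_finite_induct)
  case (insert i I)
  then show ?case using square_integrable_add[of "f i" M] by simp
qed (auto simp: square_integrable_def)

lemma l2_norm_nonneg [simp]: "0 \<le> l2_norm M f"
  by (simp add: l2_norm_def)

lemma l2_norm_squared: "(l2_norm M f)\<^sup>2 = (LINT x|M. (cmod (f x))\<^sup>2)"
  by (simp add: l2_norm_def)

lemma l2_norm_scale: "l2_norm M (\<lambda>x. c * f x) = cmod c * l2_norm M f"
  by (simp add: l2_norm_def norm_mult power_mult_distrib real_sqrt_mult)

lemma l2_norm_minus_commute: "l2_norm M (\<lambda>x. f x - h x) = l2_norm M (\<lambda>x. h x - f x)"
  by (simp add: l2_norm_def norm_minus_commute)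

text \<open>Integrating this for every \<open>c\<close> and optimising afterwards by
  \<open>le_mult_from_weighted_amgm\<close> gives a product of norms without dividing by a norm that
  may be 0.\<close>

lemma norm_mult_le_weighted:
  fixes a b :: complex assumes "0 < c"
  shows "cmod a * cmod b \<le> (c * (cmod a)\<^sup>2 + (cmod b)\<^sup>2 / c) / 2"
proof -
  have "0 \<le> (c * cmod a - cmod b)\<^sup>2 / c" using assms by simp
  also have "\<dots> = c * (cmod a)\<^sup>2 + (cmod b)\<^sup>2 / c - 2 * (cmod a * cmod b)"
    using assms by (simp add: field_simps power2_eq_square)
  finally show ?thesis by simp
qed

lemma integrable_l2_product:
  assumes f: "f \<in> square_integrable M" and h: "h \<in> square_integrable M"
  shows "integrable M (\<lambda>x. f x * cnj (h x))"
proof (rule Bochner_Integration.integrable_bound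
    [where f = "\<lambda>x. (1 * (cmod (f x))\<^sup>2 + (cmod (h x))\<^sup>2 / 1) / 2"])
  show "integrable M (\<lambda>x. (1 * (cmod (f x))\<^sup>2 + (cmod (h x))\<^sup>2 / 1) / 2)"
    using f h by (auto dest!: square_integrable_integrable)
  show "(\<lambda>x. f x * cnj (h x)) \<in> borel_measurable M"
    using f h by (auto dest!: square_integrable_measurable)
  show "AE x in M. norm (f x * cnj (h x)) \<le> norm ((1 * (cmod (f x))\<^sup>2 + (cmod (h x))\<^sup>2 / 1) / 2)"
    using norm_mult_le_weighted[of 1] by (auto simp: norm_mult)
qed

lemma l2_inner_add_left:
  assumes "f \<in> square_integrable M" "g \<in> square_integrable M" "h \<in> square_integrable M"
  shows "l2_inner M (\<lambda>x. f x + g x) h = l2_inner M f h + l2_inner M g h"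
  using integrable_l2_product[OF assms(1,3)] integrable_l2_product[OF assms(2,3)]
  by (simp add: l2_inner_def distrib_right)

lemma l2_inner_diff_left:
  assumes "f \<in> square_integrable M" "g \<in> square_integrable M" "h \<in> square_integrable M"
  shows "l2_inner M (\<lambda>x. f x - g x) h = l2_inner M f h - l2_inner M g h"
  using integrable_l2_product[OF assms(1,3)] integrable_l2_product[OF assms(2,3)]
  by (simp add: l2_inner_def left_diff_distrib)

lemma l2_inner_scale_left: "l2_inner M (\<lambda>x. c * f x) h = c * l2_inner M f h"
  by (simp add: l2_inner_def mult.assoc)

lemma l2_inner_cnj: "l2_inner M f h = cnj (l2_inner M h f)"
  using Bochner_Integration.integral_cnj[of M "\<lambda>x. h x * cnj (f x)"]
  by (simp add: l2_inner_def mult.commute)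

lemma l2_inner_self: "l2_inner M f f = complex_of_real ((l2_norm M f)\<^sup>2)"
proof -
  have "(\<lambda>x. f x * cnj (f x)) = (\<lambda>x. complex_of_real ((cmod (f x))\<^sup>2))"
    using complex_norm_square by (intro ext) (metis of_real_power)
  then show ?thesis unfolding l2_inner_def l2_norm_squared by (simp del: of_real_power)
qed

lemma l2_inner_add_right:
  assumes "f \<in> square_integrable M" "g \<in> square_integrable M" "h \<in> square_integrable M"
  shows "l2_inner M h (\<lambda>x. f x + g x) = l2_inner M h f + l2_inner M h g"
  by (subst (1 2 3) l2_inner_cnj) (simp add: l2_inner_add_left assms)

lemma l2_inner_scale_right: "l2_inner M h (\<lambda>x. c * f x) = cnj c * l2_inner M h f"
  by (subst (1 2) l2_inner_cnj) (simp add: l2_inner_scale_left)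

lemma l2_inner_Cauchy_Schwarz:
  assumes f: "f \<in> square_integrable M" and h: "h \<in> square_integrable M"
  shows "cmod (l2_inner M f h) \<le> l2_norm M f * l2_norm M h"
proof (rule le_mult_from_weighted_amgm)
  fix c :: real assume c: "0 < c"
  have "cmod (l2_inner M f h) \<le> (LINT x|M. cmod (f x * cnj (h x)))"
    unfolding l2_inner_def by (rule integral_norm_bound)
  also have "\<dots> \<le> (LINT x|M. (c * (cmod (f x))\<^sup>2 + (cmod (h x))\<^sup>2 / c) / 2)"
    using square_integrable_integrable[OF f] square_integrable_integrable[OF h]
      norm_mult_le_weighted[OF c] integrable_norm[OF integrable_l2_product[OF f h]]
    by (intro integral_mono) (auto simp: norm_mult)
  also have "\<dots> = (c * (l2_norm M f)\<^sup>2 + (l2_norm M h)\<^sup>2 / c) / 2"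
    using square_integrable_integrable[OF f] square_integrable_integrable[OF h]
    by (simp add: l2_norm_squared)
  finally show "cmod (l2_inner M f h) \<le> (c * (l2_norm M f)\<^sup>2 + (l2_norm M h)\<^sup>2 / c) / 2" .
qed auto

lemma l2_norm_add_squared:
  assumes f: "f \<in> square_integrable M" and h: "h \<in> square_integrable M"
  shows "(l2_norm M (\<lambda>x. f x + h x))\<^sup>2
    = (l2_norm M f)\<^sup>2 + 2 * Re (l2_inner M f h) + (l2_norm M h)\<^sup>2"
proof -
  have "complex_of_real ((l2_norm M (\<lambda>x. f x + h x))\<^sup>2)
      = l2_inner M (\<lambda>x. f x + h x) (\<lambda>x. f x + h x)"
    by (rule l2_inner_self[symmetric])
  also have "\<dots> = l2_inner M f f + l2_inner M f h + (l2_inner M h f + l2_inner M h h)"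
    using f h by (simp add: l2_inner_add_left l2_inner_add_right square_integrable_add)
  also have "l2_inner M h f = cnj (l2_inner M f h)" by (rule l2_inner_cnj)
  finally have "Re (complex_of_real ((l2_norm M (\<lambda>x. f x + h x))\<^sup>2))
      = Re (l2_inner M f f) + Re (l2_inner M f h) + (Re (l2_inner M f h) + Re (l2_inner M h h))"
    by simp
  then show ?thesis by (simp add: l2_inner_self del: of_real_power)
qed

lemma l2_norm_triangle:
  assumes f: "f \<in> square_integrable M" and h: "h \<in> square_integrable M"
  shows "l2_norm M (\<lambda>x. f x + h x) \<le> l2_norm M f + l2_norm M h"
proof (rule power2_le_imp_le)
  have "Re (l2_inner M f h) \<le> l2_norm M f * l2_norm M h"
    using l2_inner_Cauchy_Schwarz[OF f h] complex_Re_le_cmod order_trans by blast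
  then show "(l2_norm M (\<lambda>x. f x + h x))\<^sup>2 \<le> (l2_norm M f + l2_norm M h)\<^sup>2"
    by (simp add: l2_norm_add_squared[OF f h] power2_sum)
qed simp

lemma l2_norm_triangle_diff:
  assumes f: "f \<in> square_integrable M" and g: "g \<in> square_integrable M"
    and h: "h \<in> square_integrable M"
  shows "l2_norm M (\<lambda>x. f x - h x) \<le> l2_norm M (\<lambda>x. f x - g x) + l2_norm M (\<lambda>x. g x - h x)"
  using l2_norm_triangle[OF square_integrable_diff[OF f g] square_integrable_diff[OF g h]] by simp

lemma l2_norm_sum_le:
  assumes "\<And>i. i \<in> I \<Longrightarrow> f i \<in> square_integrable M"
  shows "l2_norm M (\<lambda>x. \<Sum>i\<in>I. f i x) \<le> (\<Sum>i\<in>I. l2_norm M (f i))"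
  using assms
proof (induction I rule: infinite_finite_induct)
  case (insert i I)
  have "l2_norm M (\<lambda>x. f i x + (\<Sum>i\<in>I. f i x)) \<le> l2_norm M (f i) + l2_norm M (\<lambda>x. \<Sum>i\<in>I. f i x)"
    using insert by (intro l2_norm_triangle square_integrable_sum) auto
  then show ?case using insert by auto
qed (auto simp: l2_norm_def)

section \<open>Completeness and the Riesz representation theorem\<close>

lemma nn_integral_square_integrable:
  assumes "f \<in> square_integrable M"
  shows "(\<integral>\<^sup>+x. ennreal ((cmod (f x))\<^sup>2) \<partial>M) = ennreal ((l2_norm M f)\<^sup>2)"
  unfolding l2_norm_squared
  by (rule nn_integral_eq_integral[OF square_integrable_integrable[OF assms]]) simp

text \<open>A bound for \<open>l2_norm\<close> alone would not do, as the Bochner integral of a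
  non-integrable function is 0. The nonnegative integral carries integrability together with the
  bound.\<close>

lemma square_integrableI_nn_integral:
  assumes [measurable]: "f \<in> borel_measurable M"
    and le: "(\<integral>\<^sup>+x. ennreal ((cmod (f x))\<^sup>2) \<partial>M) \<le> ennreal (C\<^sup>2)" and C: "0 \<le> C"
  shows "f \<in> square_integrable M" "l2_norm M f \<le> C"
proof -
  have "integrable M (\<lambda>x. (cmod (f x))\<^sup>2)"
    using le by (intro integrableI_bounded) (auto intro: le_less_trans)
  then show f: "f \<in> square_integrable M" by (simp add: square_integrable_def)
  from le have "(l2_norm M f)\<^sup>2 \<le> C\<^sup>2"
    by (simp add: nn_integral_square_integrable[OF f])
  then show "l2_norm M f \<le> C" using C by (rule power2_le_imp_le)
qed

text \<open>Fatou's lemma for the squares. The bound is asked only eventually, so that it can be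
  applied to the tail of a Cauchy sequence.\<close>

lemma l2_Fatou:
  assumes f: "\<And>n. f n \<in> square_integrable M" and [measurable]: "g \<in> borel_measurable M"
    and le: "\<forall>\<^sub>F n in sequentially. l2_norm M (f n) \<le> C" and C: "0 \<le> C"
    and lim: "AE x in M. (\<lambda>n. f n x) \<longlonglongrightarrow> g x"
  shows "g \<in> square_integrable M" "l2_norm M g \<le> C"
proof -
  have m [measurable]: "f n \<in> borel_measurable M" for n
    using f by (rule square_integrable_measurable)
  have "(\<integral>\<^sup>+x. ennreal ((cmod (g x))\<^sup>2) \<partial>M)
      = (\<integral>\<^sup>+x. liminf (\<lambda>n. ennreal ((cmod (f n x))\<^sup>2)) \<partial>M)"
  proof (rule nn_integral_cong_AE, use lim in eventually_elim)
    case (elim x)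
    then have "(\<lambda>n. ennreal ((cmod (f n x))\<^sup>2)) \<longlonglongrightarrow> ennreal ((cmod (g x))\<^sup>2)"
      by (intro tendsto_ennrealI tendsto_intros)
    then show ?case by (intro lim_imp_Liminf[symmetric]) simp_all
  qed
  also have "\<dots> \<le> liminf (\<lambda>n. \<integral>\<^sup>+x. ennreal ((cmod (f n x))\<^sup>2) \<partial>M)"
    by (rule nn_integral_liminf) simp
  also have "\<dots> \<le> ennreal (C\<^sup>2)"
  proof -
    have "liminf (\<lambda>n. \<integral>\<^sup>+x. ennreal ((cmod (f n x))\<^sup>2) \<partial>M) \<le> liminf (\<lambda>n. ennreal (C\<^sup>2))"
    proof (rule Liminf_mono, use le in eventually_elim)
      case (elim n)
      then have "(l2_norm M (f n))\<^sup>2 \<le> C\<^sup>2" by (intro power_mono) auto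
      then show ?case by (simp add: nn_integral_square_integrable[OF f])
    qed
    then show ?thesis by (simp add: Liminf_const)
  qed
  finally show "g \<in> square_integrable M" "l2_norm M g \<le> C"
    using square_integrableI_nn_integral[of g M C] C by auto
qed

text \<open>The Riesz-Fischer argument: the partial sums of the absolute differences have norm at
  most 2, so by monotone convergence their supremum is finite almost everywhere, and there the
  telescoping series converges absolutely.\<close>

lemma AE_convergent_if_summable_l2:
  fixes f :: "nat \<Rightarrow> 'a \<Rightarrow> complex"
  assumes f: "\<And>n. f n \<in> square_integrable M"
    and le: "\<And>k. l2_norm M (\<lambda>x. f (Suc k) x - f k x) \<le> (1/2) ^ k"
  shows "AE x in M. convergent (\<lambda>n. f n x)"
proof -
  have [measurable]: "f n \<in> borel_measurable M" for n
    using f by (rule square_integrable_measurable)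
  \<comment> \<open>Absolute values, embedded in the complex numbers so that
    \<open>square_integrable\<close> and \<open>l2_norm\<close> apply to their sums.\<close>
  define d where "d k x = complex_of_real (cmod (f (Suc k) x - f k x))" for k x
  have [measurable]: "d k \<in> borel_measurable M" for k unfolding d_def by measurable
  have d: "d k \<in> square_integrable M" and nd: "l2_norm M (d k) \<le> (1/2) ^ k" for k
    using square_integrable_diff[OF f[of "Suc k"] f[of k]] le[of k]
    by (simp_all add: square_integrable_def) (simp_all add: d_def l2_norm_def)
  have P: "(\<integral>\<^sup>+x. ennreal ((\<Sum>k<K. cmod (d k x))\<^sup>2) \<partial>M) \<le> ennreal 4" for K
  proof -
    have "(\<integral>\<^sup>+x. ennreal ((\<Sum>k<K. cmod (d k x))\<^sup>2) \<partial>M)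
        = (\<integral>\<^sup>+x. ennreal ((cmod (\<Sum>k<K. d k x))\<^sup>2) \<partial>M)"
      by (simp add: d_def abs_of_nonneg sum_nonneg flip: of_real_sum)
    also have "\<dots> = ennreal ((l2_norm M (\<lambda>x. \<Sum>k<K. d k x))\<^sup>2)"
      by (intro nn_integral_square_integrable square_integrable_sum d)
    also have "\<dots> \<le> ennreal (2\<^sup>2)"
    proof (intro ennreal_leI power_mono)
      have "l2_norm M (\<lambda>x. \<Sum>k<K. d k x) \<le> (\<Sum>k<K. l2_norm M (d k))"
        by (intro l2_norm_sum_le d)
      also have "\<dots> \<le> (\<Sum>k<K. (1/2) ^ k)" by (intro sum_mono nd)
      also have "\<dots> \<le> 2" by (simp add: geometric_sum)
      finally show "l2_norm M (\<lambda>x. \<Sum>k<K. d k x) \<le> 2" .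
    qed simp
    finally show ?thesis by simp
  qed
  have "(\<integral>\<^sup>+x. (SUP K. ennreal ((\<Sum>k<K. cmod (d k x))\<^sup>2)) \<partial>M)
      = (SUP K. \<integral>\<^sup>+x. ennreal ((\<Sum>k<K. cmod (d k x))\<^sup>2) \<partial>M)"
    by (rule nn_integral_monotone_convergence_SUP)
      (auto simp: incseq_def le_fun_def intro!: ennreal_leI power_mono sum_mono2 sum_nonneg)
  also have "\<dots> \<le> ennreal 4" by (intro SUP_least P)
  finally have "(\<integral>\<^sup>+x. (SUP K. ennreal ((\<Sum>k<K. cmod (d k x))\<^sup>2)) \<partial>M) \<noteq> \<infinity>"
    by (auto simp: top_unique)
  then have "AE x in M. (SUP K. ennreal ((\<Sum>k<K. cmod (d k x))\<^sup>2)) \<noteq> \<infinity>"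
    by (intro nn_integral_noteq_infinite) auto
  then show ?thesis
  proof eventually_elim
    case (elim x)
    then obtain B where B: "(SUP K. ennreal ((\<Sum>k<K. cmod (d k x))\<^sup>2)) = ennreal B" "0 \<le> B"
      by (cases "SUP K. ennreal ((\<Sum>k<K. cmod (d k x))\<^sup>2)") auto
    have "(\<Sum>k<K. norm (f (Suc k) x - f k x)) \<le> sqrt B" for K
    proof -
      have "ennreal ((\<Sum>k<K. cmod (d k x))\<^sup>2) \<le> ennreal B"
        unfolding B(1)[symmetric] by (rule SUP_upper) simp
      then have "(\<Sum>k<K. cmod (d k x))\<^sup>2 \<le> B" using B(2) by simp
      then have "(\<Sum>k<K. cmod (d k x)) \<le> sqrt B" by (rule real_le_rsqrt)
      then show ?thesis by (simp add: d_def)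
    qed
    then have "summable (\<lambda>k. norm (f (Suc k) x - f k x))"
      by (intro summableI_nonneg_bounded) auto
    then have "summable (\<lambda>k. f (Suc k) x - f k x)" by (rule summable_norm_cancel)
    then have "(\<lambda>n. f 0 x + (\<Sum>k<n. f (Suc k) x - f k x)) \<longlonglongrightarrow> f 0 x + (\<Sum>k. f (Suc k) x - f k x)"
      by (intro tendsto_intros summable_LIMSEQ)
    moreover have "f 0 x + (\<Sum>k<n. f (Suc k) x - f k x) = f n x" for n
      using sum_lessThan_telescope[of "\<lambda>k. f k x" n] by simp
    ultimately show ?case by (auto simp: convergent_def)
  qed
qed

text \<open>A subsequence with geometrically decreasing differences converges almost everywhere.
  Fatou's lemma for \<open>f n - f (r j)\<close> as \<open>j\<close> grows then compares every late
  \<open>f n\<close> with the limit, not just the members of the subsequence.\<close>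

theorem l2_complete:
  fixes f :: "nat \<Rightarrow> 'a \<Rightarrow> complex"
  assumes f: "\<And>n. f n \<in> square_integrable M"
    and Cau: "\<And>e. 0 < e \<Longrightarrow> \<exists>N. \<forall>m\<ge>N. \<forall>n\<ge>N. l2_norm M (\<lambda>x. f m x - f n x) < e"
  shows "\<exists>g\<in>square_integrable M. (\<lambda>n. l2_norm M (\<lambda>x. f n x - g x)) \<longlonglongrightarrow> 0"
proof -
  have [measurable]: "f n \<in> borel_measurable M" for n
    using f by (rule square_integrable_measurable)
  have "\<exists>N. \<forall>k. (\<forall>m\<ge>N k. \<forall>n\<ge>N k. l2_norm M (\<lambda>x. f m x - f n x) < (1/2) ^ k)"
    by (rule choice) (use Cau in simp)
  then obtain N where N: "\<And>k m n. m \<ge> N k \<Longrightarrow> n \<ge> N k \<Longrightarrow> l2_norm M (\<lambda>x. f m x - f n x) < (1/2) ^ k"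
    by blast
  \<comment> \<open>Adding \<open>k\<close> and summing all thresholds up to \<open>k\<close> makes
    \<open>r\<close> increasing, at least \<open>N k\<close>, and at least \<open>k\<close>.\<close>
  define r where "r k = k + (\<Sum>i\<le>k. N i)" for k
  have r: "r k \<ge> N k" "r (Suc k) \<ge> r k" "r k \<ge> k" for k
    by (auto simp: r_def member_le_sum trans_le_add2)
  have "AE x in M. convergent (\<lambda>k. f (r k) x)"
    using N[of _ "r (Suc _)" "r _"] r
    by (intro AE_convergent_if_summable_l2 f less_imp_le) (meson order_trans)
  then have lim: "AE x in M. (\<lambda>k. f (r k) x) \<longlonglongrightarrow> lim (\<lambda>k. f (r k) x)"
    by eventually_elim (simp add: convergent_LIMSEQ_iff)
  \<comment> \<open>\<open>lim\<close> keeps \<open>g\<close> total and measurable; its value is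
    arbitrary on the null set where the subsequence diverges.\<close>
  define g where "g x = lim (\<lambda>k. f (r k) x)" for x
  have [measurable]: "g \<in> borel_measurable M" unfolding g_def by measurable
  have g: "(\<lambda>x. f n x - g x) \<in> square_integrable M \<and> l2_norm M (\<lambda>x. f n x - g x) \<le> (1/2) ^ k"
    if n: "n \<ge> N k" for n k
  proof -
    have ev: "\<forall>\<^sub>F j in sequentially. l2_norm M (\<lambda>x. f n x - f (r j) x) \<le> (1/2) ^ k"
      using eventually_ge_at_top[of "N k"]
    proof eventually_elim
      case (elim j)
      then show ?case using N[of k n "r j"] n r(3)[of j] by (intro less_imp_le) auto
    qed
    have "AE x in M. (\<lambda>j. f n x - f (r j) x) \<longlonglongrightarrow> f n x - g x"
      using lim unfolding g_def by eventually_elim (intro tendsto_intros)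
    from l2_Fatou[OF square_integrable_diff[OF f f] _ ev _ this] show ?thesis by auto
  qed
  have "g \<in> square_integrable M"
    using square_integrable_diff[OF f[of "N 0"] conjunct1[OF g[of 0 "N 0"]]] by simp
  moreover have "(\<lambda>n. l2_norm M (\<lambda>x. f n x - g x)) \<longlonglongrightarrow> 0"
  proof (rule LIMSEQ_I)
    fix e :: real assume "0 < e"
    then obtain k where k: "(1/2) ^ k < e" using real_arch_pow_inv[of e "1/2"] by auto
    show "\<exists>n0. \<forall>n\<ge>n0. norm (l2_norm M (\<lambda>x. f n x - g x) - 0) < e"
      using g[of k] k by (intro exI[of _ "N k"]) (auto intro: le_less_trans)
  qed
  ultimately show ?thesis by blast
qed

text \<open>The representing vector minimises \<open>\<parallel>f\<parallel>\<^sup>2 - 2 Re (F f)\<close>; minimising sequences are Cauchy by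
  the parallelogram law.\<close>

theorem l2_Riesz:
  fixes F :: "('a \<Rightarrow> complex) \<Rightarrow> complex"
  assumes add: "\<And>f h. f \<in> square_integrable M \<Longrightarrow> h \<in> square_integrable M \<Longrightarrow>
      F (\<lambda>x. f x + h x) = F f + F h"
    and scale: "\<And>c f. f \<in> square_integrable M \<Longrightarrow> F (\<lambda>x. c * f x) = c * F f"
    and bound: "\<And>f. f \<in> square_integrable M \<Longrightarrow> cmod (F f) \<le> C * l2_norm M f"
  shows "\<exists>\<eta>\<in>square_integrable M. \<forall>f\<in>square_integrable M. F f = l2_inner M f \<eta>"
proof -
  let ?S = "square_integrable M"
  define J where "J f = (l2_norm M f)\<^sup>2 - 2 * Re (F f)" for f
  have lower: "- C\<^sup>2 \<le> J f" if "f \<in> ?S" for f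
  proof -
    have "Re (F f) \<le> C * l2_norm M f"
      using bound[OF that] complex_Re_le_cmod order_trans by blast
    moreover have "0 \<le> (l2_norm M f - C)\<^sup>2" by simp
    ultimately show ?thesis by (simp add: J_def power2_eq_square algebra_simps)
  qed
  have zero: "(\<lambda>x. 0) \<in> ?S" by (simp add: square_integrable_def)
  define m where "m = Inf (J ` ?S)"
  have bdd: "bdd_below (J ` ?S)" using lower by (auto simp: bdd_below_def)
  have m_le: "m \<le> J f" if "f \<in> ?S" for f
    unfolding m_def using bdd that by (intro cInf_lower) auto
  have "\<exists>f\<in>?S. J f < m + 1 / real (Suc n)" for n
    using cInf_lessD[of "J ` ?S" "m + 1 / real (Suc n)"] zero by (auto simp: m_def)
  then obtain f where f: "\<And>n. f n \<in> ?S" and Jf: "\<And>n. J (f n) < m + 1 / real (Suc n)"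
    by metis
  have F_diff: "F (\<lambda>x. g x - h x) = F g - F h" if "g \<in> ?S" "h \<in> ?S" for g h
    using add[OF that(1) square_integrable_scale[OF that(2), of "-1"]] scale[OF that(2), of "-1"]
    by simp
  \<comment> \<open>\<open>F\<close> is linear, so its contributions cancel and the parallelogram
    law survives for \<open>J\<close>. Two points with \<open>J\<close> close to \<open>m\<close>
    must be close to each other, since their midpoint cannot go below \<open>m\<close>.\<close>
  have para: "(l2_norm M (\<lambda>x. g x - h x))\<^sup>2 = 2 * J g + 2 * J h - 4 * J (\<lambda>x. (1/2) * (g x + h x))"
    if g: "g \<in> ?S" and h: "h \<in> ?S" for g h
  proof -
    have 1: "(l2_norm M (\<lambda>x. g x - h x))\<^sup>2
        = (l2_norm M g)\<^sup>2 - 2 * Re (l2_inner M g h) + (l2_norm M h)\<^sup>2"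
      using l2_norm_add_squared[OF g square_integrable_scale[OF h, of "-1"]]
        l2_inner_scale_right[of M g "-1" h] l2_norm_scale[of M "-1" h] by simp
    have 2: "(l2_norm M (\<lambda>x. (1/2) * (g x + h x)))\<^sup>2 =
        ((l2_norm M g)\<^sup>2 + 2 * Re (l2_inner M g h) + (l2_norm M h)\<^sup>2) / 4"
      unfolding l2_norm_scale
      by (simp add: power_mult_distrib l2_norm_add_squared[OF g h] power_divide)
    have "F (\<lambda>x. (1/2) * (g x + h x)) = (1/2) * (F g + F h)"
      by (rule trans[OF scale[OF square_integrable_add[OF g h]]]) (simp only: add[OF g h])
    then have 3: "Re (F (\<lambda>x. (1/2) * (g x + h x))) = (Re (F g) + Re (F h)) / 2"
      by (metis Re_divide_numeral mult_1 plus_complex.sel(1) times_divide_eq_left)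
    show ?thesis unfolding J_def 1 2 3 by (simp add: field_simps)
  qed
  have "\<exists>N. \<forall>j\<ge>N. \<forall>k\<ge>N. l2_norm M (\<lambda>x. f j x - f k x) < e" if e: "0 < e" for e :: real
  proof -
    \<comment> \<open>Two values below \<open>m + 1 / (N + 1)\<close> and a midpoint not below
      \<open>m\<close> leave \<open>4 / (N + 1)\<close> for the squared distance.\<close>
    obtain N where N: "4 / e\<^sup>2 < real (Suc N)" using reals_Archimedean2 of_nat_Suc
      by (metis add_strict_increasing zero_less_one less_trans lessI of_nat_less_iff)
    have "l2_norm M (\<lambda>x. f j x - f k x) < e" if "j \<ge> N" "k \<ge> N" for j k
    proof (rule power2_less_imp_less)
      have "1 / real (Suc i) \<le> 1 / real (Suc N)" if "i \<ge> N" for i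
        using that by (intro divide_left_mono) auto
      note le = this[OF that(1)] this[OF that(2)]
      have "m \<le> J (\<lambda>x. (1/2) * (f j x + f k x))"
        by (intro m_le square_integrable_scale square_integrable_add f)
      then have "(l2_norm M (\<lambda>x. f j x - f k x))\<^sup>2 < 4 / real (Suc N)"
        using Jf[of j] Jf[of k] le unfolding para[OF f f] by linarith
      also have "\<dots> < e\<^sup>2" using N e by (simp add: field_simps)
      finally show "(l2_norm M (\<lambda>x. f j x - f k x))\<^sup>2 < e\<^sup>2" .
    qed (use e in auto)
    then show ?thesis by blast
  qed
  from l2_complete[OF f this] obtain \<eta> where \<eta>: "\<eta> \<in> ?S"
    and lim: "(\<lambda>n. l2_norm M (\<lambda>x. f n x - \<eta> x)) \<longlonglongrightarrow> 0" by blast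
  have expand: "J (\<lambda>x. g x + h x) = J g + 2 * Re (l2_inner M g h - F h) + (l2_norm M h)\<^sup>2"
    if "g \<in> ?S" "h \<in> ?S" for g h
    using that by (simp add: J_def l2_norm_add_squared add algebra_simps)
  have J\<eta>: "J \<eta> \<le> m"
  proof (rule LIMSEQ_le[OF tendsto_const])
    \<comment> \<open>Bounds how far \<open>J \<eta>\<close> can exceed \<open>J (f n)\<close>; it
      tends to 0 with the distance of \<open>f n\<close> from \<open>\<eta>\<close>.\<close>
    define B where "B n = (l2_norm M (\<lambda>x. f n x - \<eta> x))\<^sup>2
      + 2 * (l2_norm M \<eta> + C) * l2_norm M (\<lambda>x. f n x - \<eta> x)" for n
    show "(\<lambda>n. m + 1 / real (Suc n) + B n) \<longlonglongrightarrow> m"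
    proof -
      have "(\<lambda>n. m + 1 / real (Suc n) + B n) \<longlonglongrightarrow> m + 0 + (0\<^sup>2 + 2 * (l2_norm M \<eta> + C) * 0)"
        unfolding B_def using LIMSEQ_Suc[OF lim_1_over_n] lim by (intro tendsto_intros) auto
      then show ?thesis by simp
    qed
    have "J \<eta> \<le> m + 1 / real (Suc n) + B n" for n
    proof -
      let ?h = "\<lambda>x. f n x - \<eta> x"
      have h: "?h \<in> ?S" using f \<eta> by (rule square_integrable_diff)
      have eq: "J (f n) = J \<eta> + 2 * Re (l2_inner M \<eta> ?h - F ?h) + (l2_norm M ?h)\<^sup>2"
        using expand[OF \<eta> h] by simp
      have "- Re (l2_inner M \<eta> ?h - F ?h) \<le> cmod (l2_inner M \<eta> ?h - F ?h)"
        using abs_Re_le_cmod[of "l2_inner M \<eta> ?h - F ?h"] by linarith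
      also have "\<dots> \<le> cmod (l2_inner M \<eta> ?h) + cmod (F ?h)" by (rule norm_triangle_ineq4)
      also have "\<dots> \<le> l2_norm M \<eta> * l2_norm M ?h + C * l2_norm M ?h"
        by (intro add_mono l2_inner_Cauchy_Schwarz \<eta> h bound)
      also have "\<dots> = (l2_norm M \<eta> + C) * l2_norm M ?h" by (rule distrib_right[symmetric])
      finally have "- Re (l2_inner M \<eta> ?h - F ?h) \<le> (l2_norm M \<eta> + C) * l2_norm M ?h" .
      moreover have "B n = (l2_norm M ?h)\<^sup>2 + 2 * ((l2_norm M \<eta> + C) * l2_norm M ?h)"
        unfolding B_def mult.assoc ..
      moreover have "0 \<le> (l2_norm M ?h)\<^sup>2" by simp
      ultimately show ?thesis using Jf[of n] unfolding eq by linarith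
    qed
    then show "\<exists>N. \<forall>n\<ge>N. J \<eta> \<le> m + 1 / real (Suc n) + B n"
      by (intro exI allI impI)
  qed
  have stat: "Re (l2_inner M \<eta> h) = Re (F h)" if h: "h \<in> ?S" for h
  proof (rule ccontr)
    define a where "a = Re (l2_inner M \<eta> h - F h)"
    assume "Re (l2_inner M \<eta> h) \<noteq> Re (F h)"
    then have a: "a \<noteq> 0" unfolding a_def by simp
    \<comment> \<open>The first variation at the minimum: a quadratic in \<open>t\<close> that is
      never negative and vanishes at 0 has no linear term.\<close>
    have quad: "0 \<le> 2 * t * a + t\<^sup>2 * (l2_norm M h)\<^sup>2" for t :: real
    proof -
      have "J \<eta> \<le> J (\<lambda>x. \<eta> x + of_real t * h x)"
        using J\<eta> m_le[OF square_integrable_add[OF \<eta> square_integrable_scale[OF h]]]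
        by (rule order_trans)
      then show ?thesis
        unfolding expand[OF \<eta> square_integrable_scale[OF h]]
        by (simp add: scale[OF h] l2_inner_scale_right l2_norm_scale power_mult_distrib a_def
            algebra_simps)
    qed
    \<comment> \<open>The summand 1 keeps the denominator of \<open>t = - a / L\<close> positive
      when \<open>h\<close> has norm 0.\<close>
    define L where "L = (l2_norm M h)\<^sup>2 + 1"
    have L: "0 < L" "(l2_norm M h)\<^sup>2 < L"  by (auto simp: L_def add_nonneg_pos)
    have "0 \<le> 2 * (- a / L) * a + (- a / L)\<^sup>2 * (l2_norm M h)\<^sup>2" by (rule quad)
    also have "\<dots> \<le> 2 * (- a / L) * a + (- a / L)\<^sup>2 * L"
      using L by (intro add_left_mono mult_left_mono) auto
    also have "\<dots> = - (a\<^sup>2 / L)" using L by (simp add: power2_eq_square field_simps)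
    also have "\<dots> < 0" using a L(1) by simp
    finally show False by simp
  qed
  have "F h = l2_inner M h \<eta>" if h: "h \<in> ?S" for h
  proof (rule complex_eqI)
    show "Re (F h) = Re (l2_inner M h \<eta>)"
      using stat[OF h] by (subst l2_inner_cnj) simp
    \<comment> \<open>Real parts are settled for every \<open>h\<close>; the imaginary part is the
      real part at \<open>- \<i> * h\<close>.\<close>
    have "Re (l2_inner M \<eta> (\<lambda>x. - \<i> * h x)) = Re (F (\<lambda>x. - \<i> * h x))"
      by (rule stat[OF square_integrable_scale[OF h]])
    then have "Re (\<i> * l2_inner M \<eta> h) = Re (- \<i> * F h)"
      using scale[OF h, of "- \<i>"] l2_inner_scale_right[of M \<eta> "- \<i>" h] by simp
    then show "Im (F h) = Im (l2_inner M h \<eta>)"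
      by (subst l2_inner_cnj) simp
  qed
  with \<eta> show ?thesis by blast
qed

text \<open>The difference \<open>f - h\<close> itself serves as the test vector.\<close>

lemma AE_eq_if_l2_inner_eq:
  assumes f: "f \<in> square_integrable M" and h: "h \<in> square_integrable M"
    and eq: "\<And>\<eta>. \<eta> \<in> square_integrable M \<Longrightarrow> l2_inner M f \<eta> = l2_inner M h \<eta>"
  shows "AE x in M. f x = h x"
proof -
  let ?d = "\<lambda>x. f x - h x"
  have d: "?d \<in> square_integrable M" using f h by (rule square_integrable_diff)
  have "(l2_norm M ?d)\<^sup>2 = 0"
    using l2_inner_self[of M ?d] l2_inner_diff_left[OF f h d] eq[OF d] by simp
  then have "AE x in M. (cmod (?d x))\<^sup>2 = 0"
    using integral_nonneg_eq_0_iff_AE[OF square_integrable_integrable[OF d]]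
    by (simp add: l2_norm_squared)
  then show ?thesis by eventually_elim simp
qed

lemma l2_inner_cong_AE:
  assumes "f \<in> square_integrable M" "h \<in> square_integrable M" "\<eta> \<in> square_integrable M"
    and "AE x in M. f x = h x"
  shows "l2_inner M f \<eta> = l2_inner M h \<eta>"
  unfolding l2_inner_def
proof (rule integral_cong_AE)
  show "AE x in M. f x * cnj (\<eta> x) = h x * cnj (\<eta> x)"
    using assms(4) by eventually_elim simp
qed (use assms(1-3)[THEN square_integrable_measurable] in auto)

text \<open>Riesz's theorem for the functional that sends \<open>f\<close> to the inner product of
  \<open>T f\<close> with \<open>\<eta>\<close>. Operators act on representatives and are linear
  almost everywhere only, which the inner product does not see.\<close>

lemma bounded_operator_adjoint:
  assumes T: "T \<in> bounded_operators M" and \<eta>: "\<eta> \<in> square_integrable M"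
  shows "\<exists>\<zeta>\<in>square_integrable M. \<forall>f\<in>square_integrable M. l2_inner M (T f) \<eta> = l2_inner M f \<zeta>"
proof -
  note T = T[unfolded bounded_operators_def, simplified]
  from T obtain C where C: "\<And>f. f \<in> square_integrable M \<Longrightarrow> l2_norm M (T f) \<le> C * l2_norm M f"
    by blast
  have sq: "T f \<in> square_integrable M" if "f \<in> square_integrable M" for f
    using T that by blast
  show ?thesis
  proof (rule l2_Riesz)
    fix f h assume f: "f \<in> square_integrable M" and h: "h \<in> square_integrable M"
    have "AE x in M. T (\<lambda>y. f y + h y) x = T f x + T h x" using T f h by blast
    then have "l2_inner M (T (\<lambda>x. f x + h x)) \<eta> = l2_inner M (\<lambda>x. T f x + T h x) \<eta>"
      using f h \<eta> sq by (intro l2_inner_cong_AE) (auto intro: square_integrable_add)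
    then show "l2_inner M (T (\<lambda>x. f x + h x)) \<eta> = l2_inner M (T f) \<eta> + l2_inner M (T h) \<eta>"
      using f h \<eta> sq by (simp add: l2_inner_add_left)
  next
    fix c f assume f: "f \<in> square_integrable M"
    have "AE x in M. T (\<lambda>y. c * f y) x = c * T f x" using T f by blast
    then have "l2_inner M (T (\<lambda>x. c * f x)) \<eta> = l2_inner M (\<lambda>x. c * T f x) \<eta>"
      using f \<eta> sq by (intro l2_inner_cong_AE) (auto intro: square_integrable_scale)
    then show "l2_inner M (T (\<lambda>x. c * f x)) \<eta> = c * l2_inner M (T f) \<eta>"
      by (simp add: l2_inner_scale_left)
  next
    fix f assume f: "f \<in> square_integrable M"
    show "cmod (l2_inner M (T f) \<eta>) \<le> (C * l2_norm M \<eta>) * l2_norm M f"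
      using order_trans[OF l2_inner_Cauchy_Schwarz[OF sq[OF f] \<eta>]
          mult_right_mono[OF C[OF f], of "l2_norm M \<eta>"]] by (simp add: mult_ac)
  qed
qed

section \<open>Operators in the group von Neumann algebra\<close>

text \<open>Functionals will be evaluated on this function and not on the pair of vectors, so that
  pairs with the same coefficient automatically receive the same value. The proof that the limit
  operator lies in the double commutant rests on this.\<close>

definition coefficient ::
  "('g, 'm) monoid_scheme \<Rightarrow> 'g measure \<Rightarrow> ('g \<Rightarrow> complex) \<Rightarrow> ('g \<Rightarrow> complex) \<Rightarrow> 'g \<Rightarrow> complex" where
  "coefficient G \<mu> \<xi> \<eta> = (\<lambda>g. l2_inner \<mu> (left_regular G g \<xi>) \<eta>)"

lemma bounded_operator_from_form:
  fixes L :: "('a \<Rightarrow> complex) \<Rightarrow> ('a \<Rightarrow> complex) \<Rightarrow> complex"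
  assumes add1: "\<And>f h \<eta>. f \<in> square_integrable M \<Longrightarrow> h \<in> square_integrable M \<Longrightarrow>
      \<eta> \<in> square_integrable M \<Longrightarrow> L (\<lambda>x. f x + h x) \<eta> = L f \<eta> + L h \<eta>"
    and scale1: "\<And>c f \<eta>. f \<in> square_integrable M \<Longrightarrow> \<eta> \<in> square_integrable M \<Longrightarrow>
      L (\<lambda>x. c * f x) \<eta> = c * L f \<eta>"
    and add2: "\<And>f \<eta> \<zeta>. f \<in> square_integrable M \<Longrightarrow> \<eta> \<in> square_integrable M \<Longrightarrow>
      \<zeta> \<in> square_integrable M \<Longrightarrow> L f (\<lambda>x. \<eta> x + \<zeta> x) = L f \<eta> + L f \<zeta>"
    and scale2: "\<And>c f \<eta>. f \<in> square_integrable M \<Longrightarrow> \<eta> \<in> square_integrable M \<Longrightarrow>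
      L f (\<lambda>x. c * \<eta> x) = cnj c * L f \<eta>"
    and bound: "\<And>f \<eta>. f \<in> square_integrable M \<Longrightarrow> \<eta> \<in> square_integrable M \<Longrightarrow>
      cmod (L f \<eta>) \<le> C * l2_norm M f * l2_norm M \<eta>"
    and C: "0 \<le> C"
  shows "\<exists>S\<in>bounded_operators M. \<forall>f\<in>square_integrable M. \<forall>\<eta>\<in>square_integrable M.
    l2_inner M (S f) \<eta> = L f \<eta>"
proof -
  let ?S = "square_integrable M"
  \<comment> \<open>The form is conjugate-linear in its second argument, so its conjugate is a
    functional to which Riesz's theorem applies.\<close>
  have "\<exists>s\<in>?S. \<forall>\<eta>\<in>?S. cnj (L f \<eta>) = l2_inner M \<eta> s" if f: "f \<in> ?S" for f
    by (rule l2_Riesz[where C = "C * l2_norm M f"]) (simp_all add: f add2 scale2 bound)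
  then obtain S where S: "\<And>f. f \<in> ?S \<Longrightarrow> S f \<in> ?S"
    and SL: "\<And>f \<eta>. f \<in> ?S \<Longrightarrow> \<eta> \<in> ?S \<Longrightarrow> cnj (L f \<eta>) = l2_inner M \<eta> (S f)"
    by metis
  have SL: "l2_inner M (S f) \<eta> = L f \<eta>" if "f \<in> ?S" "\<eta> \<in> ?S" for f \<eta>
    using SL[OF that] l2_inner_cnj[of M "S f" \<eta>] by simp (metis complex_cnj_cnj)
  have norm: "l2_norm M (S f) \<le> C * l2_norm M f" if f: "f \<in> ?S" for f
  proof -
    have "(l2_norm M (S f))\<^sup>2 = cmod (L f (S f))"
      using SL[OF f S[OF f]] l2_inner_self[of M "S f"] by (metis norm_of_real abs_of_nonneg zero_le_power2)
    also have "\<dots> \<le> (C * l2_norm M f) * l2_norm M (S f)" by (rule bound[OF f S[OF f]])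
    finally show ?thesis using C l2_norm_nonneg[of M "S f"] l2_norm_nonneg[of M f]
      by (cases "l2_norm M (S f) = 0") (simp_all add: power2_eq_square)
  qed
  have "S \<in> bounded_operators M"
    unfolding bounded_operators_def
  proof (intro CollectI conjI ballI allI)
    fix f h assume f: "f \<in> ?S" and h: "h \<in> ?S"
    show "AE x in M. S (\<lambda>y. f y + h y) x = S f x + S h x"
      using f h by (intro AE_eq_if_l2_inner_eq)
        (simp_all add: S square_integrable_add SL add1 l2_inner_add_left)
  next
    fix c f assume f: "f \<in> ?S"
    show "AE x in M. S (\<lambda>y. c * f y) x = c * S f x"
      using f by (intro AE_eq_if_l2_inner_eq)
        (simp_all add: S square_integrable_scale SL scale1 l2_inner_scale_left)
  qed (use S norm in auto)
  with SL show ?thesis by blast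
qed

text \<open>Tychonoff's theorem in the product of the discs of radius \<open>r p\<close>. The index
  set will consist of pairs of vectors and is too large for a subsequence that converges at every
  index. A cluster point still inherits every closed condition: the bounds, the linear relations,
  and those limits that exist.\<close>

lemma pointwise_cluster_point:
  fixes b :: "nat \<Rightarrow> 'p \<Rightarrow> complex"
  assumes bound: "\<And>n p. cmod (b n p) \<le> r p"
  shows "\<exists>L. (\<forall>p. cmod (L p) \<le> r p) \<and>
    (\<forall>a a' p q q'. (\<forall>n. b n p = a * b n q + a' * b n q') \<longrightarrow> L p = a * L q + a' * L q') \<and>
    (\<forall>p c. (\<lambda>n. b n p) \<longlonglongrightarrow> c \<longrightarrow> L p = c)"
proof -
  let ?K = "PiE UNIV (\<lambda>p. cball (0 :: complex) (r p))"
  let ?F = "filtermap b sequentially"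
  have "compactin (product_topology (\<lambda>p. euclidean) UNIV) ?K"
    unfolding compactin_PiE by simp
  then have "compact ?K" by (simp add: euclidean_product_topology)
  moreover have "?F \<noteq> bot" by (simp add: filtermap_bot_iff)
  moreover have "eventually (\<lambda>x. x \<in> ?K) ?F"
    using bound by (auto simp: eventually_filtermap PiE_def Pi_def)
  ultimately obtain L where L: "L \<in> ?K" and ne: "inf (nhds L) ?F \<noteq> bot"
    unfolding compact_filter by blast
  \<comment> \<open>Along \<open>?G\<close> the evaluations tend to \<open>L p\<close>, and whatever
    holds for all \<open>b n\<close> holds eventually; as \<open>?G\<close> is proper, limits along
    it are unique.\<close>
  let ?G = "inf (nhds L) ?F"
  have lim: "((\<lambda>f. f p) \<longlongrightarrow> L p) ?G" for p
  proof -
    have "((\<lambda>f. f p) \<longlongrightarrow> L p) (nhds L)"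
    proof (rule topological_tendstoI)
      fix U :: "complex set" assume U: "open U" "L p \<in> U"
      have "open ((\<lambda>f :: 'p \<Rightarrow> complex. f p) -` U)"
        by (rule open_vimage[OF U(1) continuous_on_product_coordinates])
      then show "\<forall>\<^sub>F f in nhds L. f p \<in> U" unfolding eventually_nhds using U(2) by blast
    qed
    then show ?thesis by (rule tendsto_mono[OF inf_le1])
  qed
  have ev: "eventually P ?G" if "\<And>n. P (b n)" for P
    using that by (intro filter_leD[OF inf_le2]) (simp add: eventually_filtermap)
  have rel: "L p = a * L q + a' * L q'" if "\<And>n. b n p = a * b n q + a' * b n q'" for a a' p q q'
  proof (rule tendsto_unique[OF ne lim])
    have "((\<lambda>f. a * f q + a' * f q') \<longlongrightarrow> a * L q + a' * L q') ?G"
      by (intro tendsto_intros lim)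
    moreover have "\<forall>\<^sub>F f in ?G. a * f q + a' * f q' = f p" by (rule ev) (simp add: that)
    ultimately show "((\<lambda>f. f p) \<longlongrightarrow> a * L q + a' * L q') ?G"
      by (rule Lim_transform_eventually)
  qed
  have conv: "L p = c" if "(\<lambda>n. b n p) \<longlonglongrightarrow> c" for p c
  proof (rule tendsto_unique[OF ne lim])
    have "((\<lambda>f. f p) \<longlongrightarrow> c) ?F" using that by (simp add: filterlim_filtermap)
    then show "((\<lambda>f. f p) \<longlongrightarrow> c) ?G" by (rule tendsto_mono[OF inf_le2])
  qed
  have "cmod (L p) \<le> r p" for p using L by (auto simp: PiE_def Pi_def)
  with rel conv show ?thesis by blast
qed

text \<open>A uniformly bounded sequence of forms \<open>\<Phi>\<^sub>n(\<langle>\<lambda>(\<cdot>)\<xi>|\<eta>\<rangle>)\<close> has a pointwise cluster point, which is the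
  form of an operator. It belongs to the double commutant because an operator \<open>R\<close> commuting with
  the left translations satisfies \<open>\<langle>\<lambda>(\<cdot>)R\<xi>|\<eta>\<rangle> = \<langle>\<lambda>(\<cdot>)\<xi>|R\<^sup>*\<eta>\<rangle>\<close>.\<close>

theorem group_vN_from_functionals:
  fixes G :: "('g, 'm) monoid_scheme" and \<Phi> :: "nat \<Rightarrow> ('g \<Rightarrow> complex) \<Rightarrow> complex"
  assumes carrier: "carrier G = UNIV"
    and lr: "\<And>g \<xi>. \<xi> \<in> square_integrable \<mu> \<Longrightarrow> left_regular G g \<xi> \<in> square_integrable \<mu>"
    and add1: "\<And>n f h \<eta>. f \<in> square_integrable \<mu> \<Longrightarrow> h \<in> square_integrable \<mu> \<Longrightarrow>
      \<eta> \<in> square_integrable \<mu> \<Longrightarrow> \<Phi> n (coefficient G \<mu> (\<lambda>x. f x + h x) \<eta>)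
        = \<Phi> n (coefficient G \<mu> f \<eta>) + \<Phi> n (coefficient G \<mu> h \<eta>)"
    and scale1: "\<And>n c f \<eta>. f \<in> square_integrable \<mu> \<Longrightarrow> \<eta> \<in> square_integrable \<mu> \<Longrightarrow>
      \<Phi> n (coefficient G \<mu> (\<lambda>x. c * f x) \<eta>) = c * \<Phi> n (coefficient G \<mu> f \<eta>)"
    and add2: "\<And>n f \<eta> \<zeta>. f \<in> square_integrable \<mu> \<Longrightarrow> \<eta> \<in> square_integrable \<mu> \<Longrightarrow>
      \<zeta> \<in> square_integrable \<mu> \<Longrightarrow> \<Phi> n (coefficient G \<mu> f (\<lambda>x. \<eta> x + \<zeta> x))
        = \<Phi> n (coefficient G \<mu> f \<eta>) + \<Phi> n (coefficient G \<mu> f \<zeta>)"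
    and scale2: "\<And>n c f \<eta>. f \<in> square_integrable \<mu> \<Longrightarrow> \<eta> \<in> square_integrable \<mu> \<Longrightarrow>
      \<Phi> n (coefficient G \<mu> f (\<lambda>x. c * \<eta> x)) = cnj c * \<Phi> n (coefficient G \<mu> f \<eta>)"
    and bound: "\<And>n f \<eta>. f \<in> square_integrable \<mu> \<Longrightarrow> \<eta> \<in> square_integrable \<mu> \<Longrightarrow>
      cmod (\<Phi> n (coefficient G \<mu> f \<eta>)) \<le> C * l2_norm \<mu> f * l2_norm \<mu> \<eta>"
    and C: "0 \<le> C"
  shows "\<exists>S\<in>group_vN G \<mu>. \<forall>\<xi>\<in>square_integrable \<mu>. \<forall>\<eta>\<in>square_integrable \<mu>. \<forall>c.
    (\<lambda>n. \<Phi> n (coefficient G \<mu> \<xi> \<eta>)) \<longlonglongrightarrow> c \<longrightarrow> l2_inner \<mu> (S \<xi>) \<eta> = c"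
proof -
  let ?S = "square_integrable \<mu>"
  \<comment> \<open>Extended by 0, so that the bound required by the compactness argument holds at
    every pair of functions, square-integrable or not.\<close>
  define b where "b n p = (if fst p \<in> ?S \<and> snd p \<in> ?S
      then \<Phi> n (coefficient G \<mu> (fst p) (snd p)) else 0)" for n p
  have b: "b n (\<xi>, \<eta>) = \<Phi> n (coefficient G \<mu> \<xi> \<eta>)" if "\<xi> \<in> ?S" "\<eta> \<in> ?S" for n \<xi> \<eta>
    using that by (simp add: b_def)
  have "cmod (b n p) \<le> C * l2_norm \<mu> (fst p) * l2_norm \<mu> (snd p)" for n p
    using bound[of "fst p" "snd p" n] C by (auto simp: b_def)
  from pointwise_cluster_point[of b, OF this]
  obtain L where L: "\<And>p. cmod (L p) \<le> C * l2_norm \<mu> (fst p) * l2_norm \<mu> (snd p)"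
    and rel: "\<And>a a' p q q'. (\<And>n. b n p = a * b n q + a' * b n q') \<Longrightarrow> L p = a * L q + a' * L q'"
    and conv: "\<And>p c. (\<lambda>n. b n p) \<longlonglongrightarrow> c \<Longrightarrow> L p = c"
    by blast
  have "\<exists>S\<in>bounded_operators \<mu>. \<forall>f\<in>?S. \<forall>\<eta>\<in>?S. l2_inner \<mu> (S f) \<eta> = L (f, \<eta>)"
  proof (rule bounded_operator_from_form)
    fix f h \<eta> assume "f \<in> ?S" "h \<in> ?S" "\<eta> \<in> ?S"
    then show "L (\<lambda>x. f x + h x, \<eta>) = L (f, \<eta>) + L (h, \<eta>)"
      using rel[of "(\<lambda>x. f x + h x, \<eta>)" 1 "(f, \<eta>)" 1 "(h, \<eta>)"]
      by (simp add: b square_integrable_add add1)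
    from \<open>f \<in> ?S\<close> \<open>h \<in> ?S\<close> \<open>\<eta> \<in> ?S\<close> show "L (f, \<lambda>x. h x + \<eta> x) = L (f, h) + L (f, \<eta>)"
      using rel[of "(f, \<lambda>x. h x + \<eta> x)" 1 "(f, h)" 1 "(f, \<eta>)"]
      by (simp add: b square_integrable_add add2)
  next
    fix c f \<eta> assume "f \<in> ?S" "\<eta> \<in> ?S"
    then show "L (\<lambda>x. c * f x, \<eta>) = c * L (f, \<eta>)" "L (f, \<lambda>x. c * \<eta> x) = cnj c * L (f, \<eta>)"
      using rel[of "(\<lambda>x. c * f x, \<eta>)" c "(f, \<eta>)" 0 "(f, \<eta>)"]
        rel[of "(f, \<lambda>x. c * \<eta> x)" "cnj c" "(f, \<eta>)" 0 "(f, \<eta>)"]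
      by (simp_all add: b square_integrable_scale scale1 scale2)
  next
    fix f \<eta> show "cmod (L (f, \<eta>)) \<le> C * l2_norm \<mu> f * l2_norm \<mu> \<eta>" using L[of "(f, \<eta>)"] by simp
  qed (rule C)
  then obtain S where S: "S \<in> bounded_operators \<mu>"
    and SL: "\<And>f \<eta>. f \<in> ?S \<Longrightarrow> \<eta> \<in> ?S \<Longrightarrow> l2_inner \<mu> (S f) \<eta> = L (f, \<eta>)"
    by blast
  have Ssq: "S f \<in> ?S" if "f \<in> ?S" for f using S that by (simp add: bounded_operators_def)
  have "S \<in> group_vN G \<mu>"
    unfolding group_vN_def commutant_def[of \<mu> "commutant _ _"]
  proof (intro CollectI conjI ballI S)
    fix R f assume R: "R \<in> commutant \<mu> (left_regular G ` carrier G)" and f: "f \<in> ?S"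
    then have Rb: "R \<in> bounded_operators \<mu>" by (simp add: commutant_def)
    have Rsq: "R h \<in> ?S" if "h \<in> ?S" for h using Rb that by (simp add: bounded_operators_def)
    show "AE x in \<mu>. S (R f) x = R (S f) x"
    proof (rule AE_eq_if_l2_inner_eq)
      fix \<eta> assume \<eta>: "\<eta> \<in> ?S"
      from bounded_operator_adjoint[OF Rb \<eta>] obtain \<zeta> where \<zeta>: "\<zeta> \<in> ?S"
        and adj: "\<And>h. h \<in> ?S \<Longrightarrow> l2_inner \<mu> (R h) \<eta> = l2_inner \<mu> h \<zeta>" by blast
      have "coefficient G \<mu> (R f) \<eta> = coefficient G \<mu> f \<zeta>"
        unfolding coefficient_def
      proof
        fix g
        have "AE x in \<mu>. R (left_regular G g f) x = left_regular G g (R f) x"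
          using R f by (simp add: commutant_def carrier)
        then have "l2_inner \<mu> (R (left_regular G g f)) \<eta> = l2_inner \<mu> (left_regular G g (R f)) \<eta>"
          by (intro l2_inner_cong_AE Rsq lr f \<eta>)
        then show "l2_inner \<mu> (left_regular G g (R f)) \<eta> = l2_inner \<mu> (left_regular G g f) \<zeta>"
          by (simp add: adj lr f)
      qed
      then have "L (R f, \<eta>) = L (f, \<zeta>)"
        using rel[of "(R f, \<eta>)" 1 "(f, \<zeta>)" 0 "(f, \<zeta>)"] by (simp add: b Rsq f \<eta> \<zeta>)
      then show "l2_inner \<mu> (S (R f)) \<eta> = l2_inner \<mu> (R (S f)) \<eta>"
        by (simp add: SL Rsq f \<eta> \<zeta> adj Ssq)
    qed (simp_all add: Rsq Ssq f)
  qed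
  moreover have "l2_inner \<mu> (S \<xi>) \<eta> = c"
    if "\<xi> \<in> ?S" "\<eta> \<in> ?S" "(\<lambda>n. \<Phi> n (coefficient G \<mu> \<xi> \<eta>)) \<longlonglongrightarrow> c" for \<xi> \<eta> c
    using conv[of "(\<xi>, \<eta>)" c] that by (simp add: SL b)
  ultimately show ?thesis by blast
qed

text \<open>The definite description is resolved for a single \<open>u\<close> by computing the same
  value \<open>c\<close> from every representation of it, which also settles uniqueness.\<close>

lemma vN_pairing_eqI:
  assumes "u \<in> fourier_algebra G \<mu>"
    and "\<And>\<xi> \<eta>. represents G \<mu> \<xi> \<eta> u \<Longrightarrow> l2_inner \<mu> (T \<xi>) \<eta> = c"
  shows "vN_pairing G \<mu> T u = c"
  unfolding vN_pairing_def
proof (rule the_equality)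
  obtain \<xi> \<eta> where "represents G \<mu> \<xi> \<eta> u" using assms(1) by (auto simp: fourier_algebra_def)
  then show "\<exists>\<xi> \<eta>. represents G \<mu> \<xi> \<eta> u \<and> c = l2_inner \<mu> (T \<xi>) \<eta>" using assms(2) by metis
qed (use assms(2) in auto)

lemma measurable_matrix_vector_mult [measurable (raw)]:
  fixes A :: "real^'n^'m"
  shows "f \<in> borel_measurable M \<Longrightarrow> (\<lambda>x. A *v f x) \<in> borel_measurable M"
  by (rule borel_measurable_continuous_on[of "\<lambda>x. A *v x"])
    (intro matrix_vector_mult_linear_continuous_on)

section \<open>The Haar measure of the Grelaud groups\<close>

lemma grelaud_tau_mult:
  "grelaud_tau \<theta> s *v x = exp s *\<^sub>R (\<chi> i. if i = 1 then cos (s * \<theta>) * x $ 1 - sin (s * \<theta>) * x $ 2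
    else sin (s * \<theta>) * x $ 1 + cos (s * \<theta>) * x $ 2)"
  by (simp add: vec_eq_iff forall_2 grelaud_tau_def matrix_vector_mult_def sum_2 algebra_simps)

lemma continuous_on_grelaud_tau_mult [continuous_intros]:
  fixes S :: "'a::t2_space set"
  assumes "continuous_on S s" "continuous_on S f"
  shows "continuous_on S (\<lambda>x. grelaud_tau \<theta> (s x) *v f x)"
  unfolding grelaud_tau_mult
proof (intro continuous_intros assms)
  fix i :: 2
  have s\<theta>: "continuous_on S (\<lambda>x. s x * \<theta>)" by (intro continuous_on_mult_right assms)
  note [continuous_intros] = continuous_on_cos[OF s\<theta>] continuous_on_sin[OF s\<theta>]
  show "continuous_on S (\<lambda>x. if i = 1 then cos (s x * \<theta>) * f x $ 1 - sin (s x * \<theta>) * f x $ 2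
      else sin (s x * \<theta>) * f x $ 1 + cos (s x * \<theta>) * f x $ 2)"
    by (cases "i = 1") (auto intro!: continuous_intros assms)
qed

lemma grelaud_tau_inverse [simp]:
  "grelaud_tau \<theta> (- s) *v (grelaud_tau \<theta> s *v x) = x"
  "grelaud_tau \<theta> s *v (grelaud_tau \<theta> (- s) *v x) = x"
  using grelaud_tau_add[of \<theta> s "-s"] grelaud_tau_add[of \<theta> "-s" s]
  by (simp_all add: matrix_vector_mul_assoc) (metis matrix_vector_mul_lid)+

text \<open>The matrix is \<open>exp s\<close> times a rotation. The value does not involve
  \<open>\<theta>\<close>, so the formula also serves the transposes, which are the matrices for
  \<open>- \<theta>\<close>.\<close>

lemma norm_grelaud_tau: "norm (grelaud_tau \<theta> s *v x) = exp s * norm x"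
proof -
  define C D where "C = cos (s * \<theta>)" and "D = sin (s * \<theta>)"
  have CD: "C\<^sup>2 + D\<^sup>2 = 1" by (simp add: C_def D_def)
  have "(norm (grelaud_tau \<theta> s *v x))\<^sup>2 = (exp s)\<^sup>2 * ((C\<^sup>2 + D\<^sup>2) * ((x$1)\<^sup>2 + (x$2)\<^sup>2))"
    unfolding power2_norm_eq_inner grelaud_tau_mult C_def[symmetric] D_def[symmetric]
    by (simp add: inner_vec_def sum_2 power2_eq_square algebra_simps)
  also have "\<dots> = (exp s * norm x)\<^sup>2"
    by (simp add: CD power_mult_distrib power2_norm_eq_inner inner_vec_def sum_2 flip: power2_eq_square)
  finally show ?thesis by (simp add: power2_eq_iff_nonneg)
qed

lemma det_grelaud_tau: "det (grelaud_tau \<theta> s) = exp (2 * s)"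
proof -
  define C D where "C = cos (s * \<theta>)" and "D = sin (s * \<theta>)"
  have CD: "C\<^sup>2 + D\<^sup>2 = 1" by (simp add: C_def D_def)
  have "det (grelaud_tau \<theta> s) = exp s * exp s * (C\<^sup>2 + D\<^sup>2)"
    unfolding det_2 grelaud_tau_def C_def[symmetric] D_def[symmetric]
    by (simp add: power2_eq_square algebra_simps)
  then show ?thesis by (simp add: CD flip: exp_add)
qed

text \<open>The determinant enters as a density of the image measure. Boxes suffice for the
  comparison because they determine \<open>lborel\<close>.\<close>

lemma lborel_grelaud_tau:
  "lborel = density (distr lborel borel (\<lambda>x. grelaud_tau \<theta> s *v x)) (\<lambda>_. ennreal (exp (2 * s)))"
proof (rule lborel_eqI)
  fix l u :: "real^2" assume le: "\<And>b. b \<in> Basis \<Longrightarrow> l \<bullet> b \<le> u \<bullet> b"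
  let ?f = "\<lambda>x. grelaud_tau \<theta> (- s) *v x"
  have vimage: "(\<lambda>x. grelaud_tau \<theta> s *v x) -` box l u = ?f ` box l u" (is "?V = _")
    by (auto simp: image_iff) (metis grelaud_tau_inverse(1))
  have "(\<lambda>x. grelaud_tau \<theta> s *v x) \<in> borel \<rightarrow>\<^sub>M borel" by measurable
  from measurable_sets[OF this, of "box l u"] have [measurable]: "?V \<in> sets borel" by simp
  have lin: "linear ?f" by (rule matrix_vector_mul_linear)
  have meas: "measure lebesgue (?f ` box l u) = \<bar>det (matrix ?f)\<bar> * measure lebesgue (box l u)"
    using lin by (intro measure_linear_image) auto
  have "?V \<in> lmeasurable" unfolding vimage
    using lin by (intro measurable_linear_image) auto
  then have "emeasure lebesgue ?V = ennreal (measure lebesgue ?V)"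
    by (intro emeasure_eq_ennreal_measure fmeasurableD2)
  then have "emeasure lborel ?V = ennreal (measure lebesgue ?V)" by simp
  also have "measure lebesgue ?V = exp (- (2 * s)) * measure lborel (box l u)"
    unfolding vimage meas by (simp add: det_grelaud_tau)
  finally have V: "emeasure lborel ?V = ennreal (exp (- (2 * s)) * measure lborel (box l u))" .
  have "emeasure (density (distr lborel borel (\<lambda>x. grelaud_tau \<theta> s *v x)) (\<lambda>_. ennreal (exp (2 * s))))
    (box l u)
      = ennreal (exp (2 * s)) * emeasure lborel ?V"
    by (subst emeasure_density_const) (auto simp: emeasure_distr)
  also have "\<dots> = ennreal (measure lborel (box l u))"
    unfolding V by (simp add: mult.assoc[symmetric] flip: ennreal_mult exp_add)
  also have "\<dots> = ennreal (\<Prod>b\<in>Basis. (u - l) \<bullet> b)"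
    using le by (simp add: measure_lborel_box_eq)
  finally show "emeasure (density (distr lborel borel (\<lambda>x. grelaud_tau \<theta> s *v x))
    (\<lambda>_. ennreal (exp (2 * s)))) (box l u)
      = (\<Prod>b\<in>Basis. (u - l) \<bullet> b)" .
qed simp

lemma nn_integral_grelaud_tau:
  assumes [measurable]: "f \<in> borel_measurable borel"
  shows "(\<integral>\<^sup>+x. f (c + grelaud_tau \<theta> s *v x) \<partial>lborel) = ennreal (exp (- 2 * s)) * (\<integral>\<^sup>+x. f x \<partial>lborel)"
proof -
  have "(\<integral>\<^sup>+x. f x \<partial>lborel) = (\<integral>\<^sup>+x. f (c + x) \<partial>lborel)"
    by (subst lborel_distr_plus[of c, symmetric]) (simp add: nn_integral_distr)
  also have "\<dots> = ennreal (exp (2 * s)) * (\<integral>\<^sup>+x. f (c + grelaud_tau \<theta> s *v x) \<partial>lborel)"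
    by (subst lborel_grelaud_tau[of \<theta> s]) (simp add: nn_integral_density nn_integral_distr nn_integral_cmult)
  finally have "ennreal (exp (- 2 * s)) * (\<integral>\<^sup>+x. f x \<partial>lborel)
      = (ennreal (exp (- 2 * s)) * ennreal (exp (2 * s))) * (\<integral>\<^sup>+x. f (c + grelaud_tau \<theta> s *v x) \<partial>lborel)"
    by (simp add: mult.assoc)
  also have "ennreal (exp (- 2 * s)) * ennreal (exp (2 * s)) = 1"
    by (simp flip: ennreal_mult exp_add)
  finally show ?thesis by simp
qed

lemma distr_eqI_nn_integral:
  assumes [measurable]: "T \<in> M \<rightarrow>\<^sub>M M"
    and eq: "\<And>f. f \<in> borel_measurable M \<Longrightarrow> (\<integral>\<^sup>+x. f (T x) \<partial>M) = (\<integral>\<^sup>+x. f x \<partial>M)"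
  shows "distr M M T = M"
proof (rule measure_eqI)
  fix A assume "A \<in> sets (distr M M T)"
  then have A [measurable]: "A \<in> sets M" by simp
  have "emeasure (distr M M T) A = (\<integral>\<^sup>+x. indicator A x \<partial>distr M M T)" by simp
  also have "\<dots> = (\<integral>\<^sup>+x. indicator A (T x) \<partial>M)" by (rule nn_integral_distr) auto
  also have "\<dots> = (\<integral>\<^sup>+x. indicator A x \<partial>M)" by (rule eq) auto
  finally show "emeasure (distr M M T) A = emeasure M A" by simp
qed simp

text \<open>The Jacobians \<open>exp (2 s)\<close> and \<open>exp (- 2 s)\<close> of the two factors cancel.\<close>

lemma distr_grelaud_tau_pair:
  "distr lborel lborel (\<lambda>(a, b). (c + grelaud_tau \<theta> s *v a, d + grelaud_tau \<theta>' (- s) *v b)) = lborel"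
    (is "distr lborel lborel ?T = _")
proof (rule distr_eqI_nn_integral)
  have [measurable]: "?T \<in> borel \<rightarrow>\<^sub>M borel"
    by (subst borel_prod[symmetric])+ measurable
  show "?T \<in> lborel \<rightarrow>\<^sub>M lborel" by simp
  fix f :: "(real^2) \<times> (real^2) \<Rightarrow> ennreal" assume "f \<in> borel_measurable lborel"
  then have [measurable]: "f \<in> borel_measurable (borel \<Otimes>\<^sub>M borel)" by (simp add: borel_prod)
  have "(\<integral>\<^sup>+z. f (?T z) \<partial>lborel) = (\<integral>\<^sup>+a. \<integral>\<^sup>+b. f (c + grelaud_tau \<theta> s *v a, d + grelaud_tau \<theta>' (- s) *v b)
    \<partial>lborel \<partial>lborel)"
    by (subst lborel_prod[symmetric], subst lborel.nn_integral_fst[symmetric]) auto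
  also have "\<dots> = (\<integral>\<^sup>+a. ennreal (exp (2 * s)) * (\<integral>\<^sup>+b. f (c + grelaud_tau \<theta> s *v a, b) \<partial>lborel) \<partial>lborel)"
    by (subst nn_integral_grelaud_tau[of "\<lambda>b. f (_, b)"]) auto
  also have "\<dots> = ennreal (exp (2 * s)) * (ennreal (exp (- 2 * s)) * (\<integral>\<^sup>+a. \<integral>\<^sup>+b. f (a, b) \<partial>lborel \<partial>lborel))"
    by (subst nn_integral_cmult) (auto simp: nn_integral_grelaud_tau[of "\<lambda>a. \<integral>\<^sup>+b. f (a, b) \<partial>lborel"])
  also have "\<dots> = (\<integral>\<^sup>+a. \<integral>\<^sup>+b. f (a, b) \<partial>lborel \<partial>lborel)"
    by (simp add: mult.assoc[symmetric] flip: ennreal_mult exp_add)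
  also have "\<dots> = (\<integral>\<^sup>+z. f z \<partial>lborel)"
    unfolding lborel_prod[symmetric, where 'a = "real^2" and 'b = "real^2"]
    by (subst lborel.nn_integral_fst[symmetric]) auto
  finally show "(\<integral>\<^sup>+z. f (?T z) \<partial>lborel) = (\<integral>\<^sup>+z. f z \<partial>lborel)" .
qed

lemma measurable_grelaud_density [measurable]:
  "(\<lambda>(x, s). ennreal (exp (- 2 * s))) \<in> borel_measurable (lborel :: ((real^2) \<times> real) measure)"
  by (subst lborel_prod[symmetric]) measurable

lemma sets_grelaud_haar [simp, measurable_cong]: "sets grelaud_haar = sets borel"
  by (simp add: grelaud_haar_def)

lemma space_grelaud_haar [simp]: "space grelaud_haar = UNIV"
  by (simp add: grelaud_haar_def)

lemma sigma_finite_grelaud_haar: "sigma_finite_measure grelaud_haar"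
  using sigma_finite_measure.sigma_finite_iff_density_finite
    [OF sigma_finite_lborel measurable_grelaud_density]
  unfolding grelaud_haar_def by (simp add: case_prod_beta)

lemma nn_integral_grelaud_haar:
  assumes f: "f \<in> borel_measurable borel"
  shows "(\<integral>\<^sup>+z. f z \<partial>grelaud_haar) = (\<integral>\<^sup>+s. ennreal (exp (- 2 * s)) * (\<integral>\<^sup>+x. f (x, s) \<partial>lborel) \<partial>lborel)"
proof -
  have [measurable]: "f \<in> borel_measurable (borel \<Otimes>\<^sub>M borel)" using f by (simp add: borel_prod)
  have "(\<integral>\<^sup>+z. f z \<partial>grelaud_haar) = (\<integral>\<^sup>+z. (case z of (x, s) \<Rightarrow> ennreal (exp (- 2 * s)) * f (x, s)) \<partial>lborel)"
    unfolding grelaud_haar_def using f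
    by (subst nn_integral_density[OF measurable_grelaud_density])
      (auto intro!: nn_integral_cong)
  also have "\<dots> = (\<integral>\<^sup>+s. \<integral>\<^sup>+x. ennreal (exp (- 2 * s)) * f (x, s) \<partial>lborel \<partial>lborel)"
    by (subst lborel_prod[symmetric], subst lborel_pair.nn_integral_snd[symmetric]) auto
  finally show ?thesis by (simp add: nn_integral_cmult)
qed

lemma measurable_grelaud_mult [measurable]: "(\<lambda>z. g \<otimes>\<^bsub>grelaud \<theta>\<^esub> z) \<in> borel \<rightarrow>\<^sub>M borel"
proof -
  have "(\<lambda>z. g \<otimes>\<^bsub>grelaud \<theta>\<^esub> z) = (\<lambda>(x, s). (fst g + grelaud_tau \<theta> (snd g) *v x, snd g + s))"
    by (cases g) auto
  then show ?thesis by (simp only:) (subst borel_prod[symmetric], subst borel_prod[symmetric], measurable)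
qed

text \<open>The Jacobian \<open>exp (- 2 * s0)\<close> of the plane turns the weight at
  \<open>s\<close> into the weight at \<open>s0 + s\<close>, after which the real line can be
  shifted.\<close>

lemma distr_grelaud_haar: "distr grelaud_haar grelaud_haar (\<lambda>z. g \<otimes>\<^bsub>grelaud \<theta>\<^esub> z) = grelaud_haar"
proof (rule distr_eqI_nn_integral)
  show "(\<lambda>z. g \<otimes>\<^bsub>grelaud \<theta>\<^esub> z) \<in> grelaud_haar \<rightarrow>\<^sub>M grelaud_haar" by measurable
  fix f :: "(real^2) \<times> real \<Rightarrow> ennreal" assume "f \<in> borel_measurable grelaud_haar"
  then have f [measurable]: "f \<in> borel_measurable borel"
    by (simp cong: measurable_cong_sets)
  then have [measurable]: "f \<in> borel_measurable (borel \<Otimes>\<^sub>M borel)" by (simp add: borel_prod)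
  obtain x0 s0 where g: "g = (x0, s0)" by fastforce
  have "(\<integral>\<^sup>+z. f (g \<otimes>\<^bsub>grelaud \<theta>\<^esub> z) \<partial>grelaud_haar)
      = (\<integral>\<^sup>+s. ennreal (exp (- 2 * s)) * (\<integral>\<^sup>+x. f (x0 + grelaud_tau \<theta> s0 *v x, s0 + s) \<partial>lborel) \<partial>lborel)"
    by (subst nn_integral_grelaud_haar) (auto simp: g)
  also have "\<dots> = (\<integral>\<^sup>+s. ennreal (exp (- 2 * (s0 + s))) * (\<integral>\<^sup>+x. f (x, s0 + s) \<partial>lborel) \<partial>lborel)"
  proof (intro nn_integral_cong)
    fix s
    have "ennreal (exp (- 2 * s)) * (ennreal (exp (- 2 * s0)) * I) = ennreal (exp (- 2 * (s0 + s))) * I" for I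
      unfolding mult.assoc[symmetric] ennreal_mult[symmetric, OF exp_ge_zero exp_ge_zero] exp_add[symmetric]
      by (simp add: algebra_simps)
    then show "ennreal (exp (- 2 * s)) * (\<integral>\<^sup>+x. f (x0 + grelaud_tau \<theta> s0 *v x, s0 + s) \<partial>lborel)
        = ennreal (exp (- 2 * (s0 + s))) * (\<integral>\<^sup>+x. f (x, s0 + s) \<partial>lborel)"
      by (subst nn_integral_grelaud_tau[of "\<lambda>x. f (x, s0 + s)"]) auto
  qed
  also have "\<dots> = (\<integral>\<^sup>+s. ennreal (exp (- 2 * s)) * (\<integral>\<^sup>+x. f (x, s) \<partial>lborel) \<partial>lborel)"
    by (subst (2) lborel_distr_plus[of s0, symmetric]) (simp add: nn_integral_distr)
  also have "\<dots> = (\<integral>\<^sup>+z. f z \<partial>grelaud_haar)" by (rule nn_integral_grelaud_haar[symmetric]) measurable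
  finally show "(\<integral>\<^sup>+z. f (g \<otimes>\<^bsub>grelaud \<theta>\<^esub> z) \<partial>grelaud_haar) = (\<integral>\<^sup>+z. f z \<partial>grelaud_haar)" .
qed

abbreviation grelaud2 :: "real \<Rightarrow> (((real^2) \<times> real) \<times> ((real^2) \<times> real)) monoid" where
  "grelaud2 \<theta> \<equiv> grelaud \<theta> \<times>\<times> grelaud \<theta>"

abbreviation haar2 :: "(((real^2) \<times> real) \<times> ((real^2) \<times> real)) measure" where
  "haar2 \<equiv> grelaud_haar \<Otimes>\<^sub>M grelaud_haar"

lemma distr_haar2: "distr haar2 haar2 (\<lambda>z. \<gamma> \<otimes>\<^bsub>grelaud2 \<theta>\<^esub> z) = haar2"
proof -
  interpret sigma_finite_measure grelaud_haar by (rule sigma_finite_grelaud_haar)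
  obtain g h where \<gamma>: "\<gamma> = (g, h)" by (cases \<gamma>)
  have "distr haar2 haar2 (\<lambda>(z, w). (g \<otimes>\<^bsub>grelaud \<theta>\<^esub> z, h \<otimes>\<^bsub>grelaud \<theta>\<^esub> w))
      = distr grelaud_haar grelaud_haar (\<lambda>z. g \<otimes>\<^bsub>grelaud \<theta>\<^esub> z)
        \<Otimes>\<^sub>M distr grelaud_haar grelaud_haar (\<lambda>z. h \<otimes>\<^bsub>grelaud \<theta>\<^esub> z)"
    by (rule pair_measure_distr[symmetric], measurable)
      (simp only: distr_grelaud_haar sigma_finite_grelaud_haar)
  moreover have "(\<lambda>z. \<gamma> \<otimes>\<^bsub>grelaud2 \<theta>\<^esub> z) = (\<lambda>(z, w). (g \<otimes>\<^bsub>grelaud \<theta>\<^esub> z, h \<otimes>\<^bsub>grelaud \<theta>\<^esub> w))"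
    by (auto simp: \<gamma> DirProd_def)
  ultimately show ?thesis by (simp add: distr_grelaud_haar)
qed

lemma carrier_grelaud2 [simp]: "carrier (grelaud2 \<theta>) = UNIV"
  by (simp add: DirProd_def)

lemma sets_haar2: "sets haar2 = sets borel"
  using sets_pair_measure_cong[OF sets_grelaud_haar sets_grelaud_haar]
  by (simp only: borel_prod)

lemma measurable_grelaud2_mult [measurable]: "(\<lambda>z. \<gamma> \<otimes>\<^bsub>grelaud2 \<theta>\<^esub> z) \<in> haar2 \<rightarrow>\<^sub>M haar2"
proof -
  have "(\<lambda>z. \<gamma> \<otimes>\<^bsub>grelaud2 \<theta>\<^esub> z)
      = (\<lambda>(z, w). (fst \<gamma> \<otimes>\<^bsub>grelaud \<theta>\<^esub> z, snd \<gamma> \<otimes>\<^bsub>grelaud \<theta>\<^esub> w))"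
    by (cases \<gamma>) (auto simp: DirProd_def)
  then show ?thesis by (simp only:) measurable
qed

lemma left_regular_grelaud2:
  assumes f: "f \<in> square_integrable haar2"
  shows "left_regular (grelaud2 \<theta>) \<gamma> f \<in> square_integrable haar2"
    and "l2_norm haar2 (left_regular (grelaud2 \<theta>) \<gamma> f) = l2_norm haar2 f"
proof -
  have [measurable]: "f \<in> borel_measurable haar2" using f by (rule square_integrable_measurable)
  let ?T = "\<lambda>z. inv\<^bsub>grelaud2 \<theta>\<^esub> \<gamma> \<otimes>\<^bsub>grelaud2 \<theta>\<^esub> z"
  have T: "?T \<in> haar2 \<rightarrow>\<^sub>M haar2" by (rule measurable_grelaud2_mult)
  have "integrable (distr haar2 haar2 ?T) (\<lambda>x. (cmod (f x))\<^sup>2)"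
    unfolding distr_haar2 by (rule square_integrable_integrable[OF f])
  then have "integrable haar2 (\<lambda>x. (cmod (f (?T x)))\<^sup>2)" by (rule integrable_distr[OF T])
  moreover have "(\<lambda>x. f (?T x)) \<in> borel_measurable haar2"
    by (rule measurable_compose[OF T]) measurable
  ultimately show "left_regular (grelaud2 \<theta>) \<gamma> f \<in> square_integrable haar2"
    unfolding left_regular_def square_integrable_def by blast
  have "(LINT x|haar2. (cmod (f (?T x)))\<^sup>2) = (LINT x|distr haar2 haar2 ?T. (cmod (f x))\<^sup>2)"
    by (rule integral_distr[OF T, symmetric]) measurable
  then show "l2_norm haar2 (left_regular (grelaud2 \<theta>) \<gamma> f) = l2_norm haar2 f"
    unfolding left_regular_def l2_norm_def distr_haar2 by simp
qed

lemma norm_coefficient_le: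
  assumes "f \<in> square_integrable haar2" "\<eta> \<in> square_integrable haar2"
  shows "cmod (coefficient (grelaud2 \<theta>) haar2 f \<eta> \<gamma>) \<le> l2_norm haar2 f * l2_norm haar2 \<eta>"
  using l2_inner_Cauchy_Schwarz[OF left_regular_grelaud2(1)[OF assms(1)] assms(2), of \<theta> \<gamma>]
  by (simp add: coefficient_def left_regular_grelaud2(2)[OF assms(1)])

lemma inv_grelaud2: "inv\<^bsub>grelaud2 \<theta>\<^esub> (g, h) = (inv\<^bsub>grelaud \<theta>\<^esub> g, inv\<^bsub>grelaud \<theta>\<^esub> h)"
  by (rule inv_DirProd) (auto simp: grelaud_group)

section \<open>Parseval's identity\<close>

definition Cc :: "('a::topological_space \<Rightarrow> complex) set" where
  "Cc = {f. continuous_on UNIV f \<and> compactly_supported f}"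

lemma Cc_measurable: "f \<in> Cc \<Longrightarrow> f \<in> borel_measurable borel"
  by (simp add: Cc_def borel_measurable_continuous_onI)

lemma Cc_bounded:
  assumes "f \<in> Cc"
  shows "\<exists>B\<ge>0. \<forall>x. cmod (f x) \<le> B"
proof -
  let ?K = "closure {x. f x \<noteq> 0}"
  have cf: "continuous_on ?K f" and K: "compact ?K"
    using assms continuous_on_subset[OF _ subset_UNIV, of f ?K]
    by (simp_all add: Cc_def compactly_supported_def)
  have "compact (f ` ?K)" by (rule compact_continuous_image[OF cf K])
  from compact_imp_bounded[OF this] obtain B where B: "\<forall>y\<in>f ` ?K. norm y \<le> B"
    unfolding bounded_iff by blast
  have le: "cmod (f x) \<le> max B 0" for x
  proof (cases "f x = 0")
    case False
    then have "x \<in> ?K" using subsetD[OF closure_subset, of x "{x. f x \<noteq> 0}"] by simp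
    then have "f x \<in> f ` ?K" by (rule imageI)
    then show ?thesis using bspec[OF B] by (simp add: le_max_iff_disj)
  qed simp
  show ?thesis
  proof (intro exI conjI allI)
    show "0 \<le> max B 0" by simp
  qed (rule le)
qed

lemma Cc_integrable:
  fixes f :: "'a::euclidean_space \<Rightarrow> complex"
  assumes "f \<in> Cc"
  shows "integrable lborel f"
proof -
  let ?K = "closure {x. f x \<noteq> 0}"
  have cf: "continuous_on ?K f" and K: "compact ?K"
    using assms continuous_on_subset[OF _ subset_UNIV, of f ?K]
    by (simp_all add: Cc_def compactly_supported_def)
  have "integrable lborel (\<lambda>x. indicator ?K x *\<^sub>R f x)"
    by (rule borel_integrable_compact[OF K cf])
  moreover have "indicator ?K x *\<^sub>R f x = f x" for x
    using closure_subset[of "{x. f x \<noteq> 0}"] by (auto simp: indicator_def)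
  ultimately show ?thesis by simp
qed

lemma Cc_square_integrable:
  fixes f :: "'a::euclidean_space \<Rightarrow> complex"
  assumes f: "f \<in> Cc"
  shows "f \<in> square_integrable lborel"
proof -
  obtain B where B: "0 \<le> B" "\<And>x. cmod (f x) \<le> B" using Cc_bounded[OF f] by blast
  have "integrable lborel (\<lambda>x. (cmod (f x))\<^sup>2)"
  proof (rule Bochner_Integration.integrable_bound)
    show "integrable lborel (\<lambda>x. B * cmod (f x))" using Cc_integrable[OF f] by simp
    show "AE x in lborel. norm ((cmod (f x))\<^sup>2) \<le> norm (B * cmod (f x))"
      using B(1) by (intro AE_I2) (simp add: power2_eq_square abs_mult mult_right_mono B(2))
  qed (use Cc_measurable[OF f] in measurable)
  then show ?thesis using Cc_measurable[OF f] by (simp add: square_integrable_def)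
qed

section \<open>Gaussian integrals\<close>

lemma borel_measurable_cis [measurable (raw)]:
  "f \<in> borel_measurable M \<Longrightarrow> (\<lambda>x. cis (f x)) \<in> borel_measurable M"
  by (rule borel_measurable_continuous_on[of cis]) (intro continuous_intros)

text \<open>The convergence factor for Fourier inversion; up to a power of
  \<open>sqrt (2 * pi)\<close> it is its own Fourier transform.\<close>

definition gaussian :: "'a::euclidean_space \<Rightarrow> real" where
  "gaussian p = exp (- (norm p)\<^sup>2 / 2)"

lemma measurable_gaussian [measurable]: "gaussian \<in> borel_measurable borel"
  unfolding gaussian_def by measurable

lemma gaussian_nonneg [simp]: "0 \<le> gaussian p"
  by (simp add: gaussian_def)

lemma gaussian_le_1 [simp]: "gaussian p \<le> 1"
  by (simp add: gaussian_def)

lemma gaussian_eq_prod: "gaussian p = (\<Prod>b\<in>Basis. exp (- (p \<bullet> b)\<^sup>2 / 2))"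
proof -
  have "(norm p)\<^sup>2 = (\<Sum>b\<in>Basis. (p \<bullet> b)\<^sup>2)"
    unfolding power2_norm_eq_inner by (subst euclidean_inner) (simp add: power2_eq_square)
  then have "- (norm p)\<^sup>2 / 2 = (\<Sum>b\<in>Basis. - (p \<bullet> b)\<^sup>2 / 2)"
    by (simp add: sum_negf sum_divide_distrib)
  then show ?thesis by (simp only: gaussian_def exp_sum finite_Basis)
qed

text \<open>\<open>lborel\<close> is an image of the product of the coordinate measures, so products
  of functions of single coordinates integrate factor by factor. Used for Gaussians and for the
  exponential kernel on the plane.\<close>

lemma lborel_integral_prod_Basis:
  fixes \<phi> :: "'a::euclidean_space \<Rightarrow> real \<Rightarrow> complex"
  assumes \<phi>: "\<And>b. b \<in> Basis \<Longrightarrow> integrable lborel (\<phi> b)"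
  shows "integrable lborel (\<lambda>x::'a. \<Prod>b\<in>Basis. \<phi> b (x \<bullet> b))"
    and "(LINT x|lborel. (\<Prod>b\<in>Basis. \<phi> b ((x::'a) \<bullet> b))) = (\<Prod>b\<in>Basis. (LINT t|lborel. \<phi> b t))"
proof -
  interpret product_sigma_finite "\<lambda>b::'a. lborel :: real measure" ..
  let ?T = "\<lambda>f :: 'a \<Rightarrow> real. \<Sum>b\<in>Basis. f b *\<^sub>R b"
  have T: "?T \<in> (\<Pi>\<^sub>M b\<in>Basis. lborel) \<rightarrow>\<^sub>M borel" by measurable
  have m: "(\<lambda>x::'a. \<Prod>b\<in>Basis. \<phi> b (x \<bullet> b)) \<in> borel_measurable borel"
    using \<phi>[THEN borel_measurable_integrable] by measurable
  have eq: "(\<Prod>b\<in>Basis. \<phi> b (?T f \<bullet> b)) = (\<Prod>b\<in>Basis. \<phi> b (f b))" for f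
    by (intro prod.cong) auto
  show "integrable lborel (\<lambda>x::'a. \<Prod>b\<in>Basis. \<phi> b (x \<bullet> b))"
    unfolding lborel_eq[where 'a = 'a] integrable_distr_eq[OF T m] eq
    by (intro product_integrable_prod \<phi>) auto
  show "(LINT x|lborel. (\<Prod>b\<in>Basis. \<phi> b ((x::'a) \<bullet> b))) = (\<Prod>b\<in>Basis. (LINT t|lborel. \<phi> b t))"
    unfolding lborel_eq[where 'a = 'a] integral_distr[OF T m] eq
    by (intro product_integral_prod \<phi>) auto
qed

lemma gaussian_fourier_real:
  "integrable lborel (\<lambda>t. cis (- (z * t)) * complex_of_real (exp (- t\<^sup>2 / 2)))" (is ?I)
  "(LINT t|lborel. cis (- (z * t)) * complex_of_real (exp (- t\<^sup>2 / 2)))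
    = complex_of_real (sqrt (2 * pi) * exp (- z\<^sup>2 / 2))" (is "?l = _")
proof -
  have eq: "complex_of_real (exp (- t\<^sup>2 / 2))
    = complex_of_real (sqrt (2 * pi)) * complex_of_real (std_normal_density t)" for t
    unfolding of_real_mult[symmetric] by (simp add: std_normal_density_def)
  have int: "integrable lborel std_normal_density"
    by (rule integrable_normal_density) simp
  have "integrable lborel (\<lambda>t. complex_of_real (exp (- t\<^sup>2 / 2)))"
    unfolding eq using int by simp
  then show ?I
    by (rule Bochner_Integration.integrable_bound) (auto simp: norm_mult)
  \<comment> \<open>The one-dimensional transform is the characteristic function of the standard
    normal distribution at \<open>- z\<close>, up to the normalising constant.\<close>
  have "char std_normal_distribution (- z) = (LINT t|lborel. std_normal_density t *\<^sub>R cis (- (z * t)))"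
    unfolding char_def by (subst integral_density) (auto simp: cis_conv_exp)
  then have "(LINT t|lborel. std_normal_density t *\<^sub>R cis (- (z * t))) = complex_of_real (exp (- z\<^sup>2 / 2))"
    by (simp add: char_std_normal_distribution)
  moreover have "?l = complex_of_real (sqrt (2 * pi))
    * (LINT t|lborel. std_normal_density t *\<^sub>R cis (- (z * t)))"
    unfolding eq by (subst integral_mult_right_zero[symmetric], intro Bochner_Integration.integral_cong)
      (auto simp: scaleR_conv_of_real)
  ultimately show "?l = complex_of_real (sqrt (2 * pi) * exp (- z\<^sup>2 / 2))" by simp
qed

lemma cis_sum: "finite A \<Longrightarrow> cis (\<Sum>b\<in>A. f b) = (\<Prod>b\<in>A. cis (f b))"
  by (induction A rule: finite_induct) (simp_all add: cis_mult[symmetric])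

lemma gaussian_fourier:
  fixes z :: "'a::euclidean_space"
  shows "integrable lborel (\<lambda>p::'a. cis (- (z \<bullet> p)) * complex_of_real (gaussian p))" (is ?I)
    and "(LINT p|lborel. cis (- (z \<bullet> p)) * complex_of_real (gaussian p))
      = complex_of_real (sqrt (2 * pi) ^ DIM('a) * gaussian z)"
proof -
  have eq: "cis (- (z \<bullet> p)) * complex_of_real (gaussian p)
      = (\<Prod>b\<in>Basis. cis (- ((z \<bullet> b) * (p \<bullet> b))) * complex_of_real (exp (- (p \<bullet> b)\<^sup>2 / 2)))" for p
  proof -
    have "- (z \<bullet> p) = (\<Sum>b\<in>Basis. - ((z \<bullet> b) * (p \<bullet> b)))"
      by (subst euclidean_inner) (simp add: sum_negf)
    then have "cis (- (z \<bullet> p)) = (\<Prod>b\<in>Basis. cis (- ((z \<bullet> b) * (p \<bullet> b))))"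
      by (simp only: cis_sum finite_Basis)
    then show ?thesis by (simp add: gaussian_eq_prod prod.distrib)
  qed
  note I = lborel_integral_prod_Basis[where
    \<phi> = "\<lambda>b t. cis (- ((z \<bullet> b) * t)) * complex_of_real (exp (- t\<^sup>2 / 2))", OF gaussian_fourier_real(1)]
  show ?I unfolding eq by (rule I(1))
  show "(LINT p|lborel. cis (- (z \<bullet> p)) * complex_of_real (gaussian p))
      = complex_of_real (sqrt (2 * pi) ^ DIM('a) * gaussian z)"
    unfolding eq I(2) gaussian_fourier_real(2)
    by (simp add: prod.distrib gaussian_eq_prod)
qed

lemma gaussian_integral:
  "integrable lborel (\<lambda>p::'a::euclidean_space. gaussian p)"
  "(LINT p|lborel. gaussian (p::'a)) = sqrt (2 * pi) ^ DIM('a)"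
proof -
  have 1: "integrable lborel (\<lambda>p::'a. complex_of_real (gaussian p))"
    using gaussian_fourier(1)[of "0::'a"] by simp
  from integrable_Re[OF this] show "integrable lborel (\<lambda>p::'a. gaussian p)" by simp
  have "complex_of_real (LINT p|lborel. gaussian (p::'a)) = complex_of_real (sqrt (2 * pi) ^ DIM('a))"
    using gaussian_fourier(2)[of "0::'a"] by (simp add: gaussian_def)
  then show "(LINT p|lborel. gaussian (p::'a)) = sqrt (2 * pi) ^ DIM('a)"
    using of_real_eq_iff by blast
qed

lemma integral_lborel_affine:
  fixes h :: "'a::euclidean_space \<Rightarrow> complex"
  assumes [measurable]: "h \<in> borel_measurable borel" and c: "0 < c"
  shows "(LINT x|lborel. h x) = of_real (c ^ DIM('a)) * (LINT z|lborel. h (t + c *\<^sub>R z))"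
proof -
  have "(LINT x|lborel. h x)
      = integral\<^sup>L (density (distr lborel borel (\<lambda>x. t + c *\<^sub>R x)) (\<lambda>_. ennreal (\<bar>c\<bar> ^ DIM('a)))) h"
    using c by (subst lborel_affine[of c t]) simp_all
  also have "\<dots> = (LINT x|distr lborel borel (\<lambda>x. t + c *\<^sub>R x). (\<bar>c\<bar> ^ DIM('a)) *\<^sub>R h x)"
    by (rule integral_density) auto
  also have "\<dots> = of_real (c ^ DIM('a)) * (LINT z|lborel. h (t + c *\<^sub>R z))"
    using c by (simp add: integral_distr scaleR_conv_of_real)
  finally show ?thesis .
qed

lemma (in pair_sigma_finite) integrable_pair_mult:
  fixes f :: "'a \<Rightarrow> 'c::{real_normed_field, banach, second_countable_topology}"
    and g :: "'b \<Rightarrow> 'c"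
  assumes f: "integrable M1 f" and g: "integrable M2 g"
  shows "integrable (M1 \<Otimes>\<^sub>M M2) (\<lambda>z. f (fst z) * g (snd z))"
proof (rule Fubini_integrable)
  note [measurable] = f[THEN borel_measurable_integrable] g[THEN borel_measurable_integrable]
  show "(\<lambda>z. f (fst z) * g (snd z)) \<in> borel_measurable (M1 \<Otimes>\<^sub>M M2)" by measurable
qed (use f g in \<open>simp_all add: norm_mult\<close>)

section \<open>Fourier inversion with a Gaussian factor\<close>

lemma fourier_transform_measurable:
  fixes f :: "'a::euclidean_space \<Rightarrow> complex"
  assumes "f \<in> borel_measurable borel"
  shows "fourier_transform f \<in> borel_measurable borel"
proof -
  have [measurable]: "f \<in> borel_measurable lborel" using assms by simp
  have "(\<lambda>y. LINT x|lborel. cis (- (x \<bullet> y)) * f x) \<in> borel_measurable lborel"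
    by (rule lborel.borel_measurable_lebesgue_integral) measurable
  then show ?thesis by (simp add: fourier_transform_def[abs_def])
qed

lemma norm_fourier_transform_le:
  "cmod (fourier_transform f y) \<le> (LINT x|lborel. cmod (f x))"
proof -
  have "cmod (fourier_transform f y) \<le> (LINT x|lborel. cmod (cis (- (x \<bullet> y)) * f x))"
    unfolding fourier_transform_def by (rule integral_norm_bound)
  then show ?thesis by (simp add: norm_mult)
qed

lemma integrable_gaussian_scaled:
  assumes e: "0 < e"
  shows "integrable lborel (\<lambda>p::'a::euclidean_space. gaussian (e *\<^sub>R p))"
proof -
  have "integrable (density (distr lborel borel (\<lambda>x::'a. 0 + e *\<^sub>R x)) (\<lambda>_. ennreal (\<bar>e\<bar> ^ DIM('a)))) gaussian"
    using gaussian_integral(1)[where 'a = 'a] e by (subst (asm) lborel_affine[of e 0]) simp_all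
  then show ?thesis using e
    by (simp add: integrable_density integrable_distr_eq)
qed

text \<open>The Gaussian makes the double integral over \<open>p\<close> and \<open>y\<close>
  absolutely convergent. After the exchange the \<open>p\<close>-integral is a Gaussian peak at
  \<open>y = x\<close> of width \<open>e\<close>, so the right side is an average of the conjugate
  of \<open>g\<close> around \<open>x\<close>.\<close>

lemma fourier_gaussian_inversion:
  fixes g :: "'a::euclidean_space \<Rightarrow> complex"
  assumes g: "g \<in> Cc" and e: "0 < e"
  shows "(LINT p|lborel. cis (- (x \<bullet> p)) * cnj (fourier_transform g p) * of_real (gaussian (e *\<^sub>R p)))
    = of_real (sqrt (2 * pi) ^ DIM('a)) * (LINT z|lborel. cnj (g (x + e *\<^sub>R z)) * of_real (gaussian z))"
proof -
  have [measurable]: "g \<in> borel_measurable lborel" using Cc_measurable[OF g] by simp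
  let ?G = "\<lambda>p. complex_of_real (gaussian (e *\<^sub>R p))"
  have ig: "integrable lborel (\<lambda>p::'a. gaussian (e *\<^sub>R p))"
    by (rule integrable_gaussian_scaled[OF e])
  have int: "integrable (lborel \<Otimes>\<^sub>M lborel) (\<lambda>(p, y). cis ((y - x) \<bullet> p) * cnj (g y) * ?G p)"
  proof (rule Bochner_Integration.integrable_bound)
    show "integrable (lborel \<Otimes>\<^sub>M lborel) (\<lambda>z. gaussian (e *\<^sub>R (fst z :: 'a)) * cmod (g (snd z)))"
      using ig Cc_integrable[OF g] by (intro lborel_pair.integrable_pair_mult) auto
  qed (auto simp: norm_mult split: prod.splits)
  have "(LINT p|lborel. cis (- (x \<bullet> p)) * cnj (fourier_transform g p) * ?G p)
      = (LINT p|lborel. LINT y|lborel. cis ((y - x) \<bullet> p) * cnj (g y) * ?G p)"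
  proof (intro Bochner_Integration.integral_cong refl)
    fix p :: 'a
    have "cis (- (x \<bullet> p)) * cnj (fourier_transform g p) * ?G p
        = (LINT y|lborel. cis (- (x \<bullet> p)) * ?G p * cnj (cis (- (y \<bullet> p)) * g y))"
      unfolding fourier_transform_def integral_mult_right_zero Bochner_Integration.integral_cnj
      by (simp only: mult_ac)
    also have "\<dots> = (LINT y|lborel. cis ((y - x) \<bullet> p) * cnj (g y) * ?G p)"
    proof (intro Bochner_Integration.integral_cong refl)
      fix y
      have "cis (- (x \<bullet> p)) * cis (y \<bullet> p) = cis ((y - x) \<bullet> p)"
        by (simp add: cis_mult inner_diff_left)
      then show "cis (- (x \<bullet> p)) * ?G p * cnj (cis (- (y \<bullet> p)) * g y) = cis ((y - x) \<bullet> p) * cnj (g y) * ?G p"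
        by (simp add: cis_cnj mult_ac)
    qed
    finally show "cis (- (x \<bullet> p)) * cnj (fourier_transform g p) * ?G p
        = (LINT y|lborel. cis ((y - x) \<bullet> p) * cnj (g y) * ?G p)" .
  qed
  also have "\<dots> = (LINT y|lborel. LINT p|lborel. cis ((y - x) \<bullet> p) * cnj (g y) * ?G p)"
    using lborel_pair.Fubini_integral[OF int] by simp
  \<comment> \<open>Substituting \<open>y = x + e *\<^sub>R z\<close> rescales the peak to unit
    width; the factor \<open>e ^ DIM('a)\<close> is later absorbed by rescaling
    \<open>p\<close>.\<close>
  also have "\<dots> = of_real (e ^ DIM('a)) *
      (LINT z|lborel. LINT p|lborel. cis (((x + e *\<^sub>R z) - x) \<bullet> p) * cnj (g (x + e *\<^sub>R z)) * ?G p)"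
    by (intro integral_lborel_affine e) measurable
  also have "\<dots> = of_real (e ^ DIM('a)) * (LINT z|lborel. cnj (g (x + e *\<^sub>R z)) *
      (LINT p|lborel. cis (e *\<^sub>R z \<bullet> p) * ?G p))"
    by (simp add: mult_ac flip: integral_mult_right_zero)
  also have "\<dots> = (LINT z|lborel. cnj (g (x + e *\<^sub>R z)) *
      (of_real (e ^ DIM('a)) * (LINT p|lborel. cis (- ((- z) \<bullet> (e *\<^sub>R p))) * ?G p)))"
    by (subst integral_mult_right_zero[symmetric]) (simp add: mult_ac)
  also have "\<dots> = (LINT z|lborel. cnj (g (x + e *\<^sub>R z)) *
      (LINT p|lborel. cis (- ((- z) \<bullet> p)) * of_real (gaussian p)))"
  proof (intro Bochner_Integration.integral_cong refl arg_cong2[where f = "(*)"])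
    fix z :: 'a
    show "of_real (e ^ DIM('a)) * (LINT p|lborel. cis (- ((- z) \<bullet> (e *\<^sub>R p))) * ?G p)
        = (LINT p|lborel. cis (- ((- z) \<bullet> p)) * of_real (gaussian p))"
      using integral_lborel_affine[OF _ e, of "\<lambda>p. cis (- ((- z) \<bullet> p)) * of_real (gaussian p)" 0] by simp
  qed
  also have "\<dots> = of_real (sqrt (2 * pi) ^ DIM('a))
    * (LINT z|lborel. cnj (g (x + e *\<^sub>R z)) * of_real (gaussian z))"
    unfolding gaussian_fourier(2)
    by (subst integral_mult_right_zero[symmetric]) (simp add: gaussian_def mult_ac)
  finally show ?thesis .
qed

lemma Cc_gaussian_average_tendsto:
  fixes g :: "'a::euclidean_space \<Rightarrow> complex"
  assumes g: "g \<in> Cc" and e: "e \<longlonglongrightarrow> 0"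
  shows "(\<lambda>n. LINT z|lborel. cnj (g (x + e n *\<^sub>R z)) * of_real (gaussian z))
    \<longlonglongrightarrow> of_real (sqrt (2 * pi) ^ DIM('a)) * cnj (g x)"
proof -
  have [measurable]: "g \<in> borel_measurable borel" by (rule Cc_measurable[OF g])
  obtain B where B: "0 \<le> B" "\<And>x. cmod (g x) \<le> B" using Cc_bounded[OF g] by blast
  have "(\<lambda>n. LINT z|lborel. cnj (g (x + e n *\<^sub>R z)) * of_real (gaussian z))
    \<longlonglongrightarrow> (LINT z|lborel. cnj (g x) * complex_of_real (gaussian (z::'a)))"
  proof (rule integral_dominated_convergence[where w = "\<lambda>z. B * gaussian z"])
    show "integrable lborel (\<lambda>z::'a. B * gaussian z)" using gaussian_integral(1)[where 'a = 'a] by simp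
    show "AE z in lborel. cmod (cnj (g (x + e n *\<^sub>R z)) * of_real (gaussian z)) \<le> B * gaussian z" for n
      by (intro AE_I2) (simp add: norm_mult mult_right_mono B(2))
    show "AE z in lborel. (\<lambda>n. cnj (g (x + e n *\<^sub>R z)) * of_real (gaussian z))
        \<longlonglongrightarrow> cnj (g x) * complex_of_real (gaussian z)"
    proof (rule AE_I2)
      fix z :: 'a
      have "(\<lambda>n. x + e n *\<^sub>R z) \<longlonglongrightarrow> x + 0 *\<^sub>R z"
        by (intro tendsto_intros e)
      moreover have "isCont g x" using g by (simp add: Cc_def continuous_on_eq_continuous_at)
      ultimately have "(\<lambda>n. g (x + e n *\<^sub>R z)) \<longlonglongrightarrow> g x"
        by (intro isCont_tendsto_compose[of x g]) simp_all
      then show "(\<lambda>n. cnj (g (x + e n *\<^sub>R z)) * of_real (gaussian z))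
          \<longlonglongrightarrow> cnj (g x) * complex_of_real (gaussian z)"
        by (intro tendsto_intros)
    qed
  qed measurable
  also have "(LINT z|lborel. cnj (g x) * complex_of_real (gaussian (z::'a)))
      = of_real (sqrt (2 * pi) ^ DIM('a)) * cnj (g x)"
    using gaussian_integral(2)[where 'a = 'a] by simp
  finally show ?thesis .
qed

text \<open>At this stage the product of the two transforms is not known to be integrable, so
  Fubini's theorem relies on the Gaussian factor. Letting the Gaussian tend to 1 turns the averages
  of \<open>g\<close> into \<open>g\<close> itself.\<close>

lemma Parseval_gaussian_tendsto:
  fixes f g :: "'a::euclidean_space \<Rightarrow> complex"
  assumes f: "f \<in> Cc" and g: "g \<in> Cc" and e0: "\<And>n. 0 < e n" and e: "e \<longlonglongrightarrow> 0"
  shows "(\<lambda>n. LINT p|lborel. fourier_transform f p * cnj (fourier_transform g p)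
        * of_real (gaussian (e n *\<^sub>R p)))
    \<longlonglongrightarrow> of_real ((2 * pi) ^ DIM('a)) * l2_inner lborel f g"
proof -
  have [measurable]: "f \<in> borel_measurable borel" "g \<in> borel_measurable borel"
    by (rule Cc_measurable[OF f], rule Cc_measurable[OF g])
  have [measurable]: "fourier_transform g \<in> borel_measurable borel"
    by (rule fourier_transform_measurable) measurable
  let ?c = "complex_of_real (sqrt (2 * pi) ^ DIM('a))"
  obtain B where B: "0 \<le> B" "\<And>x. cmod (g x) \<le> B" using Cc_bounded[OF g] by blast
  let ?A = "\<lambda>n x. LINT z|lborel. cnj (g (x + e n *\<^sub>R z)) * complex_of_real (gaussian (z::'a))"
  have Am [measurable]: "?A n \<in> borel_measurable borel" for n
  proof -
    have "?A n \<in> borel_measurable lborel"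
      by (rule lborel.borel_measurable_lebesgue_integral) measurable
    then show ?thesis by simp
  qed
  have Ab: "cmod (?A n x) \<le> B * sqrt (2 * pi) ^ DIM('a)" for n x
  proof -
    let ?h = "\<lambda>z. cnj (g (x + e n *\<^sub>R z)) * complex_of_real (gaussian z)"
    have bd: "norm (?h z) \<le> B * gaussian z" for z
      by (simp add: norm_mult mult_right_mono B(2))
    have iB: "integrable lborel (\<lambda>z::'a. B * gaussian z)" using gaussian_integral(1)[where 'a = 'a] by simp
    have ih: "integrable lborel ?h"
    proof (rule Bochner_Integration.integrable_bound[OF iB])
      show "AE z in lborel. norm (?h z) \<le> norm (B * gaussian z)"
        using bd by (intro AE_I2) (simp add: B(1))
    qed measurable
    have "cmod (?A n x) \<le> (LINT z|lborel. norm (?h z))" by (rule integral_norm_bound)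
    also have "\<dots> \<le> (LINT z|lborel. B * gaussian (z::'a))"
      by (rule integral_mono[OF integrable_norm[OF ih] iB bd])
    finally have "cmod (?A n x) \<le> (LINT z|lborel. B * gaussian (z::'a))" .
    then show ?thesis using gaussian_integral(2)[where 'a = 'a] by simp
  qed
  have eq: "(LINT p|lborel. fourier_transform f p * cnj (fourier_transform g p)
        * of_real (gaussian (d *\<^sub>R p)))
      = ?c * (LINT x|lborel. f x * (LINT z|lborel. cnj (g (x + d *\<^sub>R z)) * of_real (gaussian z)))"
    if d: "0 < d" for d
  proof -
    let ?G = "\<lambda>p::'a. complex_of_real (gaussian (d *\<^sub>R p))"
    let ?C = "LINT x|lborel. cmod (g x)"
    have ig: "integrable lborel (\<lambda>p::'a. gaussian (d *\<^sub>R p))"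
      by (rule integrable_gaussian_scaled[OF d])
    have int: "integrable (lborel \<Otimes>\<^sub>M lborel)
        (\<lambda>(p, x). cis (- (x \<bullet> p)) * f x * (cnj (fourier_transform g p) * ?G p))"
    proof (rule Bochner_Integration.integrable_bound)
      show "integrable (lborel \<Otimes>\<^sub>M lborel) (\<lambda>z. (?C * gaussian (d *\<^sub>R (fst z :: 'a))) * cmod (f (snd z)))"
        using ig Cc_integrable[OF f] by (intro lborel_pair.integrable_pair_mult) auto
      have C: "0 \<le> ?C" by simp
      show "AE z in lborel \<Otimes>\<^sub>M lborel. norm
        (case z of (p, x) \<Rightarrow> cis (- (x \<bullet> p)) * f x * (cnj (fourier_transform g p) * ?G p))
          \<le> norm ((?C * gaussian (d *\<^sub>R (fst z :: 'a))) * cmod (f (snd z)))"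
      proof (rule AE_I2)
        fix z :: "'a \<times> 'a"
        obtain p x where z: "z = (p, x)" by (cases z)
        have "cmod (fourier_transform g (fst z)) * gaussian (d *\<^sub>R fst z) * cmod (f (snd z))
            \<le> ?C * gaussian (d *\<^sub>R fst z) * cmod (f (snd z))"
          by (intro mult_right_mono norm_fourier_transform_le) auto
        then show "norm (case z of (p, x) \<Rightarrow> cis (- (x \<bullet> p)) * f x * (cnj (fourier_transform g p) * ?G p))
          \<le> norm ((?C * gaussian (d *\<^sub>R fst z)) * cmod (f (snd z)))"
          using C by (simp add: z norm_mult abs_mult mult_ac)
      qed
      show "(\<lambda>(p, x). cis (- (x \<bullet> p)) * f x * (cnj (fourier_transform g p) * ?G p)) \<in> borel_measurable
        (lborel \<Otimes>\<^sub>M lborel)"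
        by measurable
    qed
    have "(LINT p|lborel. fourier_transform f p * cnj (fourier_transform g p) * ?G p)
        = (LINT p|lborel. LINT x|lborel. cis (- (x \<bullet> p)) * f x * (cnj (fourier_transform g p) * ?G p))"
    proof (intro Bochner_Integration.integral_cong refl)
      fix p :: 'a
      have "(LINT x|lborel. cis (- (x \<bullet> p)) * f x * (cnj (fourier_transform g p) * ?G p))
          = fourier_transform f p * (cnj (fourier_transform g p) * ?G p)"
        by (simp only: fourier_transform_def[of f] integral_mult_left_zero)
      then show "fourier_transform f p * cnj (fourier_transform g p) * ?G p
          = (LINT x|lborel. cis (- (x \<bullet> p)) * f x * (cnj (fourier_transform g p) * ?G p))"
        by (simp only: mult.assoc)
    qed
    also have "\<dots> = (LINT x|lborel. LINT p|lborel. cis (- (x \<bullet> p)) * f x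
      * (cnj (fourier_transform g p) * ?G p))"
      using lborel_pair.Fubini_integral[OF int] by simp
    also have "\<dots> = (LINT x|lborel. f x * (LINT p|lborel. cis (- (x \<bullet> p)) * cnj (fourier_transform g p)
      * ?G p))"
      by (subst integral_mult_right_zero[symmetric]) (simp add: mult_ac)
    also have "\<dots> = (LINT x|lborel. ?c * (f x * (LINT z|lborel. cnj (g (x + d *\<^sub>R z)) * of_real (gaussian z))))"
      unfolding fourier_gaussian_inversion[OF g d] by (simp only: mult_ac)
    finally show ?thesis by simp
  qed
  have "(\<lambda>n. LINT x|lborel. f x * ?A n x) \<longlonglongrightarrow> (LINT x|lborel. f x * (?c * cnj (g x)))"
  proof (rule integral_dominated_convergence[where w = "\<lambda>x. cmod (f x) * (B * sqrt (2 * pi) ^ DIM('a))"])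
    show "integrable lborel (\<lambda>x. cmod (f x) * (B * sqrt (2 * pi) ^ DIM('a)))"
      using Cc_integrable[OF f] by simp
    show "AE x in lborel. (\<lambda>n. f x * ?A n x) \<longlonglongrightarrow> f x * (?c * cnj (g x))"
      by (intro AE_I2 tendsto_intros Cc_gaussian_average_tendsto g e)
    show "AE x in lborel. norm (f x * ?A n x) \<le> cmod (f x) * (B * sqrt (2 * pi) ^ DIM('a))" for n
      unfolding norm_mult by (intro AE_I2 mult_left_mono Ab) simp
  qed measurable
  then have "(\<lambda>n. ?c * (LINT x|lborel. f x * ?A n x)) \<longlonglongrightarrow> ?c * (LINT x|lborel. f x * (?c * cnj (g x)))"
    by (intro tendsto_intros)
  also have "(\<lambda>n. ?c * (LINT x|lborel. f x * ?A n x)) = (\<lambda>n. LINT p|lborel. fourier_transform f p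
      * cnj (fourier_transform g p) * of_real (gaussian (e n *\<^sub>R p)))"
    by (intro ext eq[symmetric] e0)
  also have "?c * (LINT x|lborel. f x * (?c * cnj (g x)))
    = of_real ((2 * pi) ^ DIM('a)) * l2_inner lborel f g"
  proof -
    have "sqrt (2 * pi) ^ DIM('a) * sqrt (2 * pi) ^ DIM('a) = (2 * pi) ^ DIM('a)"
      unfolding power_mult_distrib[symmetric] by simp
    then have "?c * ?c = of_real ((2 * pi) ^ DIM('a))" by (simp only: flip: of_real_mult)
    moreover have "(LINT x|lborel. f x * (?c * cnj (g x))) = ?c * l2_inner lborel f g"
      unfolding l2_inner_def by (subst integral_mult_right_zero[symmetric]) (simp add: mult_ac)
    ultimately show ?thesis by (simp add: mult.assoc[symmetric])
  qed
  finally show ?thesis .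
qed

text \<open>For \<open>g = f\<close> the integrands are nonnegative, and Fatou's lemma applies as
  the Gaussian tends to 1. An inequality of norms is all that is asked, as it makes the products in
  Parseval's identity integrable.\<close>

lemma fourier_transform_square_integrable:
  fixes f :: "'a::euclidean_space \<Rightarrow> complex"
  assumes f: "f \<in> Cc"
  shows "fourier_transform f \<in> square_integrable lborel"
    and "l2_norm lborel (fourier_transform f) \<le> sqrt ((2 * pi) ^ DIM('a)) * l2_norm lborel f"
proof -
  have [measurable]: "fourier_transform f \<in> borel_measurable borel"
    by (rule fourier_transform_measurable[OF Cc_measurable[OF f]])
  obtain e :: "nat \<Rightarrow> real" where e0: "\<And>n. 0 < e n" and e: "e \<longlonglongrightarrow> 0"
    by (rule that[OF _ LIMSEQ_inverse_real_of_nat]) simp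
  let ?w = "\<lambda>n p. (cmod (fourier_transform f p))\<^sup>2 * gaussian (e n *\<^sub>R p)"
  let ?N = "(2 * pi) ^ DIM('a) * (l2_norm lborel f)\<^sup>2"
  have eq: "fourier_transform f p * cnj (fourier_transform f p) * of_real (gaussian (e n *\<^sub>R p))
      = complex_of_real (?w n p)" for n p
    by (simp add: complex_norm_square[symmetric])
  have "(\<lambda>n. complex_of_real (LINT p|lborel. ?w n p)) \<longlonglongrightarrow> complex_of_real ?N"
    using Parseval_gaussian_tendsto[OF f f e0 e] unfolding eq l2_inner_self
    by (simp only: of_real_mult[symmetric] integral_complex_of_real)
  then have lim: "(\<lambda>n. LINT p|lborel. ?w n p) \<longlonglongrightarrow> ?N"
    by (simp only: tendsto_of_real_iff)
  let ?C = "LINT x|lborel. cmod (f x)"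
  have int: "integrable lborel (?w n)" for n
  proof (rule Bochner_Integration.integrable_bound)
    have "integrable lborel (\<lambda>p::'a. gaussian (e n *\<^sub>R p))"
      by (rule integrable_gaussian_scaled[OF e0])
    then show "integrable lborel (\<lambda>p::'a. ?C\<^sup>2 * gaussian (e n *\<^sub>R p))" by simp
    have "(cmod (fourier_transform f p))\<^sup>2 \<le> ?C\<^sup>2" for p
      by (intro power_mono norm_fourier_transform_le) simp
    then show "AE p in lborel. norm (?w n p) \<le> norm (?C\<^sup>2 * gaussian (e n *\<^sub>R p))"
      by (intro AE_I2) (simp add: abs_mult mult_right_mono)
  qed measurable
  have "(\<integral>\<^sup>+p. ennreal ((cmod (fourier_transform f p))\<^sup>2) \<partial>lborel)
      = (\<integral>\<^sup>+p. liminf (\<lambda>n. ennreal (?w n p)) \<partial>lborel)"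
  proof (rule nn_integral_cong)
    fix p :: 'a
    have "(\<lambda>n. e n *\<^sub>R p) \<longlonglongrightarrow> 0 *\<^sub>R p"
      by (intro tendsto_intros e)
    then have "(\<lambda>n. ?w n p) \<longlonglongrightarrow> (cmod (fourier_transform f p))\<^sup>2 * exp (- (norm (0 *\<^sub>R p))\<^sup>2 / 2)"
      unfolding gaussian_def by (intro tendsto_intros e) simp_all
    then have "(\<lambda>n. ennreal (?w n p)) \<longlonglongrightarrow> ennreal ((cmod (fourier_transform f p))\<^sup>2)"
      by (intro tendsto_ennrealI) simp
    then show "ennreal ((cmod (fourier_transform f p))\<^sup>2) = liminf (\<lambda>n. ennreal (?w n p))"
      by (intro lim_imp_Liminf[symmetric]) simp_all
  qed
  also have "\<dots> \<le> liminf (\<lambda>n. \<integral>\<^sup>+p. ennreal (?w n p) \<partial>lborel)"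
    by (rule nn_integral_liminf) measurable
  also have "\<dots> = liminf (\<lambda>n. ennreal (LINT p|lborel. ?w n p))"
    by (subst nn_integral_eq_integral[OF int]) simp_all
  also have "\<dots> = ennreal ?N"
    by (intro lim_imp_Liminf tendsto_ennrealI lim) simp
  also have "?N = (sqrt ((2 * pi) ^ DIM('a)) * l2_norm lborel f)\<^sup>2" by (simp add: power_mult_distrib)
  finally show "fourier_transform f \<in> square_integrable lborel"
    "l2_norm lborel (fourier_transform f) \<le> sqrt ((2 * pi) ^ DIM('a)) * l2_norm lborel f"
    using square_integrableI_nn_integral[of "fourier_transform f" lborel
      "sqrt ((2 * pi) ^ DIM('a)) * l2_norm lborel f"]
    by simp_all
qed

text \<open>With both transforms square-integrable, the absolute value of their product dominates
  the integrands with the Gaussian factor, which can then be removed in the limit.\<close>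

theorem Parseval:
  fixes f g :: "'a::euclidean_space \<Rightarrow> complex"
  assumes f: "f \<in> Cc" and g: "g \<in> Cc"
  shows "l2_inner lborel (fourier_transform f) (fourier_transform g)
    = of_real ((2 * pi) ^ DIM('a)) * l2_inner lborel f g"
proof -
  obtain e :: "nat \<Rightarrow> real" where e0: "\<And>n. 0 < e n" and e: "e \<longlonglongrightarrow> 0"
    by (rule that[OF _ LIMSEQ_inverse_real_of_nat]) simp
  have [measurable]: "fourier_transform f \<in> borel_measurable borel"
    "fourier_transform g \<in> borel_measurable borel"
    by (rule fourier_transform_measurable[OF Cc_measurable[OF f]],
        rule fourier_transform_measurable[OF Cc_measurable[OF g]])
  have int: "integrable lborel (\<lambda>p. fourier_transform f p * cnj (fourier_transform g p))"
    by (intro integrable_l2_product fourier_transform_square_integrable f g)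
  have "(\<lambda>n. LINT p|lborel. fourier_transform f p * cnj (fourier_transform g p)
        * of_real (gaussian (e n *\<^sub>R p)))
    \<longlonglongrightarrow> l2_inner lborel (fourier_transform f) (fourier_transform g)"
    unfolding l2_inner_def
  proof (rule integral_dominated_convergence[where
    w = "\<lambda>p. cmod (fourier_transform f p * cnj (fourier_transform g p))"])
    show "integrable lborel (\<lambda>p. cmod (fourier_transform f p * cnj (fourier_transform g p)))"
      using int by (rule integrable_norm)
    show "AE p in lborel. (\<lambda>n. fourier_transform f p * cnj (fourier_transform g p)
        * of_real (gaussian (e n *\<^sub>R p))) \<longlonglongrightarrow> fourier_transform f p * cnj (fourier_transform g p)"
    proof (rule AE_I2)
      fix p :: 'a
      have "(\<lambda>n. e n *\<^sub>R p) \<longlonglongrightarrow> 0 *\<^sub>R p"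
        by (intro tendsto_intros e)
      then have "(\<lambda>n. fourier_transform f p * cnj (fourier_transform g p)
        * of_real (gaussian (e n *\<^sub>R p))) \<longlonglongrightarrow> fourier_transform f p * cnj (fourier_transform g p)
          * of_real (exp (- (norm (0 *\<^sub>R p))\<^sup>2 / 2))"
        unfolding gaussian_def by (intro tendsto_intros e) simp_all
      then show "(\<lambda>n. fourier_transform f p * cnj (fourier_transform g p)
        * of_real (gaussian (e n *\<^sub>R p))) \<longlonglongrightarrow> fourier_transform f p * cnj (fourier_transform g p)"
        by simp
    qed
    show "AE p in lborel. norm (fourier_transform f p * cnj (fourier_transform g p)
        * of_real (gaussian (e n *\<^sub>R p))) \<le> cmod (fourier_transform f p * cnj (fourier_transform g p))" for n
      by (intro AE_I2) (simp add: norm_mult mult_left_le)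
  qed measurable
  then show ?thesis using Parseval_gaussian_tendsto[OF f g e0 e] by (rule LIMSEQ_unique)
qed

lemma borel_measurable_fst_borel [measurable (raw)]:
  fixes f :: "'c \<Rightarrow> 'a::second_countable_topology \<times> 'b::second_countable_topology"
  shows "f \<in> borel_measurable M \<Longrightarrow> (\<lambda>x. fst (f x)) \<in> borel_measurable M"
  by (rule borel_measurable_continuous_on[of fst]) (intro continuous_intros)

lemma borel_measurable_snd_borel [measurable (raw)]:
  fixes f :: "'c \<Rightarrow> 'a::second_countable_topology \<times> 'b::second_countable_topology"
  shows "f \<in> borel_measurable M \<Longrightarrow> (\<lambda>x. snd (f x)) \<in> borel_measurable M"
  by (rule borel_measurable_continuous_on[of snd]) (intro continuous_intros)

section \<open>The partial Fourier transform\<close>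

abbreviation fibre_weight :: "(real \<times> real) \<times> ((real^2) \<times> (real^2)) \<Rightarrow> ennreal" where
  "fibre_weight \<equiv> (\<lambda>y. ennreal (exp (- 2 * (fst (fst y) + snd (fst y)))))"

text \<open>The Haar measure of the product group, with the coordinates \<open>((x, s), (x', s'))\<close>
  reordered to \<open>((s, s'), (x, x'))\<close>, so that the Fourier transform acts on the second component.\<close>

definition fibre_haar :: "((real \<times> real) \<times> ((real^2) \<times> (real^2))) measure" where
  "fibre_haar = density lborel fibre_weight"

definition fibre_coord :: "(real \<times> real) \<times> ((real^2) \<times> (real^2)) \<Rightarrow> ((real^2) \<times> real) \<times> ((real^2) \<times> real)"
  where
  "fibre_coord y = ((fst (snd y), fst (fst y)), (snd (snd y), snd (fst y)))"

lemma sets_fibre_haar [simp, measurable_cong]: "sets fibre_haar = sets borel"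
  by (simp add: fibre_haar_def)

lemma sigma_finite_fibre_haar: "sigma_finite_measure fibre_haar"
proof -
  have "fibre_weight \<in> borel_measurable borel" by measurable
  then have "fibre_weight \<in> borel_measurable lborel" by simp
  from sigma_finite_measure.sigma_finite_iff_density_finite[OF sigma_finite_lborel this]
  show ?thesis unfolding fibre_haar_def by simp
qed

lemma measurable_fibre_coord: "fibre_coord \<in> borel \<rightarrow>\<^sub>M borel"
  unfolding fibre_coord_def[abs_def] by (intro borel_measurable_continuous_onI continuous_intros)

lemma measurable_fibre_coord_haar2: "fibre_coord \<in> fibre_haar \<rightarrow>\<^sub>M haar2"
  by (subst measurable_cong_sets[OF sets_fibre_haar sets_haar2]) (rule measurable_fibre_coord)

lemma nn_integral_fibre_haar:
  assumes "f \<in> borel_measurable borel"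
  shows "(\<integral>\<^sup>+y. f y \<partial>fibre_haar)
    = (\<integral>\<^sup>+t. \<integral>\<^sup>+z. ennreal (exp (- 2 * (fst t + snd t))) * f (t, z) \<partial>lborel \<partial>lborel)"
proof -
  have fl: "f \<in> borel_measurable lborel" using assms by simp
  have [measurable]: "f \<in> borel_measurable (borel \<Otimes>\<^sub>M borel)"
    using assms by (simp only: borel_prod)
  have "(\<integral>\<^sup>+y. f y \<partial>fibre_haar) = (\<integral>\<^sup>+y. fibre_weight y * f y \<partial>lborel)"
    unfolding fibre_haar_def by (rule nn_integral_density[OF _ fl]) measurable
  also have "\<dots> = (\<integral>\<^sup>+y. fibre_weight y * f y \<partial>(lborel \<Otimes>\<^sub>M lborel))"
    by (simp only: lborel_prod)
  also have "\<dots> = (\<integral>\<^sup>+t. \<integral>\<^sup>+z. fibre_weight (t, z) * f (t, z) \<partial>lborel \<partial>lborel)"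
    by (rule lborel.nn_integral_fst[symmetric]) measurable
  finally show ?thesis by simp
qed

text \<open>Tonelli's theorem on indicators: the weights depend on the two real coordinates only, so
  the two plane integrals can be moved innermost.\<close>

lemma haar2_eq_distr: "haar2 = distr fibre_haar haar2 fibre_coord"
proof (rule measure_eqI)
  fix A assume A: "A \<in> sets haar2"
  then have Ab: "A \<in> sets borel" unfolding sets_haar2 .
  let ?I = "indicator A :: ((real^2) \<times> real) \<times> ((real^2) \<times> real) \<Rightarrow> ennreal"
  interpret sigma_finite_measure grelaud_haar by (rule sigma_finite_grelaud_haar)
  have I: "?I \<in> borel_measurable borel" using Ab by (rule borel_measurable_indicator)
  have [measurable]: "?I \<in> borel_measurable ((borel \<Otimes>\<^sub>M borel) \<Otimes>\<^sub>M (borel \<Otimes>\<^sub>M borel))"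
    using I by (simp add: borel_prod)
  have [measurable]: "?I \<in> borel_measurable (borel \<Otimes>\<^sub>M borel)"
    using I by (simp add: borel_prod)
  define J where "J t = (\<integral>\<^sup>+z. ennreal (exp (- 2 * (fst t + snd t))) * ?I ((fst z, fst t), (snd z, snd t))
    \<partial>(lborel \<Otimes>\<^sub>M lborel))"
    for t :: "real \<times> real"
  have [measurable]: "J \<in> borel_measurable (borel \<Otimes>\<^sub>M borel)" unfolding J_def by measurable
  have "emeasure haar2 A = (\<integral>\<^sup>+z. ?I z \<partial>haar2)" using A by simp
  also have "\<dots> = (\<integral>\<^sup>+z. \<integral>\<^sup>+w. ?I (z, w) \<partial>grelaud_haar \<partial>grelaud_haar)"
    using A by (intro nn_integral_fst[symmetric] borel_measurable_indicator)
  also have "\<dots> = (\<integral>\<^sup>+z. \<integral>\<^sup>+t'. ennreal (exp (- 2 * t')) * (\<integral>\<^sup>+b. ?I (z, (b, t')) \<partial>lborel) \<partial>lborel \<partial>grelaud_haar)"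
    by (intro nn_integral_cong nn_integral_grelaud_haar) measurable
  also have "\<dots> = (\<integral>\<^sup>+t. ennreal (exp (- 2 * t)) *
      (\<integral>\<^sup>+a. \<integral>\<^sup>+t'. ennreal (exp (- 2 * t')) * (\<integral>\<^sup>+b. ?I ((a, t), (b, t')) \<partial>lborel) \<partial>lborel \<partial>lborel) \<partial>lborel)"
    by (rule nn_integral_grelaud_haar) measurable
  also have "\<dots> = (\<integral>\<^sup>+t. \<integral>\<^sup>+t'. ennreal (exp (- 2 * (t + t'))) *
      (\<integral>\<^sup>+a. \<integral>\<^sup>+b. ?I ((a, t), (b, t')) \<partial>lborel \<partial>lborel) \<partial>lborel \<partial>lborel)"
  proof (rule nn_integral_cong)
    fix t :: real
    have "(\<integral>\<^sup>+a. \<integral>\<^sup>+t'. ennreal (exp (- 2 * t')) * (\<integral>\<^sup>+b. ?I ((a, t), (b, t')) \<partial>lborel) \<partial>lborel \<partial>lborel)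
        = (\<integral>\<^sup>+t'. \<integral>\<^sup>+a. ennreal (exp (- 2 * t')) * (\<integral>\<^sup>+b. ?I ((a, t), (b, t')) \<partial>lborel) \<partial>lborel \<partial>lborel)"
      by (rule lborel_pair.Fubini') measurable
    also have "\<dots> = (\<integral>\<^sup>+t'. ennreal (exp (- 2 * t')) * (\<integral>\<^sup>+a. \<integral>\<^sup>+b. ?I ((a, t), (b, t')) \<partial>lborel \<partial>lborel)
      \<partial>lborel)"
      by (intro nn_integral_cong nn_integral_cmult) measurable
    finally have "ennreal (exp (- 2 * t))
      * (\<integral>\<^sup>+a. \<integral>\<^sup>+t'. ennreal (exp (- 2 * t')) * (\<integral>\<^sup>+b. ?I ((a, t), (b, t')) \<partial>lborel) \<partial>lborel \<partial>lborel)
        = (\<integral>\<^sup>+t'. ennreal (exp (- 2 * t))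
          * (ennreal (exp (- 2 * t')) * (\<integral>\<^sup>+a. \<integral>\<^sup>+b. ?I ((a, t), (b, t')) \<partial>lborel \<partial>lborel)) \<partial>lborel)"
      by (simp only:) (rule nn_integral_cmult[symmetric], measurable)
    also have "\<dots> = (\<integral>\<^sup>+t'. ennreal (exp (- 2 * (t + t')))
      * (\<integral>\<^sup>+a. \<integral>\<^sup>+b. ?I ((a, t), (b, t')) \<partial>lborel \<partial>lborel) \<partial>lborel)"
    proof (rule nn_integral_cong)
      fix t' :: real
      have "ennreal (exp (- 2 * t)) * ennreal (exp (- 2 * t')) = ennreal (exp (- 2 * (t + t')))"
        unfolding ennreal_mult[symmetric, OF exp_ge_zero exp_ge_zero] exp_add[symmetric] distrib_left ..
      then show "ennreal (exp (- 2 * t))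
        * (ennreal (exp (- 2 * t')) * (\<integral>\<^sup>+a. \<integral>\<^sup>+b. ?I ((a, t), (b, t')) \<partial>lborel \<partial>lborel))
          = ennreal (exp (- 2 * (t + t'))) * (\<integral>\<^sup>+a. \<integral>\<^sup>+b. ?I ((a, t), (b, t')) \<partial>lborel \<partial>lborel)"
        by (simp only: mult.assoc[symmetric])
    qed
    finally show "ennreal (exp (- 2 * t))
      * (\<integral>\<^sup>+a. \<integral>\<^sup>+t'. ennreal (exp (- 2 * t')) * (\<integral>\<^sup>+b. ?I ((a, t), (b, t')) \<partial>lborel) \<partial>lborel \<partial>lborel)
        = (\<integral>\<^sup>+t'. ennreal (exp (- 2 * (t + t'))) * (\<integral>\<^sup>+a. \<integral>\<^sup>+b. ?I ((a, t), (b, t')) \<partial>lborel \<partial>lborel) \<partial>lborel)" .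
  qed
  also have "\<dots> = (\<integral>\<^sup>+t. \<integral>\<^sup>+t'. (\<integral>\<^sup>+z. ennreal (exp (- 2 * (t + t'))) * ?I ((fst z, t), (snd z, t'))
    \<partial>(lborel \<Otimes>\<^sub>M lborel)) \<partial>lborel \<partial>lborel)"
  proof (intro nn_integral_cong)
    fix t t' :: real
    have "(\<integral>\<^sup>+z. ennreal (exp (- 2 * (t + t'))) * ?I ((fst z, t), (snd z, t')) \<partial>(lborel \<Otimes>\<^sub>M lborel))
        = ennreal (exp (- 2 * (t + t'))) * (\<integral>\<^sup>+z. ?I ((fst z, t), (snd z, t')) \<partial>(lborel \<Otimes>\<^sub>M lborel))"
      by (rule nn_integral_cmult) measurable
    also have "(\<integral>\<^sup>+z. ?I ((fst z, t), (snd z, t')) \<partial>(lborel \<Otimes>\<^sub>M lborel))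
        = (\<integral>\<^sup>+a. \<integral>\<^sup>+b. ?I ((fst (a, b), t), (snd (a, b), t')) \<partial>lborel \<partial>lborel)"
      by (rule lborel.nn_integral_fst[symmetric]) measurable
    finally show "ennreal (exp (- 2 * (t + t'))) * (\<integral>\<^sup>+a. \<integral>\<^sup>+b. ?I ((a, t), (b, t')) \<partial>lborel \<partial>lborel)
        = (\<integral>\<^sup>+z. ennreal (exp (- 2 * (t + t'))) * ?I ((fst z, t), (snd z, t')) \<partial>(lborel \<Otimes>\<^sub>M lborel))"
      by simp
  qed
  also have "\<dots> = (\<integral>\<^sup>+t. \<integral>\<^sup>+t'. J (t, t') \<partial>lborel \<partial>lborel)"
    by (simp only: J_def fst_conv snd_conv)
  also have "\<dots> = (\<integral>\<^sup>+t. J t \<partial>(lborel \<Otimes>\<^sub>M lborel))"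
    by (rule lborel.nn_integral_fst) measurable
  also have "\<dots> = (\<integral>\<^sup>+t. \<integral>\<^sup>+z. ennreal (exp (- 2 * (fst t + snd t))) * ?I (fibre_coord (t, z)) \<partial>lborel \<partial>lborel)"
    by (simp only: J_def lborel_prod fibre_coord_def fst_conv snd_conv)
  also have "\<dots> = (\<integral>\<^sup>+y. ?I (fibre_coord y) \<partial>fibre_haar)"
    by (rule nn_integral_fibre_haar[symmetric]) (rule measurable_compose[OF measurable_fibre_coord I])
  also have "\<dots> = (\<integral>\<^sup>+z. ?I z \<partial>distr fibre_haar haar2 fibre_coord)"
    using A by (intro nn_integral_distr[symmetric] measurable_fibre_coord_haar2) simp
  also have "\<dots> = emeasure (distr fibre_haar haar2 fibre_coord) A" using A by simp
  finally show "emeasure haar2 A = emeasure (distr fibre_haar haar2 fibre_coord) A" .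
qed simp

text \<open>In the weighted AM-GM bound of \<open>F (\<Lambda> s y) * H y\<close> the first term is moved by \<open>\<Lambda> s\<close>, which
  preserves \<open>Y\<close> and turns \<open>k1 s\<close> into \<open>k2 s\<close>; both terms are then integrated over \<open>s\<close> first.\<close>

lemma schur_test:
  fixes k1 k2 :: "'s \<Rightarrow> 'y \<Rightarrow> ennreal" and \<Lambda> :: "'s \<Rightarrow> 'y \<Rightarrow> 'y" and F H :: "'y \<Rightarrow> real"
  assumes sf: "sigma_finite_measure S" "sigma_finite_measure Y"
    and k1: "case_prod k1 \<in> borel_measurable (S \<Otimes>\<^sub>M Y)" and k2: "case_prod k2 \<in> borel_measurable (S \<Otimes>\<^sub>M Y)"
    and \<Lambda>: "\<And>s. \<Lambda> s \<in> Y \<rightarrow>\<^sub>M Y" and pres: "\<And>s. distr Y Y (\<Lambda> s) = Y"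
    and \<Lambda>2: "(\<lambda>(s, y). \<Lambda> s y) \<in> (S \<Otimes>\<^sub>M Y) \<rightarrow>\<^sub>M Y"
    and k12: "\<And>s y. k1 s y = k2 s (\<Lambda> s y)"
    and le1: "\<And>y. (\<integral>\<^sup>+s. k1 s y \<partial>S) \<le> C" and le2: "\<And>y. (\<integral>\<^sup>+s. k2 s y \<partial>S) \<le> C"
    and F [measurable]: "F \<in> borel_measurable Y" and H [measurable]: "H \<in> borel_measurable Y"
    and F0: "\<And>y. 0 \<le> F y" and H0: "\<And>y. 0 \<le> H y" and c: "0 < c"
  shows "(\<integral>\<^sup>+s. \<integral>\<^sup>+y. k1 s y * ennreal (F (\<Lambda> s y) * H y) \<partial>Y \<partial>S)
    \<le> C * (ennreal (c / 2) * (\<integral>\<^sup>+y. ennreal ((F y)\<^sup>2) \<partial>Y) + ennreal (1 / (2 * c)) * (\<integral>\<^sup>+y. ennreal ((H y)\<^sup>2) \<partial>Y))"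
proof -
  interpret S: sigma_finite_measure S by (rule sf)
  interpret Y: sigma_finite_measure Y by (rule sf)
  interpret P: pair_sigma_finite S Y ..
  note [measurable] = k1 k2 \<Lambda> \<Lambda>2
  let ?F2 = "\<lambda>y. ennreal ((F y)\<^sup>2)" and ?H2 = "\<lambda>y. ennreal ((H y)\<^sup>2)"
  have k1': "k1 s \<in> borel_measurable Y" and k2': "k2 s \<in> borel_measurable Y" if "s \<in> space S" for s
    using measurable_Pair2[OF k1 that] measurable_Pair2[OF k2 that] by simp_all
  have amgm: "ennreal (F z * H y) \<le> ennreal (c / 2) * ?F2 z + ennreal (1 / (2 * c)) * ?H2 y" for z y
  proof -
    have "0 \<le> (c * F z - H y)\<^sup>2 / (2 * c)" using c by simp
    also have "\<dots> = (c / 2) * (F z)\<^sup>2 + 1 / (2 * c) * (H y)\<^sup>2 - F z * H y"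
      using c by (simp add: field_simps power2_eq_square)
    finally have "ennreal (F z * H y) \<le> ennreal ((c / 2) * (F z)\<^sup>2 + 1 / (2 * c) * (H y)\<^sup>2)"
      by (intro ennreal_leI) simp
    also have "\<dots> = ennreal (c / 2) * ?F2 z + ennreal (1 / (2 * c)) * ?H2 y"
      using c by (subst ennreal_plus) (simp_all add: ennreal_mult[symmetric])
    finally show ?thesis .
  qed
  have bound: "(\<integral>\<^sup>+s. \<integral>\<^sup>+y. k s y * g y \<partial>Y \<partial>S) \<le> C * (\<integral>\<^sup>+y. g y \<partial>Y)"
    if [measurable]: "case_prod k \<in> borel_measurable (S \<Otimes>\<^sub>M Y)" "g \<in> borel_measurable Y"
      and le: "\<And>y. (\<integral>\<^sup>+s. k s y \<partial>S) \<le> C" for k g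
  proof -
    have "(\<integral>\<^sup>+s. \<integral>\<^sup>+y. k s y * g y \<partial>Y \<partial>S) = (\<integral>\<^sup>+y. \<integral>\<^sup>+s. k s y * g y \<partial>S \<partial>Y)"
      by (rule P.Fubini'[symmetric]) measurable
    also have "\<dots> = (\<integral>\<^sup>+y. (\<integral>\<^sup>+s. k s y \<partial>S) * g y \<partial>Y)"
      by (intro nn_integral_cong nn_integral_multc) measurable
    also have "\<dots> \<le> (\<integral>\<^sup>+y. C * g y \<partial>Y)" by (intro nn_integral_mono mult_right_mono le) simp
    also have "\<dots> = C * (\<integral>\<^sup>+y. g y \<partial>Y)" by (rule nn_integral_cmult) measurable
    finally show ?thesis .
  qed
  have "(\<integral>\<^sup>+s. \<integral>\<^sup>+y. k1 s y * ennreal (F (\<Lambda> s y) * H y) \<partial>Y \<partial>S)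
      \<le> (\<integral>\<^sup>+s. \<integral>\<^sup>+y. k1 s y * (ennreal (c / 2) * ?F2 (\<Lambda> s y) + ennreal (1 / (2 * c)) * ?H2 y) \<partial>Y \<partial>S)"
    by (intro nn_integral_mono mult_left_mono amgm) simp
  also have "\<dots> = (\<integral>\<^sup>+s. (\<integral>\<^sup>+y. k2 s y * (ennreal (c / 2) * ?F2 y) \<partial>Y)
    + (\<integral>\<^sup>+y. k1 s y * (ennreal (1 / (2 * c)) * ?H2 y) \<partial>Y) \<partial>S)"
  proof (rule nn_integral_cong)
    fix s assume s: "s \<in> space S"
    note [measurable] = k1'[OF s] k2'[OF s]
    have "(\<integral>\<^sup>+y. k1 s y * (ennreal (c / 2) * ?F2 (\<Lambda> s y) + ennreal (1 / (2 * c)) * ?H2 y) \<partial>Y)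
        = (\<integral>\<^sup>+y. k1 s y * (ennreal (c / 2) * ?F2 (\<Lambda> s y)) \<partial>Y)
          + (\<integral>\<^sup>+y. k1 s y * (ennreal (1 / (2 * c)) * ?H2 y) \<partial>Y)"
      unfolding distrib_left by (rule nn_integral_add) measurable
    also have "(\<integral>\<^sup>+y. k1 s y * (ennreal (c / 2) * ?F2 (\<Lambda> s y)) \<partial>Y)
        = (\<integral>\<^sup>+y. k2 s y * (ennreal (c / 2) * ?F2 y) \<partial>distr Y Y (\<Lambda> s))"
      unfolding k12 by (rule nn_integral_distr[symmetric]) measurable
    finally show "(\<integral>\<^sup>+y. k1 s y * (ennreal (c / 2) * ?F2 (\<Lambda> s y) + ennreal (1 / (2 * c)) * ?H2 y) \<partial>Y)
        = (\<integral>\<^sup>+y. k2 s y * (ennreal (c / 2) * ?F2 y) \<partial>Y) + (\<integral>\<^sup>+y. k1 s y * (ennreal (1 / (2 * c)) * ?H2 y) \<partial>Y)"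
      unfolding pres .
  qed
  also have "\<dots> = (\<integral>\<^sup>+s. \<integral>\<^sup>+y. k2 s y * (ennreal (c / 2) * ?F2 y) \<partial>Y \<partial>S)
      + (\<integral>\<^sup>+s. \<integral>\<^sup>+y. k1 s y * (ennreal (1 / (2 * c)) * ?H2 y) \<partial>Y \<partial>S)"
    by (rule nn_integral_add) measurable
  also have "\<dots> \<le> C * (\<integral>\<^sup>+y. ennreal (c / 2) * ?F2 y \<partial>Y) + C * (\<integral>\<^sup>+y. ennreal (1 / (2 * c)) * ?H2 y \<partial>Y)"
    by (intro add_mono bound le1 le2) measurable
  also have "\<dots> = C * (ennreal (c / 2) * (\<integral>\<^sup>+y. ?F2 y \<partial>Y) + ennreal (1 / (2 * c)) * (\<integral>\<^sup>+y. ?H2 y \<partial>Y))"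
    by (simp add: nn_integral_cmult distrib_left)
  finally show ?thesis .
qed

text \<open>In the window \<open>exp (- s) * a\<close> lies between \<open>b - R\<close> and
  \<open>b + R\<close>, so \<open>s\<close> lies in an interval of length
  \<open>ln ((b + R) / (b - R))\<close>, and \<open>ln x \<le> x - 1\<close>. What matters is the
  decay in \<open>b\<close>, uniformly in \<open>a\<close>.\<close>

lemma emeasure_exp_window:
  assumes R: "0 < R" "R < b" and a: "0 \<le> a"
  shows "emeasure lborel {s :: real. \<bar>exp (- s) * a - b\<bar> \<le> R} \<le> ennreal (2 * R / (b - R))"
proof (cases "a = 0")
  case True
  then have "{s :: real. \<bar>exp (- s) * a - b\<bar> \<le> R} = {}" using R by auto
  then show ?thesis by simp
next
  case False
  then have a: "0 < a" using assms(3) by simp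
  let ?l = "ln (a / (b + R))" and ?u = "ln (a / (b - R))"
  have sub: "{s :: real. \<bar>exp (- s) * a - b\<bar> \<le> R} \<subseteq> {?l..?u}"
  proof
    fix s assume "s \<in> {s :: real. \<bar>exp (- s) * a - b\<bar> \<le> R}"
    then have 1: "b - R \<le> a / exp s" and 2: "a / exp s \<le> b + R"
      by (simp_all add: exp_minus divide_inverse mult.commute abs_le_iff)
    have "exp s \<le> a / (b - R)" using 1 R by (simp add: field_simps)
    moreover have "a / (b + R) \<le> exp s" using 2 R by (simp add: field_simps)
    ultimately show "s \<in> {?l..?u}"
      using a R ln_le_cancel_iff[of "a / (b + R)" "exp s"] ln_le_cancel_iff[of "exp s" "a / (b - R)"]
      by simp
  qed
  have "?u - ?l = ln ((b + R) / (b - R))" using a R by (simp add: ln_div)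
  also have "\<dots> \<le> (b + R) / (b - R) - 1" using R by (intro ln_le_minus_one) simp
  also have "\<dots> = 2 * R / (b - R)" using R by (simp add: field_simps)
  finally have len: "?u - ?l \<le> 2 * R / (b - R)" .
  have "emeasure lborel {s :: real. \<bar>exp (- s) * a - b\<bar> \<le> R} \<le> emeasure lborel {?l..?u}"
    using sub by (rule emeasure_mono) simp
  also have "\<dots> \<le> ennreal (2 * R / (b - R))"
    using len R by (simp add: emeasure_lborel_Icc_eq ennreal_leI)
  finally show ?thesis .
qed

lemma nn_integral_window_le:
  fixes k :: "real \<Rightarrow> real"
  assumes "\<And>s. s \<in> A \<Longrightarrow> k s \<le> M" "\<And>s. s \<notin> A \<Longrightarrow> k s \<le> 0"
    and A [measurable]: "A \<in> sets lborel" and le: "emeasure lborel A \<le> ennreal d"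
    and M: "0 \<le> M" "0 \<le> d" "M * d \<le> D"
  shows "(\<integral>\<^sup>+s. ennreal (k s) \<partial>lborel) \<le> ennreal D"
proof -
  have "(\<integral>\<^sup>+s. ennreal (k s) \<partial>lborel) \<le> (\<integral>\<^sup>+s. ennreal M * indicator A s \<partial>lborel)"
  proof (rule nn_integral_mono)
    fix s
    show "ennreal (k s) \<le> ennreal M * indicator A s"
      using assms(1,2)[of s] by (cases "s \<in> A") (simp_all add: ennreal_leI ennreal_neg)
  qed
  also have "\<dots> = ennreal M * emeasure lborel A" by (rule nn_integral_cmult_indicator[OF A])
  also have "\<dots> \<le> ennreal M * ennreal d" by (intro mult_left_mono le) simp
  also have "\<dots> \<le> ennreal D" using M by (simp add: ennreal_leI flip: ennreal_mult)
  finally show ?thesis .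
qed

text \<open>Two regimes. For \<open>a \<le> 2 * R\<close> the weight is bounded and \<open>s\<close>
  ranges over an interval of length \<open>2 * L\<close>. For larger \<open>a\<close> the window has
  measure at most \<open>2 * R / (a - R)\<close>, hence at most \<open>4 * R / a\<close>, which
  cancels the weight \<open>a\<close>.\<close>

lemma exp_window_integral_1:
  assumes R: "0 < R" and L: "0 \<le> L" and a: "0 \<le> a" and b: "0 \<le> b"
  shows "(\<integral>\<^sup>+s. ennreal (indicator {-L..L} s * (if \<bar>exp (- s) * b - a\<bar> \<le> R then a else 0)) \<partial>lborel)
    \<le> ennreal (6 * R * (L + 1))"
proof (cases "a \<le> 2 * R")
  case True
  show ?thesis
    by (rule nn_integral_window_le[where A = "{-L..L}" and M = "2 * R" and d = "2 * L"])
      (use True R L a in \<open>simp_all add: algebra_simps\<close>)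
next
  case False
  have "a * (2 * R / (a - R)) \<le> 4 * R"
    using False R by (simp add: field_simps)
  moreover have "4 * R \<le> 6 * R * (L + 1)" using R L by (simp add: algebra_simps)
  ultimately have *: "a * (2 * R / (a - R)) \<le> 6 * R * (L + 1)" by linarith
  show ?thesis
    by (rule nn_integral_window_le[where A = "{s. \<bar>exp (- s) * b - a\<bar> \<le> R}" and M = a
      and d = "2 * R / (a - R)"])
      (use False R L a b * in \<open>simp_all add: emeasure_exp_window indicator_def\<close>)
qed

text \<open>The kernel seen from the other side: inside the window the weight is at most
  \<open>b + R\<close>. For \<open>b \<le> 2 * R\<close> this gives \<open>3 * R\<close> on an
  interval of length \<open>2 * L\<close>; for larger \<open>b\<close> the quotient
  \<open>(b + R) / (b - R)\<close> is at most 3. Both regimes lead to the constant 6.\<close>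

lemma exp_window_integral_2:
  assumes R: "0 < R" and L: "0 \<le> L" and a: "0 \<le> a" and b: "0 \<le> b"
  shows "(\<integral>\<^sup>+s. ennreal (indicator {-L..L} s * (if \<bar>exp (- s) * a - b\<bar> \<le> R then exp (- s) * a else 0)) \<partial>lborel)
    \<le> ennreal (6 * R * (L + 1))"
proof (cases "b \<le> 2 * R")
  case True
  show ?thesis
  proof (rule nn_integral_window_le[where A = "{-L..L}" and M = "3 * R" and d = "2 * L"])
    fix s
    show "indicator {-L..L} s * (if \<bar>exp (- s) * a - b\<bar> \<le> R then exp (- s) * a else 0) \<le> 3 * R"
      if "s \<in> {-L..L}"
      using True R that by (auto simp: abs_le_iff)
  qed (use True R L a in \<open>simp_all add: algebra_simps\<close>)
next
  case False
  have "(b + R) * (2 * R / (b - R)) = 2 * R * ((b + R) / (b - R))" by simp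
  also have "\<dots> \<le> 2 * R * 3" using False R by (intro mult_left_mono) (simp_all add: field_simps)
  also have "\<dots> \<le> 6 * R * (L + 1)" using R L by (simp add: algebra_simps)
  finally have *: "(b + R) * (2 * R / (b - R)) \<le> 6 * R * (L + 1)" .
  show ?thesis
  proof (rule nn_integral_window_le[where A = "{s. \<bar>exp (- s) * a - b\<bar> \<le> R}" and M = "b + R"
    and d = "2 * R / (b - R)"])
    fix s
    show "indicator {-L..L} s * (if \<bar>exp (- s) * a - b\<bar> \<le> R then exp (- s) * a else 0) \<le> b + R"
      using False R b by (auto simp: indicator_def abs_le_iff)
  qed (use False R L a b * in \<open>simp_all add: emeasure_exp_window\<close>)
qed

text \<open>A continuous left inverse \<open>\<psi>\<close> does the work of properness: the support
  of the composition lies in the image under \<open>\<psi>\<close> of the support of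
  \<open>f\<close>. This covers homeomorphisms and the embeddings of single fibres alike.\<close>

lemma Cc_compose:
  fixes \<phi> :: "'b::t2_space \<Rightarrow> 'a::topological_space"
  assumes f: "f \<in> Cc" and \<phi>: "continuous_on UNIV \<phi>" and \<psi>: "continuous_on UNIV \<psi>"
    and inv: "\<And>x. \<psi> (\<phi> x) = x"
  shows "(\<lambda>x. f (\<phi> x)) \<in> Cc"
proof -
  let ?K = "closure {x. f x \<noteq> 0}"
  have fc: "continuous_on UNIV f" and K: "compact ?K"
    using f by (simp_all add: Cc_def compactly_supported_def)
  have \<psi>K: "compact (\<psi> ` ?K)"
    by (rule compact_continuous_image[OF continuous_on_subset[OF \<psi> subset_UNIV] K])
  have "x \<in> \<psi> ` ?K" if "f (\<phi> x) \<noteq> 0" for x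
  proof -
    have "\<phi> x \<in> ?K" using that subsetD[OF closure_subset, of "\<phi> x" "{x. f x \<noteq> 0}"] by simp
    then have "\<psi> (\<phi> x) \<in> \<psi> ` ?K" by (rule imageI)
    then show ?thesis by (simp only: inv)
  qed
  then have "closure {x. f (\<phi> x) \<noteq> 0} \<subseteq> \<psi> ` ?K"
    by (intro closure_minimal subsetI compact_imp_closed[OF \<psi>K]) simp
  then have "compact (closure {x. f (\<phi> x) \<noteq> 0})"
    using compact_Int_closed[OF \<psi>K closed_closure[of "{x. f (\<phi> x) \<noteq> 0}"]] by (simp add: Int_absorb1)
  moreover have "continuous_on UNIV (\<lambda>x. f (\<phi> x))"
    by (rule continuous_on_compose2[OF fc \<phi>]) simp
  ultimately show ?thesis by (simp add: Cc_def compactly_supported_def)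
qed

lemma Cc_mult:
  fixes f g :: "'a::t2_space \<Rightarrow> complex"
  assumes f: "continuous_on UNIV f" and g: "g \<in> Cc"
  shows "(\<lambda>x. f x * g x) \<in> Cc"
proof -
  have gc: "continuous_on UNIV g" and K: "compact (closure {x. g x \<noteq> 0})"
    using g by (simp_all add: Cc_def compactly_supported_def)
  have "closure {x. f x * g x \<noteq> 0} \<subseteq> closure {x. g x \<noteq> 0}"
    by (rule closure_mono) auto
  then have "compact (closure {x. f x * g x \<noteq> 0})"
    using compact_Int_closed[OF K closed_closure[of "{x. f x * g x \<noteq> 0}"]] by (simp add: Int_absorb1)
  moreover have "continuous_on UNIV (\<lambda>x. f x * g x)" by (intro continuous_intros f gc)
  ultimately show ?thesis by (simp add: Cc_def compactly_supported_def)
qed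

lemma Cc_cnj: "f \<in> Cc \<Longrightarrow> (\<lambda>x. cnj (f x)) \<in> Cc"
  by (auto simp: Cc_def compactly_supported_def intro!: continuous_intros)

lemma Cc_continuous: "f \<in> Cc \<Longrightarrow> continuous_on UNIV f"
  by (simp add: Cc_def)

text \<open>Valid without integrability, since the Bochner integral is then 0; intermediate
  integrals need no separate check.\<close>

lemma ennreal_norm_integral_le:
  fixes f :: "'a \<Rightarrow> complex"
  shows "ennreal (norm (integral\<^sup>L M f)) \<le> (\<integral>\<^sup>+x. ennreal (norm (f x)) \<partial>M)"
proof (cases "integrable M f")
  case True
  then show ?thesis by (rule integral_norm_bound_ennreal)
next
  case False
  then show ?thesis by (simp add: not_integrable_integral_eq)
qed

section \<open>Integration and Fourier transform along the fibres\<close>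

lemma integrable_fibre_haar_Cc:
  assumes f: "f \<in> Cc"
  shows "integrable fibre_haar f"
proof -
  have "(\<lambda>y. complex_of_real (exp (- 2 * (fst (fst y) + snd (fst y)))) * f y) \<in> Cc"
    by (rule Cc_mult[OF _ f]) (intro continuous_intros)
  from Cc_integrable[OF this] have "integrable lborel (\<lambda>y. exp (- 2 * (fst (fst y) + snd (fst y))) *\<^sub>R f y)"
    by (simp add: scaleR_conv_of_real)
  moreover have "f \<in> borel_measurable lborel" using Cc_measurable[OF f] by simp
  moreover have "(\<lambda>y. exp (- 2 * (fst (fst y) + snd (fst y)))) \<in> borel_measurable
    (lborel :: ((real \<times> real) \<times> ((real^2) \<times> (real^2))) measure)"
    using borel_measurable_continuous_onI[of
      "\<lambda>y :: (real \<times> real) \<times> ((real^2) \<times> (real^2)). exp (- 2 * (fst (fst y) + snd (fst y)))"]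
    by (simp add: continuous_intros)
  ultimately show ?thesis
    unfolding fibre_haar_def by (subst integrable_density) simp_all
qed

lemma integral_fibre_haar:
  fixes f :: "(real \<times> real) \<times> ((real^2) \<times> (real^2)) \<Rightarrow> complex"
  assumes f: "integrable fibre_haar f"
  shows "(LINT y|fibre_haar. f y)
    = (LINT t|lborel. of_real (exp (- 2 * (fst t + snd t))) * (LINT z|lborel. f (t, z)))"
proof -
  have fm: "f \<in> borel_measurable lborel"
    using borel_measurable_integrable[OF f] by (simp cong: measurable_cong_sets)
  have wm: "(\<lambda>y. exp (- 2 * (fst (fst y) + snd (fst y)))) \<in> borel_measurable
    (lborel :: ((real \<times> real) \<times> ((real^2) \<times> (real^2))) measure)"
    using borel_measurable_continuous_onI[of
      "\<lambda>y :: (real \<times> real) \<times> ((real^2) \<times> (real^2)). exp (- 2 * (fst (fst y) + snd (fst y)))"]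
    by (simp add: continuous_intros)
  have int: "integrable lborel (\<lambda>y. exp (- 2 * (fst (fst y) + snd (fst y))) *\<^sub>R f y)"
    using f unfolding fibre_haar_def by (subst (asm) integrable_density[OF fm wm]) simp_all
  have "(LINT y|fibre_haar. f y) = (LINT y|lborel. exp (- 2 * (fst (fst y) + snd (fst y))) *\<^sub>R f y)"
    unfolding fibre_haar_def by (rule integral_density[OF fm wm]) simp
  also have "\<dots> = (LINT y|(lborel \<Otimes>\<^sub>M lborel). exp (- 2 * (fst (fst y) + snd (fst y))) *\<^sub>R f y)"
    by (simp only: lborel_prod)
  also have "\<dots> = (LINT t|lborel. LINT z|lborel. exp (- 2 * (fst (fst (t, z)) + snd (fst (t, z)))) *\<^sub>R f
    (t, z))"
    by (rule lborel_pair.integral_fst'[symmetric]) (use int in \<open>simp only: lborel_prod\<close>)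
  also have "\<dots> = (LINT t|lborel. of_real (exp (- 2 * (fst t + snd t))) * (LINT z|lborel. f (t, z)))"
    by (simp only: fst_conv snd_conv scaleR_conv_of_real integral_mult_right_zero)
  finally show ?thesis .
qed

lemma Cc_fibre_coord: "\<xi> \<in> Cc \<Longrightarrow> (\<lambda>y. \<xi> (fibre_coord y)) \<in> Cc"
  unfolding fibre_coord_def
  by (erule Cc_compose[where \<psi> = "\<lambda>z. ((snd (fst z), snd (snd z)), (fst (fst z), fst (snd z)))"])
    (auto intro!: continuous_intros)

lemma Cc_fibre_slice: "\<xi> \<in> Cc \<Longrightarrow> (\<lambda>z. \<xi> (fibre_coord (t, z))) \<in> Cc"
  unfolding fibre_coord_def
  by (erule Cc_compose[where \<psi> = "\<lambda>z. (fst (fst z), fst (snd z))"]) (auto intro!: continuous_intros)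

lemma Cc_square_integrable_haar2:
  assumes \<xi>: "\<xi> \<in> Cc"
  shows "\<xi> \<in> square_integrable haar2"
proof -
  have m: "\<xi> \<in> borel_measurable haar2"
    using Cc_measurable[OF \<xi>] by (subst measurable_cong_sets[OF sets_haar2 refl])
  have "(\<lambda>y. cnj (\<xi> (fibre_coord y)) * \<xi> (fibre_coord y)) \<in> Cc"
    by (intro Cc_mult Cc_continuous Cc_cnj Cc_fibre_coord \<xi>)
  from integrable_norm[OF integrable_fibre_haar_Cc[OF this]]
  have "integrable fibre_haar (\<lambda>y. (cmod (\<xi> (fibre_coord y)))\<^sup>2)"
    by (simp add: norm_mult power2_eq_square)
  then have "integrable haar2 (\<lambda>z. (cmod (\<xi> z))\<^sup>2)"
    using m by (subst haar2_eq_distr, subst integrable_distr_eq[OF measurable_fibre_coord_haar2]) simp_all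
  then show ?thesis using m by (simp add: square_integrable_def)
qed

text \<open>The transform acts on the two planes together, while the real coordinates are kept. The
  second component of \<open>y\<close> then holds the dual variables \<open>(p, q)\<close>; as the
  weight of \<open>fibre_haar\<close> does not involve it, the same measure is used on the Fourier
  side.\<close>

definition fibre_fourier ::
  "(((real^2) \<times> real) \<times> ((real^2) \<times> real) \<Rightarrow> complex) \<Rightarrow> (real \<times> real) \<times> ((real^2) \<times> (real^2)) \<Rightarrow> complex" where
  "fibre_fourier \<xi> y = fourier_transform (\<lambda>z. \<xi> (fibre_coord (fst y, z))) (snd y)"

lemma fibre_fourier_measurable:
  assumes \<xi>: "\<xi> \<in> Cc"
  shows "fibre_fourier \<xi> \<in> borel_measurable borel"
proof -
  have "continuous_on UNIV (\<lambda>x :: ((real \<times> real) \<times> ((real^2) \<times> (real^2))) \<times> ((real^2) \<times> (real^2)).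
      cis (- (snd x \<bullet> snd (fst x))) * \<xi> (fibre_coord (fst (fst x), snd x)))"
    unfolding fibre_coord_def
    by (intro continuous_intros continuous_on_compose2[OF Cc_continuous[OF \<xi>]]) auto
  from borel_measurable_continuous_onI[OF this]
  have "(\<lambda>(y :: (real \<times> real) \<times> ((real^2) \<times> (real^2)), z). cis (- (z \<bullet> snd y)) * \<xi> (fibre_coord (fst y, z)))
      \<in> borel_measurable borel"
    by (simp only: case_prod_beta')
  moreover have "sets ((borel :: ((real \<times> real) \<times> ((real^2) \<times> (real^2))) measure) \<Otimes>\<^sub>M
    (lborel :: ((real^2) \<times> (real^2)) measure)) = sets borel"
    by (subst borel_prod[symmetric]) (intro sets_pair_measure_cong refl sets_lborel)
  ultimately have "(\<lambda>(y :: (real \<times> real) \<times> ((real^2) \<times> (real^2)), z). cis (- (z \<bullet> snd y))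
    * \<xi> (fibre_coord (fst y, z)))
      \<in> borel_measurable (borel \<Otimes>\<^sub>M lborel)"
    using measurable_cong_sets[OF _ refl] by blast
  from lborel.borel_measurable_lebesgue_integral[OF this]
  show ?thesis by (simp add: fibre_fourier_def[abs_def] fourier_transform_def)
qed

text \<open>The Plancherel bound on each fibre, integrated against the weight. The two planes have
  total dimension 4, hence \<open>(2 * pi) ^ 4\<close> for the squares.\<close>

lemma fibre_fourier_square_integrable:
  assumes \<xi>: "\<xi> \<in> Cc"
  shows "fibre_fourier \<xi> \<in> square_integrable fibre_haar"
    and "l2_norm fibre_haar (fibre_fourier \<xi>) \<le> (2 * pi)\<^sup>2 * l2_norm haar2 \<xi>"
proof -
  have m: "fibre_fourier \<xi> \<in> borel_measurable fibre_haar"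
    using fibre_fourier_measurable[OF \<xi>] by (subst measurable_cong_sets[OF sets_fibre_haar refl])
  have mc: "(\<lambda>y. ennreal ((cmod (\<xi> (fibre_coord y)))\<^sup>2)) \<in> borel_measurable borel"
    using Cc_measurable[OF Cc_fibre_coord[OF \<xi>]] by measurable
  have slice: "(\<integral>\<^sup>+z. ennreal ((cmod (fibre_fourier \<xi> (t, z)))\<^sup>2) \<partial>lborel)
      \<le> ennreal ((2 * pi) ^ 4) * (\<integral>\<^sup>+z. ennreal ((cmod (\<xi> (fibre_coord (t, z))))\<^sup>2) \<partial>lborel)" for t
  proof -
    note s = Cc_fibre_slice[OF \<xi>, of t]
    let ?f = "\<lambda>z. \<xi> (fibre_coord (t, z))"
    have "(\<integral>\<^sup>+z. ennreal ((cmod (fibre_fourier \<xi> (t, z)))\<^sup>2) \<partial>lborel)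
        = ennreal ((l2_norm lborel (fourier_transform ?f))\<^sup>2)"
      unfolding fibre_fourier_def fst_conv snd_conv
      by (rule nn_integral_square_integrable[OF fourier_transform_square_integrable(1)[OF s]])
    also have "\<dots> \<le> ennreal ((sqrt ((2 * pi) ^ 4) * l2_norm lborel ?f)\<^sup>2)"
      using fourier_transform_square_integrable(2)[OF s] by (intro ennreal_leI power_mono) simp_all
    also have "\<dots> = ennreal ((2 * pi) ^ 4) * ennreal ((l2_norm lborel ?f)\<^sup>2)"
      by (simp add: power_mult_distrib ennreal_mult)
    also have "ennreal ((l2_norm lborel ?f)\<^sup>2) = (\<integral>\<^sup>+z. ennreal ((cmod (?f z))\<^sup>2) \<partial>lborel)"
      by (rule nn_integral_square_integrable[OF Cc_square_integrable[OF s], symmetric])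
    finally show ?thesis .
  qed
  have mz: "(\<lambda>t. ennreal (exp (- 2 * (fst t + snd t)))
    * (\<integral>\<^sup>+z. ennreal ((cmod (\<xi> (fibre_coord (t, z))))\<^sup>2) \<partial>lborel)) \<in> borel_measurable lborel"
  proof -
    have [measurable]: "(\<lambda>y. ennreal ((cmod (\<xi> (fibre_coord y)))\<^sup>2)) \<in> borel_measurable (borel \<Otimes>\<^sub>M borel)"
      using mc by (simp only: borel_prod)
    show ?thesis by measurable
  qed
  have "(\<integral>\<^sup>+y. ennreal ((cmod (fibre_fourier \<xi> y))\<^sup>2) \<partial>fibre_haar)
      = (\<integral>\<^sup>+t. \<integral>\<^sup>+z. ennreal (exp (- 2 * (fst t + snd t))) * ennreal ((cmod (fibre_fourier \<xi> (t, z)))\<^sup>2)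
        \<partial>lborel \<partial>lborel)"
    using fibre_fourier_measurable[OF \<xi>] by (intro nn_integral_fibre_haar) measurable
  also have "\<dots> = (\<integral>\<^sup>+t. ennreal (exp (- 2 * (fst t + snd t)))
    * (\<integral>\<^sup>+z. ennreal ((cmod (fibre_fourier \<xi> (t, z)))\<^sup>2) \<partial>lborel) \<partial>lborel)"
  proof (intro nn_integral_cong nn_integral_cmult)
    fix t
    show "(\<lambda>z. ennreal ((cmod (fibre_fourier \<xi> (t, z)))\<^sup>2)) \<in> borel_measurable lborel"
      using square_integrable_measurable[OF
        fourier_transform_square_integrable(1)[OF Cc_fibre_slice[OF \<xi>, of t]]]
      unfolding fibre_fourier_def fst_conv snd_conv by measurable
  qed
  also have "\<dots> \<le> (\<integral>\<^sup>+t. ennreal (exp (- 2 * (fst t + snd t)))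
    * (ennreal ((2 * pi) ^ 4) * (\<integral>\<^sup>+z. ennreal ((cmod (\<xi> (fibre_coord (t, z))))\<^sup>2) \<partial>lborel)) \<partial>lborel)"
    by (intro nn_integral_mono mult_left_mono slice) simp
  also have "\<dots> = ennreal ((2 * pi) ^ 4) * (\<integral>\<^sup>+t. ennreal (exp (- 2 * (fst t + snd t)))
    * (\<integral>\<^sup>+z. ennreal ((cmod (\<xi> (fibre_coord (t, z))))\<^sup>2) \<partial>lborel) \<partial>lborel)"
    by (subst nn_integral_cmult[OF mz, symmetric]) (simp only: mult.left_commute)
  also have "(\<integral>\<^sup>+t. ennreal (exp (- 2 * (fst t + snd t)))
    * (\<integral>\<^sup>+z. ennreal ((cmod (\<xi> (fibre_coord (t, z))))\<^sup>2) \<partial>lborel) \<partial>lborel)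
      = (\<integral>\<^sup>+t. \<integral>\<^sup>+z. ennreal (exp (- 2 * (fst t + snd t))) * ennreal ((cmod (\<xi> (fibre_coord (t, z))))\<^sup>2)
        \<partial>lborel \<partial>lborel)"
  proof (intro nn_integral_cong nn_integral_cmult[symmetric])
    fix t
    show "(\<lambda>z. ennreal ((cmod (\<xi> (fibre_coord (t, z))))\<^sup>2)) \<in> borel_measurable lborel"
      using Cc_measurable[OF Cc_fibre_slice[OF \<xi>, of t]] by measurable
  qed
  also have "\<dots> = (\<integral>\<^sup>+y. ennreal ((cmod (\<xi> (fibre_coord y)))\<^sup>2) \<partial>fibre_haar)"
    by (rule nn_integral_fibre_haar[OF mc, symmetric])
  also have "\<dots> = (\<integral>\<^sup>+z. ennreal ((cmod (\<xi> z))\<^sup>2) \<partial>distr fibre_haar haar2 fibre_coord)"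
    using square_integrable_measurable[OF Cc_square_integrable_haar2[OF \<xi>]]
    by (intro nn_integral_distr[symmetric] measurable_fibre_coord_haar2) simp
  also have "\<dots> = ennreal ((l2_norm haar2 \<xi>)\<^sup>2)"
    unfolding haar2_eq_distr[symmetric]
    by (rule nn_integral_square_integrable[OF Cc_square_integrable_haar2[OF \<xi>]])
  also have "ennreal ((2 * pi) ^ 4) * ennreal ((l2_norm haar2 \<xi>)\<^sup>2) = ennreal (((2 * pi)\<^sup>2 * l2_norm haar2 \<xi>)\<^sup>2)"
    by (simp add: power_mult_distrib ennreal_mult)
  finally have le: "(\<integral>\<^sup>+y. ennreal ((cmod (fibre_fourier \<xi> y))\<^sup>2) \<partial>fibre_haar)
    \<le> ennreal (((2 * pi)\<^sup>2 * l2_norm haar2 \<xi>)\<^sup>2)" .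
  show "fibre_fourier \<xi> \<in> square_integrable fibre_haar"
    "l2_norm fibre_haar (fibre_fourier \<xi>) \<le> (2 * pi)\<^sup>2 * l2_norm haar2 \<xi>"
    by (rule square_integrableI_nn_integral[OF m le]; simp)+
qed

text \<open>The transport of \<open>fibre_fourier\<close> by \<open>\<lambda>((0, s), (0, - s))\<close>; on the dual of the plane the
  matrices act by their transposes, hence \<open>- \<theta>\<close>.\<close>

definition fibre_transport :: "real \<Rightarrow> real \<Rightarrow> (real \<times> real) \<times> ((real^2) \<times> (real^2)) \<Rightarrow> (real \<times> real) \<times>
  ((real^2) \<times> (real^2))" where
  "fibre_transport \<theta> s y = ((- s, s) + fst y,
    (grelaud_tau (- \<theta>) s *v fst (snd y), grelaud_tau (- \<theta>) (- s) *v snd (snd y)))"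

lemma measurable_fibre_transport: "(\<lambda>x. fibre_transport \<theta> (fst x) (snd x)) \<in> borel \<rightarrow>\<^sub>M borel"
  unfolding fibre_transport_def by (intro borel_measurable_continuous_onI continuous_intros)

lemma measurable_fibre_transport2: "fibre_transport \<theta> s \<in> fibre_haar \<rightarrow>\<^sub>M fibre_haar"
proof (subst measurable_cong_sets[OF sets_fibre_haar sets_fibre_haar])
  show "fibre_transport \<theta> s \<in> borel \<rightarrow>\<^sub>M borel"
    unfolding fibre_transport_def[abs_def] by (intro borel_measurable_continuous_onI continuous_intros)
qed

text \<open>The shift by \<open>(- s, s)\<close> preserves the sum of the real coordinates, on which
  alone the weight depends, and on the planes the Jacobians for \<open>s\<close> and
  \<open>- s\<close> cancel. This is where the evaluation at a group element and its inverse
  enters.\<close>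

lemma distr_fibre_transport: "distr fibre_haar fibre_haar (fibre_transport \<theta> s) = fibre_haar"
proof (rule distr_eqI_nn_integral[OF measurable_fibre_transport2])
  fix f :: "(real \<times> real) \<times> ((real^2) \<times> (real^2)) \<Rightarrow> ennreal" assume fh: "f \<in> borel_measurable fibre_haar"
  then have f: "f \<in> borel_measurable borel" by (simp cong: measurable_cong_sets)
  have fp [measurable]: "f \<in> borel_measurable (borel \<Otimes>\<^sub>M borel)" using f by (simp only: borel_prod)
  let ?T = "\<lambda>(a, b). (0 + grelaud_tau (- \<theta>) s *v a, 0 + grelaud_tau (- \<theta>) (- s) *v b)"
  have T: "?T \<in> lborel \<rightarrow>\<^sub>M lborel"
  proof -
    have "?T \<in> borel \<rightarrow>\<^sub>M borel"
      unfolding case_prod_beta' by (intro borel_measurable_continuous_onI continuous_intros)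
    then show ?thesis by simp
  qed
  have ft: "(\<lambda>y. f (fibre_transport \<theta> s y)) \<in> borel_measurable borel"
    using measurable_compose[OF measurable_fibre_transport2 fh] by (simp cong: measurable_cong_sets)
  have mF: "(\<lambda>t. \<integral>\<^sup>+z. ennreal (exp (- 2 * (fst t + snd t))) * f (t, z) \<partial>lborel) \<in> borel_measurable borel"
    by measurable
  have "(\<integral>\<^sup>+y. f (fibre_transport \<theta> s y) \<partial>fibre_haar)
      = (\<integral>\<^sup>+t. \<integral>\<^sup>+z. ennreal (exp (- 2 * (fst t + snd t))) * f (fibre_transport \<theta> s (t, z)) \<partial>lborel \<partial>lborel)"
    by (rule nn_integral_fibre_haar[OF ft])
  also have "\<dots> = (\<integral>\<^sup>+t. \<integral>\<^sup>+z. ennreal (exp (- 2 * (fst ((- s, s) + t) + snd ((- s, s) + t))))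
    * f ((- s, s) + t, z) \<partial>lborel \<partial>lborel)"
  proof (rule nn_integral_cong)
    fix t :: "real \<times> real"
    have "(\<integral>\<^sup>+z. ennreal (exp (- 2 * (fst ((- s, s) + t) + snd ((- s, s) + t)))) * f ((- s, s) + t, z) \<partial>lborel)
        = (\<integral>\<^sup>+z. ennreal (exp (- 2 * (fst ((- s, s) + t) + snd ((- s, s) + t)))) * f ((- s, s) + t, z)
          \<partial>distr lborel lborel ?T)"
      by (simp only: distr_grelaud_tau_pair)
    also have "\<dots> = (\<integral>\<^sup>+z. ennreal (exp (- 2 * (fst ((- s, s) + t) + snd ((- s, s) + t))))
      * f ((- s, s) + t, ?T z) \<partial>lborel)"
      by (rule nn_integral_distr[OF T]) measurable
    finally show "(\<integral>\<^sup>+z. ennreal (exp (- 2 * (fst t + snd t))) * f (fibre_transport \<theta> s (t, z)) \<partial>lborel)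
        = (\<integral>\<^sup>+z. ennreal (exp (- 2 * (fst ((- s, s) + t) + snd ((- s, s) + t)))) * f ((- s, s) + t, z)
          \<partial>lborel)"
      by (simp add: fibre_transport_def case_prod_beta')
  qed
  also have "\<dots> = (\<integral>\<^sup>+t. \<integral>\<^sup>+z. ennreal (exp (- 2 * (fst t + snd t))) * f (t, z) \<partial>lborel \<partial>distr lborel borel
    ((+) (- s, s)))"
    by (rule nn_integral_distr[symmetric]) (simp_all add: mF)
  also have "\<dots> = (\<integral>\<^sup>+y. f y \<partial>fibre_haar)"
    unfolding lborel_distr_plus by (rule nn_integral_fibre_haar[OF f, symmetric])
  finally show "(\<integral>\<^sup>+y. f (fibre_transport \<theta> s y) \<partial>fibre_haar) = (\<integral>\<^sup>+y. f y \<partial>fibre_haar)" .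
qed

text \<open>Transposition keeps the dilation and reverses the rotation.\<close>

lemma inner_grelaud_tau: "(grelaud_tau \<theta> s *v x) \<bullet> y = x \<bullet> (grelaud_tau (- \<theta>) s *v y)"
  by (simp add: grelaud_tau_mult inner_vec_def sum_2 algebra_simps)

text \<open>The substitution that undoes the affine map preserves \<open>lborel\<close> on the
  product of the planes. Its translations become the phase, and its matrices pass to the dual
  variables as transposes.\<close>

lemma fourier_transform_grelaud:
  fixes f :: "(real^2) \<times> (real^2) \<Rightarrow> complex"
  assumes f: "f \<in> Cc"
  shows "fourier_transform (\<lambda>z. f (grelaud_tau \<theta> (- s) *v (fst z - c), d + grelaud_tau \<theta> s *v snd z)) (p, q)
    = cis (- (c \<bullet> p) + (grelaud_tau \<theta> (- s) *v d) \<bullet> q)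
      * fourier_transform f (grelaud_tau (- \<theta>) s *v p, grelaud_tau (- \<theta>) (- s) *v q)"
proof -
  have neg: "grelaud_tau \<theta> r *v (- x) = - (grelaud_tau \<theta> r *v x)" for r x
    by (rule linear_neg[OF matrix_vector_mul_linear])
  let ?d = "- (grelaud_tau \<theta> (- s) *v d)"
  let ?T = "\<lambda>(a, b). (c + grelaud_tau \<theta> s *v a, ?d + grelaud_tau \<theta> (- s) *v b)"
  let ?H = "\<lambda>z. cis (- (z \<bullet> (p, q))) * f (grelaud_tau \<theta> (- s) *v (fst z - c), d + grelaud_tau \<theta> s *v snd z)"
  have T: "?T \<in> lborel \<rightarrow>\<^sub>M lborel"
  proof -
    have "?T \<in> borel \<rightarrow>\<^sub>M borel"
      unfolding case_prod_beta' by (intro borel_measurable_continuous_onI continuous_intros)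
    then show ?thesis by simp
  qed
  have H: "?H \<in> borel_measurable lborel"
  proof -
    have "continuous_on UNIV ?H"
      by (intro continuous_intros continuous_on_compose2[OF Cc_continuous[OF f]]) auto
    from borel_measurable_continuous_onI[OF this] show ?thesis by simp
  qed
  have "(LINT z|lborel. ?H z) = (LINT z|distr lborel lborel ?T. ?H z)"
    by (simp only: distr_grelaud_tau_pair)
  also have "\<dots> = (LINT z|lborel. ?H (?T z))" by (rule integral_distr[OF T H])
  also have "\<dots> = (LINT z|lborel. cis (- (c \<bullet> p) + (grelaud_tau \<theta> (- s) *v d) \<bullet> q)
      * (cis (- (z \<bullet> (grelaud_tau (- \<theta>) s *v p, grelaud_tau (- \<theta>) (- s) *v q))) * f z))"
  proof (intro Bochner_Integration.integral_cong refl)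
    fix z :: "(real^2) \<times> (real^2)"
    obtain a b where z: "z = (a, b)" by (cases z)
    have "f (grelaud_tau \<theta> (- s) *v (fst (?T z) - c), d + grelaud_tau \<theta> s *v snd (?T z)) = f z"
      by (simp add: z matrix_vector_right_distrib matrix_vector_mult_diff_distrib neg)
    moreover have "- (?T z \<bullet> (p, q)) = (- (c \<bullet> p) + (grelaud_tau \<theta> (- s) *v d) \<bullet> q)
        + - (z \<bullet> (grelaud_tau (- \<theta>) s *v p, grelaud_tau (- \<theta>) (- s) *v q))"
      by (simp add: z inner_add_left inner_diff_left inner_grelaud_tau)
    ultimately show "?H (?T z) = cis (- (c \<bullet> p) + (grelaud_tau \<theta> (- s) *v d) \<bullet> q)
      * (cis (- (z \<bullet> (grelaud_tau (- \<theta>) s *v p, grelaud_tau (- \<theta>) (- s) *v q))) * f z)"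
      by (simp only: cis_mult[symmetric] mult.assoc)
  qed
  finally show ?thesis unfolding fourier_transform_def by simp
qed

section \<open>Coefficients on the Fourier side\<close>

lemma inv_mult_grelaud2:
  "inv\<^bsub>grelaud2 \<theta>\<^esub> ((c, s), inv\<^bsub>grelaud \<theta>\<^esub> (d, s)) \<otimes>\<^bsub>grelaud2 \<theta>\<^esub> ((a, t), (b, t'))
    = ((grelaud_tau \<theta> (- s) *v (a - c), t - s), (d + grelaud_tau \<theta> s *v b, t' + s))"
proof -
  have neg: "grelaud_tau \<theta> r *v (- x) = - (grelaud_tau \<theta> r *v x)" for r x
    by (rule linear_neg[OF matrix_vector_mul_linear])
  have "inv\<^bsub>grelaud \<theta>\<^esub> (inv\<^bsub>grelaud \<theta>\<^esub> (d, s)) = (d, s)"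
    by (rule group.inv_inv[OF grelaud_group]) simp
  then have "inv\<^bsub>grelaud2 \<theta>\<^esub> ((c, s), inv\<^bsub>grelaud \<theta>\<^esub> (d, s)) = (inv\<^bsub>grelaud \<theta>\<^esub> (c, s), (d, s))"
    by (simp only: inv_grelaud2)
  then show ?thesis
    by (simp add: grelaud_inv DirProd_def matrix_vector_mult_diff_distrib)
qed

lemma coefficient_eq_integral_fibre:
  assumes \<xi>: "\<xi> \<in> square_integrable haar2" and \<eta>: "\<eta> \<in> square_integrable haar2"
  shows "coefficient (grelaud2 \<theta>) haar2 \<xi> \<eta> \<gamma>
    = (LINT y|fibre_haar. \<xi> (inv\<^bsub>grelaud2 \<theta>\<^esub> \<gamma> \<otimes>\<^bsub>grelaud2 \<theta>\<^esub> fibre_coord y) * cnj (\<eta> (fibre_coord y)))"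
proof -
  have m: "(\<lambda>z. left_regular (grelaud2 \<theta>) \<gamma> \<xi> z * cnj (\<eta> z)) \<in> borel_measurable haar2"
    using integrable_l2_product[OF left_regular_grelaud2(1)[OF \<xi>] \<eta>]
    by (rule borel_measurable_integrable)
  have "coefficient (grelaud2 \<theta>) haar2 \<xi> \<eta> \<gamma>
      = (LINT z|distr fibre_haar haar2 fibre_coord. left_regular (grelaud2 \<theta>) \<gamma> \<xi> z * cnj (\<eta> z))"
    unfolding coefficient_def l2_inner_def haar2_eq_distr[symmetric] ..
  also have "\<dots> = (LINT y|fibre_haar. left_regular (grelaud2 \<theta>) \<gamma> \<xi> (fibre_coord y) * cnj (\<eta> (fibre_coord y)))"
    by (rule integral_distr[OF measurable_fibre_coord_haar2 m])
  finally show ?thesis by (simp only: left_regular_def)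
qed

lemma Cc_grelaud_affine:
  fixes f :: "(real^2) \<times> (real^2) \<Rightarrow> complex"
  assumes f: "f \<in> Cc"
  shows "(\<lambda>z. f (grelaud_tau \<theta> (- s) *v (fst z - c), d + grelaud_tau \<theta> s *v snd z)) \<in> Cc"
proof (rule Cc_compose[OF f, where \<psi> = "\<lambda>z.
  (c + grelaud_tau \<theta> s *v fst z, grelaud_tau \<theta> (- s) *v (snd z - d))"])
  show "(c + grelaud_tau \<theta> s *v fst (grelaud_tau \<theta> (- s) *v (fst z - c), d + grelaud_tau \<theta> s *v snd z),
      grelaud_tau \<theta> (- s) *v (snd (grelaud_tau \<theta> (- s) *v (fst z - c), d + grelaud_tau \<theta> s *v snd z)
        - d)) = z" for z
    by simp
qed (intro continuous_intros)+

lemma fibre_product_integrable: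
  assumes \<xi>: "\<xi> \<in> Cc" and \<eta>: "\<eta> \<in> Cc"
  shows "integrable fibre_haar (\<lambda>y. fibre_fourier \<xi> (fibre_transport \<theta> s y) * cnj (fibre_fourier \<eta> y))"
proof (rule integrable_l2_product[OF _ fibre_fourier_square_integrable(1)[OF \<eta>]])
  note sq = fibre_fourier_square_integrable(1)[OF \<xi>]
  have "integrable (distr fibre_haar fibre_haar (fibre_transport \<theta> s)) (\<lambda>y. (cmod (fibre_fourier \<xi> y))\<^sup>2)"
    unfolding distr_fibre_transport by (rule square_integrable_integrable[OF sq])
  then have "integrable fibre_haar (\<lambda>y. (cmod (fibre_fourier \<xi> (fibre_transport \<theta> s y)))\<^sup>2)"
    by (rule integrable_distr[OF measurable_fibre_transport2])
  moreover have "(\<lambda>y. fibre_fourier \<xi> (fibre_transport \<theta> s y)) \<in> borel_measurable fibre_haar"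
    by (rule measurable_compose[OF measurable_fibre_transport2 square_integrable_measurable[OF sq]])
  ultimately show "(\<lambda>y. fibre_fourier \<xi> (fibre_transport \<theta> s y)) \<in> square_integrable fibre_haar"
    by (simp add: square_integrable_def)
qed

text \<open>The character produced by the translations in \<open>fourier_transform_grelaud\<close>.
  For \<open>c = d\<close> it depends on the dual variables only through
  \<open>p - \<tau>(- s)\<^sup>T q\<close>, and there the Fourier transform of \<open>v1\<close>
  will be evaluated.\<close>

definition fibre_phase :: "real \<Rightarrow> real \<Rightarrow> real^2 \<Rightarrow> real^2 \<Rightarrow> (real \<times> real) \<times> ((real^2) \<times> (real^2)) \<Rightarrow>
  complex" where
  "fibre_phase \<theta> s c d y = cis (- (c \<bullet> fst (snd y)) + (grelaud_tau \<theta> (- s) *v d) \<bullet> snd (snd y))"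

lemma norm_fibre_phase [simp]: "cmod (fibre_phase \<theta> s c d y) = 1"
  by (simp add: fibre_phase_def)

lemma fibre_phase_measurable: "fibre_phase \<theta> s c d \<in> borel_measurable fibre_haar"
proof (subst measurable_cong_sets[OF sets_fibre_haar refl])
  show "fibre_phase \<theta> s c d \<in> borel_measurable borel"
    unfolding fibre_phase_def[abs_def] by (intro borel_measurable_continuous_onI continuous_intros)
qed

lemma integrable_phase_mult:
  assumes Z: "integrable fibre_haar Z"
  shows "integrable fibre_haar (\<lambda>y. fibre_phase \<theta> s c d y * Z y)"
proof (rule Bochner_Integration.integrable_bound[OF Z])
  show "(\<lambda>y. fibre_phase \<theta> s c d y * Z y) \<in> borel_measurable fibre_haar"
    by (rule borel_measurable_times[OF fibre_phase_measurable borel_measurable_integrable[OF Z]])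
qed (simp add: norm_mult)

text \<open>Parseval's identity on each fibre. The parameters \<open>c\<close> and \<open>d\<close>
  are independent, so that the first factor can be displaced while the second is kept, as a
  derivative in the first variable requires.\<close>

lemma coefficient_fourier:
  assumes \<xi>: "\<xi> \<in> Cc" and \<eta>: "\<eta> \<in> Cc"
  shows "of_real ((2 * pi) ^ 4) * coefficient (grelaud2 \<theta>) haar2 \<xi> \<eta> ((c, s), inv\<^bsub>grelaud \<theta>\<^esub> (d, s))
    = (LINT y|fibre_haar. fibre_phase \<theta> s c d y
        * (fibre_fourier \<xi> (fibre_transport \<theta> s y) * cnj (fibre_fourier \<eta> y)))"
proof -
  let ?\<gamma> = "((c, s), inv\<^bsub>grelaud \<theta>\<^esub> (d, s))"
  define f where "f t z = \<xi> (fibre_coord ((- s, s) + t, z))" for t z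
  define g where "g t z = \<eta> (fibre_coord (t, z))" for t z
  define H where "H t z = f t (grelaud_tau \<theta> (- s) *v (fst z - c), d + grelaud_tau \<theta> s *v snd z)" for t z
  have fC: "f t \<in> Cc" and gC: "g t \<in> Cc" for t
    unfolding f_def g_def by (rule Cc_fibre_slice[OF \<xi>], rule Cc_fibre_slice[OF \<eta>])
  have HC: "H t \<in> Cc" for t unfolding H_def by (rule Cc_grelaud_affine[OF fC])
  have H: "\<xi> (inv\<^bsub>grelaud2 \<theta>\<^esub> ?\<gamma> \<otimes>\<^bsub>grelaud2 \<theta>\<^esub> fibre_coord (t, z)) = H t z" for t z
    unfolding H_def f_def fibre_coord_def fst_conv snd_conv inv_mult_grelaud2
    by (cases t) (simp add: add.commute)
  have Hft: "fourier_transform (H t) z = fibre_phase \<theta> s c d (t, z) * fibre_fourier \<xi>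
    (fibre_transport \<theta> s (t, z))" for t z
  proof -
    obtain p q where z: "z = (p, q)" by (cases z)
    show ?thesis
      unfolding H_def z fourier_transform_grelaud[OF fC] fibre_phase_def fibre_fourier_def fibre_transport_def
      by (simp add: f_def[abs_def])
  qed
  have int1: "integrable fibre_haar (\<lambda>y. \<xi> (inv\<^bsub>grelaud2 \<theta>\<^esub> ?\<gamma> \<otimes>\<^bsub>grelaud2 \<theta>\<^esub> fibre_coord y)
    * cnj (\<eta> (fibre_coord y)))"
  proof (rule integrable_fibre_haar_Cc[OF Cc_mult[OF _ Cc_cnj[OF Cc_fibre_coord[OF \<eta>]]]])
    have "(\<lambda>y. \<xi> (inv\<^bsub>grelaud2 \<theta>\<^esub> ?\<gamma> \<otimes>\<^bsub>grelaud2 \<theta>\<^esub> fibre_coord y))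
        = (\<lambda>y. \<xi> ((grelaud_tau \<theta> (- s) *v (fst (snd y) - c), fst (fst y) - s),
          (d + grelaud_tau \<theta> s *v snd (snd y), snd (fst y) + s)))"
      by (simp only: fibre_coord_def inv_mult_grelaud2)
    moreover have "continuous_on UNIV (\<lambda>y :: (real \<times> real) \<times> ((real^2) \<times> (real^2)). \<xi>
      ((grelaud_tau \<theta> (- s) *v (fst (snd y) - c), fst (fst y) - s),
        (d + grelaud_tau \<theta> s *v snd (snd y), snd (fst y) + s)))"
      by (intro continuous_on_compose2[OF Cc_continuous[OF \<xi>]] continuous_intros) simp
    ultimately show "continuous_on UNIV (\<lambda>y. \<xi> (inv\<^bsub>grelaud2 \<theta>\<^esub> ?\<gamma> \<otimes>\<^bsub>grelaud2 \<theta>\<^esub> fibre_coord y))"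
      by (simp only:)
  qed
  have slice: "of_real ((2 * pi) ^ 4) * (LINT z|lborel. H t z * cnj (g t z))
      = (LINT z|lborel. fibre_phase \<theta> s c d (t, z)
        * (fibre_fourier \<xi> (fibre_transport \<theta> s (t, z)) * cnj (fibre_fourier \<eta> (t, z))))" for t
  proof -
    have gft: "fibre_fourier \<eta> (t, z) = fourier_transform (g t) z" for z
      by (simp add: fibre_fourier_def g_def[abs_def])
    show ?thesis
      using Parseval[OF HC gC, of t t] unfolding l2_inner_def Hft gft by (simp add: mult.assoc)
  qed
  have "coefficient (grelaud2 \<theta>) haar2 \<xi> \<eta> ?\<gamma>
      = (LINT t|lborel. of_real (exp (- 2 * (fst t + snd t))) * (LINT z|lborel. H t z * cnj (g t z)))"
    unfolding coefficient_eq_integral_fibre[OF Cc_square_integrable_haar2[OF \<xi>]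
      Cc_square_integrable_haar2[OF \<eta>]]
      integral_fibre_haar[OF int1] H g_def ..
  then have "of_real ((2 * pi) ^ 4) * coefficient (grelaud2 \<theta>) haar2 \<xi> \<eta> ?\<gamma>
      = (LINT t|lborel. of_real (exp (- 2 * (fst t + snd t)))
        * (of_real ((2 * pi) ^ 4) * (LINT z|lborel. H t z * cnj (g t z))))"
    by (simp only: integral_mult_right_zero[symmetric] mult.left_commute)
  also have "\<dots> = (LINT y|fibre_haar. fibre_phase \<theta> s c d y
        * (fibre_fourier \<xi> (fibre_transport \<theta> s y) * cnj (fibre_fourier \<eta> y)))"
    unfolding slice
    by (rule integral_fibre_haar[OF integrable_phase_mult[OF fibre_product_integrable[OF \<xi> \<eta>]], symmetric])
  finally show ?thesis .
qed

lemma norm_cis_minus_1_le: "cmod (cis t - 1) \<le> \<bar>t\<bar>"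
proof -
  have "cmod (cis t - 1) = 2 * \<bar>sin (t / 2)\<bar>"
    using dist_exp_i_1[of t] by (simp add: cis_conv_exp)
  also have "\<dots> \<le> \<bar>t\<bar>" using abs_sin_x_le_abs_x[of "t / 2"] by simp
  finally show ?thesis .
qed

text \<open>Integrating the phases against \<open>v1\<close> produces its Fourier transform at
  \<open>p - \<tau>(- s)\<^sup>T q\<close>; the difference quotient contributes at most \<open>|p| |\<tau>(s) w|\<close>.\<close>

lemma difference_fourier:
  fixes \<theta> s h :: real and \<delta> :: "real^2"
  assumes \<xi>: "\<xi> \<in> Cc" and \<eta>: "\<eta> \<in> Cc" and v1: "integrable lborel v1" and h: "h \<noteq> 0"
  defines "u \<equiv> coefficient (grelaud2 \<theta>) haar2 \<xi> \<eta>"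
  shows "of_real ((2 * pi) ^ 4) * (LINT x|lborel. v1 x * ((u ((x + \<delta>, s), inv\<^bsub>grelaud \<theta>\<^esub> (x, s))
        - u ((x, s), inv\<^bsub>grelaud \<theta>\<^esub> (x, s))) / of_real h))
    = (LINT y|fibre_haar. (cis (- (\<delta> \<bullet> fst (snd y))) - 1) / of_real h
        * fourier_transform v1 (fst (snd y) - grelaud_tau (- \<theta>) (- s) *v snd (snd y))
        * (fibre_fourier \<xi> (fibre_transport \<theta> s y) * cnj (fibre_fourier \<eta> y)))"
proof -
  interpret fibre: sigma_finite_measure fibre_haar by (rule sigma_finite_fibre_haar)
  interpret P: pair_sigma_finite "lborel :: (real^2) measure" fibre_haar ..
  define Z where "Z y = fibre_fourier \<xi> (fibre_transport \<theta> s y) * cnj (fibre_fourier \<eta> y)" for y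
  have Z: "integrable fibre_haar Z" unfolding Z_def by (rule fibre_product_integrable[OF \<xi> \<eta>])
  define m where "m y = (cis (- (\<delta> \<bullet> fst (snd y))) - 1) / complex_of_real h"
    for y :: "(real \<times> real) \<times> ((real^2) \<times> (real^2))"
  define r where "r y = fst (snd y) - grelaud_tau (- \<theta>) (- s) *v snd (snd y)"
    for y :: "(real \<times> real) \<times> ((real^2) \<times> (real^2))"
  \<comment> \<open>The displaced phase differs by the factor
    \<open>cis (- (\<delta> \<bullet> p))\<close>, which does not contain \<open>x\<close>; the
    difference quotient therefore factors out of the integral over \<open>x\<close>.\<close>
  have phase: "fibre_phase \<theta> s x x y = cis (- (x \<bullet> r y))"
    and phase2: "fibre_phase \<theta> s (x + \<delta>) x y = cis (- (x \<bullet> r y)) * cis (- (\<delta> \<bullet> fst (snd y)))" for x y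
    unfolding fibre_phase_def r_def cis_mult
    by (simp_all add: inner_grelaud_tau inner_diff_right inner_add_left algebra_simps)
  have rc: "continuous_on UNIV r" unfolding r_def[abs_def] by (intro continuous_intros)
  have mc: "continuous_on UNIV m" unfolding m_def[abs_def] using h by (intro continuous_intros) simp
  have "(LINT x|lborel. v1 x * ((u ((x + \<delta>, s), inv\<^bsub>grelaud \<theta>\<^esub> (x, s)) - u ((x, s), inv\<^bsub>grelaud \<theta>\<^esub> (x, s))) /
    of_real h))
      * of_real ((2 * pi) ^ 4)
    = (LINT x|lborel. LINT y|fibre_haar. v1 x * (cis (- (x \<bullet> r y)) * (m y * Z y)))"
    unfolding integral_mult_left_zero[symmetric]
  proof (intro Bochner_Integration.integral_cong refl)
    fix x :: "real^2"
    note I = integrable_phase_mult[OF Z, of \<theta> s]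
    have "of_real ((2 * pi) ^ 4) * (u ((x + \<delta>, s), inv\<^bsub>grelaud \<theta>\<^esub> (x, s)) - u ((x, s), inv\<^bsub>grelaud \<theta>\<^esub> (x, s)))
        = (LINT y|fibre_haar. fibre_phase \<theta> s (x + \<delta>) x y * Z y)
          - (LINT y|fibre_haar. fibre_phase \<theta> s x x y * Z y)"
      unfolding u_def right_diff_distrib coefficient_fourier[OF \<xi> \<eta>] Z_def ..
    also have "\<dots> = (LINT y|fibre_haar. fibre_phase \<theta> s (x + \<delta>) x y * Z y - fibre_phase \<theta> s x x y * Z y)"
      by (rule Bochner_Integration.integral_diff[OF I I, symmetric])
    also have "\<dots> = (LINT y|fibre_haar. of_real h * (cis (- (x \<bullet> r y)) * (m y * Z y)))"
      using h unfolding phase phase2 m_def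
      by (intro Bochner_Integration.integral_cong refl) (simp add: field_simps)
    finally have "of_real ((2 * pi) ^ 4)
      * (u ((x + \<delta>, s), inv\<^bsub>grelaud \<theta>\<^esub> (x, s)) - u ((x, s), inv\<^bsub>grelaud \<theta>\<^esub> (x, s)))
        = of_real h * (LINT y|fibre_haar. cis (- (x \<bullet> r y)) * (m y * Z y))"
      by (simp only: integral_mult_right_zero)
    then have "(u ((x + \<delta>, s), inv\<^bsub>grelaud \<theta>\<^esub> (x, s)) - u ((x, s), inv\<^bsub>grelaud \<theta>\<^esub> (x, s))) / of_real h
      * of_real ((2 * pi) ^ 4)
        = (LINT y|fibre_haar. cis (- (x \<bullet> r y)) * (m y * Z y))"
      using h by (simp add: field_simps)
    then show "v1 x * ((u ((x + \<delta>, s), inv\<^bsub>grelaud \<theta>\<^esub> (x, s)) - u ((x, s), inv\<^bsub>grelaud \<theta>\<^esub> (x, s))) / of_real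
      h) * of_real ((2 * pi) ^ 4)
        = (LINT y|fibre_haar. v1 x * (cis (- (x \<bullet> r y)) * (m y * Z y)))"
      by (simp only: integral_mult_right_zero mult.assoc)
  qed
  also have "\<dots> = (LINT y|fibre_haar. LINT x|lborel. v1 x * (cis (- (x \<bullet> r y)) * (m y * Z y)))"
  proof (rule P.Fubini_integral[symmetric])
    have int: "integrable (lborel \<Otimes>\<^sub>M fibre_haar) (\<lambda>z. v1 (fst z) * (of_real (2 / \<bar>h\<bar>) * Z (snd z)))"
      using Z v1 by (intro P.integrable_pair_mult) simp_all
    show "integrable (lborel \<Otimes>\<^sub>M fibre_haar) (\<lambda>(x, y). v1 x * (cis (- (x \<bullet> r y)) * (m y * Z y)))"
    proof (rule Bochner_Integration.integrable_bound[OF int])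
      have [measurable]: "v1 \<in> borel_measurable lborel" "Z \<in> borel_measurable fibre_haar"
        using v1 Z by (auto dest: borel_measurable_integrable)
      have [measurable]: "r \<in> fibre_haar \<rightarrow>\<^sub>M borel" "m \<in> fibre_haar \<rightarrow>\<^sub>M borel"
        using borel_measurable_continuous_onI[OF rc] borel_measurable_continuous_onI[OF mc]
        by (simp_all cong: measurable_cong_sets)
      show "(\<lambda>(x, y). v1 x * (cis (- (x \<bullet> r y)) * (m y * Z y))) \<in> borel_measurable (lborel \<Otimes>\<^sub>M fibre_haar)"
        by measurable
      \<comment> \<open>This bound explodes as \<open>h\<close> tends to 0; it serves Fubini's
        theorem for a fixed \<open>h\<close>.\<close>
      have m2: "cmod (m y) \<le> 2 / \<bar>h\<bar>" for y
        unfolding m_def norm_divide using norm_triangle_ineq4[of "cis (- (\<delta> \<bullet> fst (snd y)))" 1]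
        by (simp add: divide_right_mono)
      show "AE z in lborel \<Otimes>\<^sub>M fibre_haar. norm (case z of (x, y) \<Rightarrow> v1 x * (cis (- (x \<bullet> r y)) * (m y * Z y)))
          \<le> norm (v1 (fst z) * (of_real (2 / \<bar>h\<bar>) * Z (snd z)))"
      proof (rule AE_I2)
        fix z :: "(real^2) \<times> ((real \<times> real) \<times> ((real^2) \<times> (real^2)))"
        have "cmod (v1 (fst z)) * (cmod (m (snd z)) * cmod (Z (snd z)))
          \<le> cmod (v1 (fst z)) * (2 / \<bar>h\<bar> * cmod (Z (snd z)))"
          by (intro mult_left_mono mult_right_mono m2) simp_all
        then show "norm (case z of (x, y) \<Rightarrow> v1 x * (cis (- (x \<bullet> r y)) * (m y * Z y)))
            \<le> norm (v1 (fst z) * (of_real (2 / \<bar>h\<bar>) * Z (snd z)))"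
          by (simp add: norm_mult case_prod_beta' norm_divide)
      qed
    qed
  qed
  also have "\<dots> = (LINT y|fibre_haar. m y * fourier_transform v1 (r y) * Z y)"
  proof (intro Bochner_Integration.integral_cong refl)
    fix y
    have "m y * fourier_transform v1 (r y) * Z y = m y * Z y * (LINT x|lborel. cis (- (x \<bullet> r y)) * v1 x)"
      unfolding fourier_transform_def by (simp only: mult_ac)
    also have "\<dots> = (LINT x|lborel. m y * Z y * (cis (- (x \<bullet> r y)) * v1 x))"
      by (simp only: integral_mult_right_zero)
    finally show "(LINT x|lborel. v1 x * (cis (- (x \<bullet> r y)) * (m y * Z y)))
      = m y * fourier_transform v1 (r y) * Z y"
      by (simp only: mult_ac)
  qed
  finally show ?thesis unfolding m_def r_def Z_def by (simp only: mult.commute)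
qed

section \<open>Difference quotients\<close>

definition translated_difference ::
  "real \<Rightarrow> ((real^2) \<times> real \<Rightarrow> complex) \<Rightarrow> real^2 \<Rightarrow> real
    \<Rightarrow> (((real^2) \<times> real) \<times> ((real^2) \<times> real) \<Rightarrow> complex) \<Rightarrow> complex" where
  "translated_difference \<theta> v w h u = (LINT g|grelaud_haar. v g *
     ((u (g \<otimes>\<^bsub>grelaud \<theta>\<^esub> (h *\<^sub>R w, 0), inv\<^bsub>grelaud \<theta>\<^esub> g) - u (g, inv\<^bsub>grelaud \<theta>\<^esub> g)) / of_real h))"

text \<open>Absolute values are taken only after the integration over \<open>x\<close>, which has to
  keep its oscillation: it produces the Fourier transform of \<open>v1\<close>.\<close>

lemma norm_integral_grelaud_haar_le:
  fixes F :: "(real^2) \<times> real \<Rightarrow> complex"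
  shows "ennreal (cmod (LINT g|grelaud_haar. F g))
    \<le> (\<integral>\<^sup>+s. ennreal (exp (- 2 * s)) * ennreal (cmod (LINT x|lborel. F (x, s))) \<partial>lborel)"
proof (cases "integrable grelaud_haar F")
  case True
  have d: "grelaud_haar = density lborel (\<lambda>z. ennreal (exp (- 2 * snd z)))"
    unfolding grelaud_haar_def case_prod_beta' ..
  have Fm: "F \<in> borel_measurable lborel"
    using borel_measurable_integrable[OF True] by (simp cong: measurable_cong_sets)
  have wm: "(\<lambda>z :: (real^2) \<times> real. exp (- 2 * snd z)) \<in> borel_measurable lborel"
    using borel_measurable_continuous_onI[of "\<lambda>z :: (real^2) \<times> real. exp (- 2 * snd z)"]
    by (simp add: continuous_intros)
  have int: "integrable lborel (\<lambda>z. exp (- 2 * snd z) *\<^sub>R F z)"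
    using True unfolding d by (subst (asm) integrable_density[OF Fm wm]) simp_all
  have "(LINT g|grelaud_haar. F g) = (LINT z|lborel. exp (- 2 * snd z) *\<^sub>R F z)"
    unfolding d by (rule integral_density[OF Fm wm]) simp
  also have "\<dots> = (LINT z|(lborel \<Otimes>\<^sub>M lborel). (case z of (x, s) \<Rightarrow> exp (- 2 * s) *\<^sub>R F (x, s)))"
    by (simp only: lborel_prod case_prod_beta' prod.collapse)
  also have "\<dots> = (LINT s|lborel. LINT x|lborel. exp (- 2 * s) *\<^sub>R F (x, s))"
  proof (rule lborel_pair.integral_snd[symmetric])
    show "integrable (lborel \<Otimes>\<^sub>M lborel) (\<lambda>(x, s). exp (- 2 * s) *\<^sub>R F (x, s))"
      using int by (simp only: lborel_prod case_prod_beta' prod.collapse)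
  qed
  finally have eq: "(LINT g|grelaud_haar. F g) = (LINT s|lborel. exp (- 2 * s) *\<^sub>R (LINT x|lborel. F (x, s)))"
    by (simp only: integral_scaleR_right)
  show ?thesis
    using ennreal_norm_integral_le[of lborel "\<lambda>s. exp (- 2 * s) *\<^sub>R (LINT x|lborel. F (x, s))"]
    unfolding eq by (simp add: ennreal_mult)
next
  case False
  then show ?thesis by (simp add: not_integrable_integral_eq)
qed

text \<open>Origin of the constant: \<open>M\<close> bounds \<open>v2\<close>, the integral of
  \<open>cmod (v1 x)\<close> bounds the transform of \<open>v1\<close>, \<open>norm w\<close> comes
  from the difference quotient, \<open>exp L\<close> from the Haar weight and the growth of the
  matrices, and \<open>6 * R * (L + 1)\<close> from the two window integrals in Schur's test. None
  of them involves \<open>h\<close>.\<close>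

lemma translated_difference_bound_Cc:
  fixes \<theta> :: real and w :: "real^2"
  assumes v1: "integrable lborel v1" and R: "0 < R"
    and supp1: "\<And>p. R < norm p \<Longrightarrow> fourier_transform v1 p = 0"
    and M: "\<And>s. cmod (v2 s) \<le> M" and L: "0 \<le> L" and supp2: "\<And>s. L < \<bar>s\<bar> \<Longrightarrow> v2 s = 0"
    and v: "\<And>x s. v (x, s) = v1 x * v2 s"
    and \<xi>: "\<xi> \<in> Cc" and \<eta>: "\<eta> \<in> Cc" and h: "h \<noteq> 0"
  shows "cmod (translated_difference \<theta> v w h (coefficient (grelaud2 \<theta>) haar2 \<xi> \<eta>))
    \<le> (exp L * M * (LINT x|lborel. cmod (v1 x)) * norm w * (6 * R * (L + 1))) * l2_norm haar2 \<xi>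
      * l2_norm haar2 \<eta>"
proof -
  define u where "u = coefficient (grelaud2 \<theta>) haar2 \<xi> \<eta>"
  define V where "V = (LINT x|lborel. cmod (v1 x))"
  define K where "K = exp L * M * V * norm w"
  have M0: "0 \<le> M" using M[of 0] norm_ge_zero order_trans by blast
  have V0: "0 \<le> V" by (simp add: V_def)
  have K0: "0 \<le> K" using M0 V0 by (simp add: K_def)
  let ?E = "\<lambda>y :: (real \<times> real) \<times> ((real^2) \<times> (real^2)). fst (snd y)"
  let ?Q = "\<lambda>y :: (real \<times> real) \<times> ((real^2) \<times> (real^2)). snd (snd y)"
  have nP: "cmod (complex_of_real ((2 * pi) ^ 4)) = (2 * pi) ^ 4" unfolding norm_of_real by simp
  \<comment> \<open>\<open>k1\<close> puts the weight |p| on the window forced by the support of the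
    transform of \<open>v1\<close>. \<open>k2\<close> is the same kernel written in the transported
    variables, whose norms are \<open>exp s\<close> times |p| and \<open>exp (- s)\<close> times
    |q|.\<close>
  define k1 where "k1 s y = ennreal (K * (indicator {-L..L} s *
      (if \<bar>exp (- s) * norm (?Q y) - norm (?E y)\<bar> \<le> R then norm (?E y) else 0)))" for s y
  define k2 where "k2 s y = ennreal (K * (indicator {-L..L} s *
      (if \<bar>exp (- s) * norm (?E y) - norm (?Q y)\<bar> \<le> R then exp (- s) * norm (?E y) else 0)))" for s y
  define Fx where "Fx y = cmod (fibre_fourier \<xi> y)" for y
  define Fe where "Fe y = cmod (fibre_fourier \<eta> y)" for y
  have F0: "0 \<le> Fx y" "0 \<le> Fe y" for y by (simp_all add: Fx_def Fe_def)
  have slice: "ennreal (exp (- 2 * s)) * ennreal ((2 * pi) ^ 4 * cmod (LINT x|lborel. v (x, s) *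
      ((u ((x, s) \<otimes>\<^bsub>grelaud \<theta>\<^esub> (h *\<^sub>R w, 0), inv\<^bsub>grelaud \<theta>\<^esub> (x, s)) - u ((x, s), inv\<^bsub>grelaud \<theta>\<^esub> (x, s))) /
        of_real h)))
    \<le> (\<integral>\<^sup>+y. k1 s y * ennreal (Fx (fibre_transport \<theta> s y) * Fe y) \<partial>fibre_haar)" for s
  proof -
    let ?\<delta> = "grelaud_tau \<theta> s *v (h *\<^sub>R w)"
    define G where "G y = (cis (- (?\<delta> \<bullet> ?E y)) - 1) / of_real h
        * fourier_transform v1 (?E y - grelaud_tau (- \<theta>) (- s) *v ?Q y)
        * (fibre_fourier \<xi> (fibre_transport \<theta> s y) * cnj (fibre_fourier \<eta> y))" for y
    have G: "exp (- 2 * s) * cmod (v2 s) * cmod (G y) \<le>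
        K * (indicator {-L..L} s * (if \<bar>exp (- s) * norm (?Q y) - norm (?E y)\<bar> \<le> R then norm (?E y) else 0))
          * (Fx (fibre_transport \<theta> s y) * Fe y)" for y
    proof (cases "\<bar>s\<bar> \<le> L \<and> norm (?E y - grelaud_tau (- \<theta>) (- s) *v ?Q y) \<le> R")
      case True
      let ?r = "?E y - grelaud_tau (- \<theta>) (- s) *v ?Q y"
      \<comment> \<open>The condition on the vector \<open>?r\<close> is weakened to a condition on
        norms, which no longer sees the rotation.\<close>
      have "\<bar>norm (?E y) - norm (grelaud_tau (- \<theta>) (- s) *v ?Q y)\<bar> \<le> norm ?r"
        by (rule norm_triangle_ineq3)
      then have win: "\<bar>exp (- s) * norm (?Q y) - norm (?E y)\<bar> \<le> R"
        using True by (simp add: norm_grelaud_tau abs_minus_commute)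
      have s: "s \<in> {-L..L}" using True by (simp add: abs_le_iff)
      have "cmod (cis (- (?\<delta> \<bullet> ?E y)) - 1) \<le> \<bar>?\<delta> \<bullet> ?E y\<bar>"
        using norm_cis_minus_1_le[of "- (?\<delta> \<bullet> ?E y)"] by simp
      also have "\<dots> \<le> norm ?\<delta> * norm (?E y)" by (rule Cauchy_Schwarz_ineq2)
      also have "\<dots> = \<bar>h\<bar> * (exp s * norm w * norm (?E y))" by (simp add: norm_grelaud_tau)
      finally have m: "cmod ((cis (- (?\<delta> \<bullet> ?E y)) - 1) / of_real h) \<le> exp s * norm w * norm (?E y)"
        using h by (simp add: norm_divide divide_le_eq mult.commute)
      have f: "cmod (fourier_transform v1 ?r) \<le> V" unfolding V_def by (rule norm_fourier_transform_le)
      have "cmod (G y) \<le> (exp s * norm w * norm (?E y)) * V * (Fx (fibre_transport \<theta> s y) * Fe y)"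
        unfolding G_def norm_mult complex_mod_cnj Fx_def Fe_def
        by (intro mult_mono m f order_refl) (simp_all add: V0)
      then have "exp (- 2 * s) * cmod (v2 s) * cmod (G y)
          \<le> exp (- 2 * s) * M * ((exp s * norm w * norm (?E y)) * V * (Fx (fibre_transport \<theta> s y) * Fe y))"
        by (intro mult_mono M order_refl) (simp_all add: M0)
      also have "\<dots> = (exp (- 2 * s) * exp s)
        * (M * V * norm w * norm (?E y) * (Fx (fibre_transport \<theta> s y) * Fe y))"
        by (simp only: mult_ac)
      \<comment> \<open>The Haar weight and the growth \<open>exp s\<close> of the displaced
        direction leave \<open>exp (- s)\<close>, which is at most \<open>exp L\<close> on the
        support of \<open>v2\<close>.\<close>
      also have "exp (- 2 * s) * exp s = exp (- s)" unfolding exp_add[symmetric] by simp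
      also have "exp (- s) * (M * V * norm w * norm (?E y) * (Fx (fibre_transport \<theta> s y) * Fe y))
          \<le> exp L * (M * V * norm w * norm (?E y) * (Fx (fibre_transport \<theta> s y) * Fe y))"
        using s M0 V0 by (intro mult_right_mono) (simp_all add: Fx_def Fe_def)
      finally show ?thesis using s win by (simp add: K_def mult_ac)
    next
      case False
      \<comment> \<open>Here the integrand vanishes, so the bound holds even if the norms still lie
        in the window of \<open>k1\<close>.\<close>
      then have "v2 s = 0 \<or> fourier_transform v1 (?E y - grelaud_tau (- \<theta>) (- s) *v ?Q y) = 0"
        using supp1 supp2 not_le by blast
      then have z: "exp (- 2 * s) * cmod (v2 s) * cmod (G y) = 0" by (auto simp: G_def)
      show ?thesis unfolding z using K0 by (simp add: Fx_def Fe_def)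
    qed
    have step: "(x, s) \<otimes>\<^bsub>grelaud \<theta>\<^esub> (h *\<^sub>R w, 0) = (x + ?\<delta>, s)" for x by simp
    have "complex_of_real ((2 * pi) ^ 4) * (LINT x|lborel. v (x, s) *
        ((u ((x, s) \<otimes>\<^bsub>grelaud \<theta>\<^esub> (h *\<^sub>R w, 0), inv\<^bsub>grelaud \<theta>\<^esub> (x, s)) - u ((x, s), inv\<^bsub>grelaud \<theta>\<^esub> (x, s))) /
          of_real h))
      = v2 s * (complex_of_real ((2 * pi) ^ 4) * (LINT x|lborel. v1 x *
        ((u ((x + ?\<delta>, s), inv\<^bsub>grelaud \<theta>\<^esub> (x, s)) - u ((x, s), inv\<^bsub>grelaud \<theta>\<^esub> (x, s))) / of_real h)))"
      unfolding step v integral_mult_right_zero[symmetric] by (simp only: mult_ac)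
    also have "\<dots> = v2 s * (LINT y|fibre_haar. G y)"
      unfolding u_def G_def difference_fourier[OF \<xi> \<eta> v1 h] ..
    finally have "(2 * pi) ^ 4 * cmod (LINT x|lborel. v (x, s) *
        ((u ((x, s) \<otimes>\<^bsub>grelaud \<theta>\<^esub> (h *\<^sub>R w, 0), inv\<^bsub>grelaud \<theta>\<^esub> (x, s)) - u ((x, s), inv\<^bsub>grelaud \<theta>\<^esub> (x, s))) /
          of_real h))
      = cmod (v2 s) * cmod (LINT y|fibre_haar. G y)"
      by (metis (no_types, lifting) norm_mult norm_of_real abs_of_nonneg zero_le_power mult_nonneg_nonneg
        pi_ge_zero zero_le_numeral)
    then have "ennreal (exp (- 2 * s)) * ennreal ((2 * pi) ^ 4 * cmod (LINT x|lborel. v (x, s) *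
        ((u ((x, s) \<otimes>\<^bsub>grelaud \<theta>\<^esub> (h *\<^sub>R w, 0), inv\<^bsub>grelaud \<theta>\<^esub> (x, s)) - u ((x, s), inv\<^bsub>grelaud \<theta>\<^esub> (x, s))) /
          of_real h)))
      = ennreal (exp (- 2 * s) * cmod (v2 s)) * ennreal (cmod (LINT y|fibre_haar. G y))"
      by (simp add: ennreal_mult mult.assoc)
    also have "\<dots> \<le> ennreal (exp (- 2 * s) * cmod (v2 s)) * (\<integral>\<^sup>+y. ennreal (cmod (G y)) \<partial>fibre_haar)"
      by (intro mult_left_mono ennreal_norm_integral_le) simp
    also have "\<dots> = (\<integral>\<^sup>+y. ennreal (exp (- 2 * s) * cmod (v2 s)) * ennreal (cmod (G y)) \<partial>fibre_haar)"
    proof (rule nn_integral_cmult[symmetric])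
      have v1m: "fourier_transform v1 \<in> borel_measurable borel"
        using borel_measurable_integrable[OF v1] by (intro fourier_transform_measurable) simp
      have "continuous_on UNIV (\<lambda>y. (cis (- (?\<delta> \<bullet> ?E y)) - 1) / complex_of_real h)"
        using h by (intro continuous_intros) simp
      note c1 = borel_measurable_continuous_onI[OF this]
      have "continuous_on UNIV (\<lambda>y. ?E y - grelaud_tau (- \<theta>) (- s) *v ?Q y)" by (intro continuous_intros)
      note c2 = measurable_compose[OF borel_measurable_continuous_onI[OF this] v1m]
      have "(\<lambda>y. (cis (- (?\<delta> \<bullet> ?E y)) - 1) / complex_of_real h
          * fourier_transform v1 (?E y - grelaud_tau (- \<theta>) (- s) *v ?Q y)) \<in> borel_measurable borel"
        by (rule borel_measurable_times[OF c1 c2])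
      then have "(\<lambda>y. (cis (- (?\<delta> \<bullet> ?E y)) - 1) / complex_of_real h
          * fourier_transform v1 (?E y - grelaud_tau (- \<theta>) (- s) *v ?Q y)) \<in> borel_measurable fibre_haar"
        by (simp cong: measurable_cong_sets)
      from borel_measurable_times[OF this borel_measurable_integrable[OF fibre_product_integrable[OF \<xi> \<eta>]]]
      have "G \<in> borel_measurable fibre_haar" unfolding G_def[abs_def] .
      then show "(\<lambda>y. ennreal (cmod (G y))) \<in> borel_measurable fibre_haar" by measurable
    qed
    also have "\<dots> \<le> (\<integral>\<^sup>+y. k1 s y * ennreal (Fx (fibre_transport \<theta> s y) * Fe y) \<partial>fibre_haar)"
    proof (rule nn_integral_mono)
      fix y
      have "ennreal (exp (- 2 * s) * cmod (v2 s)) * ennreal (cmod (G y))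
        = ennreal (exp (- 2 * s) * cmod (v2 s) * cmod (G y))"
        by (simp add: ennreal_mult)
      also have "\<dots> \<le> ennreal (K * (indicator {-L..L} s * (if \<bar>exp (- s) * norm (?Q y) - norm (?E y)\<bar>
        \<le> R then norm (?E y) else 0))
          * (Fx (fibre_transport \<theta> s y) * Fe y))"
        by (rule ennreal_leI[OF G])
      also have "\<dots> = k1 s y * ennreal (Fx (fibre_transport \<theta> s y) * Fe y)"
        unfolding k1_def using K0 by (intro ennreal_mult) (simp_all add: Fx_def Fe_def)
      finally show "ennreal (exp (- 2 * s) * cmod (v2 s)) * ennreal (cmod (G y))
        \<le> k1 s y * ennreal (Fx (fibre_transport \<theta> s y) * Fe y)" .
    qed
    finally show ?thesis .
  qed
  define D where "D = translated_difference \<theta> v w h u"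
  have le: "ennreal ((2 * pi) ^ 4 * cmod D)
      \<le> (\<integral>\<^sup>+s. \<integral>\<^sup>+y. k1 s y * ennreal (Fx (fibre_transport \<theta> s y) * Fe y) \<partial>fibre_haar \<partial>lborel)"
  proof -
    define F where "F g = complex_of_real ((2 * pi) ^ 4) * (v g *
      ((u (g \<otimes>\<^bsub>grelaud \<theta>\<^esub> (h *\<^sub>R w, 0), inv\<^bsub>grelaud \<theta>\<^esub> g) - u (g, inv\<^bsub>grelaud \<theta>\<^esub> g)) / of_real h))" for g
    have "(2 * pi) ^ 4 * cmod D = cmod (LINT g|grelaud_haar. F g)"
      unfolding D_def translated_difference_def F_def integral_mult_right_zero norm_mult nP ..
    then have "ennreal ((2 * pi) ^ 4 * cmod D)
      \<le> (\<integral>\<^sup>+s. ennreal (exp (- 2 * s)) * ennreal (cmod (LINT x|lborel. F (x, s))) \<partial>lborel)"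
      by (simp only: norm_integral_grelaud_haar_le)
    also have "\<dots> \<le> (\<integral>\<^sup>+s. \<integral>\<^sup>+y. k1 s y * ennreal (Fx (fibre_transport \<theta> s y) * Fe y) \<partial>fibre_haar \<partial>lborel)"
    proof (rule nn_integral_mono)
      fix s
      have "cmod (LINT x|lborel. F (x, s)) = (2 * pi) ^ 4 * cmod (LINT x|lborel. v (x, s) *
          ((u ((x, s) \<otimes>\<^bsub>grelaud \<theta>\<^esub> (h *\<^sub>R w, 0), inv\<^bsub>grelaud \<theta>\<^esub> (x, s)) - u ((x, s), inv\<^bsub>grelaud \<theta>\<^esub> (x, s))) /
            of_real h))"
        unfolding F_def integral_mult_right_zero norm_mult nP ..
      then show "ennreal (exp (- 2 * s)) * ennreal (cmod (LINT x|lborel. F (x, s)))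
          \<le> (\<integral>\<^sup>+y. k1 s y * ennreal (Fx (fibre_transport \<theta> s y) * Fe y) \<partial>fibre_haar)"
        using slice[of s] by (simp only:)
    qed
    finally show ?thesis .
  qed
  let ?C = "K * (6 * R * (L + 1))"
  have C0: "0 \<le> ?C" using K0 R L by simp
  have wt: "(\<integral>\<^sup>+s. ennreal (K * f s) \<partial>lborel) \<le> ennreal ?C"
    if "(\<integral>\<^sup>+s. ennreal (f s) \<partial>lborel) \<le> ennreal (6 * R * (L + 1))" "f \<in> borel_measurable borel"
    for f :: "real \<Rightarrow> real"
  proof -
    have "(\<integral>\<^sup>+s. ennreal (K * f s) \<partial>lborel) = ennreal K * (\<integral>\<^sup>+s. ennreal (f s) \<partial>lborel)"
      using that(2) by (simp add: ennreal_mult' K0 nn_integral_cmult)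
    also have "\<dots> \<le> ennreal K * ennreal (6 * R * (L + 1))" by (intro mult_left_mono that) simp
    also have "\<dots> = ennreal ?C" using K0 R L by (intro ennreal_mult[symmetric]) simp_all
    finally show ?thesis .
  qed
  \<comment> \<open>\<open>c\<close> stays free throughout the integration; optimising it at the end
    turns the sum of squares into the product of the norms.\<close>
  have amgm: "(2 * pi) ^ 4 * cmod D \<le> ?C
    * ((c * ((2 * pi)\<^sup>2 * l2_norm haar2 \<xi>)\<^sup>2 + ((2 * pi)\<^sup>2 * l2_norm haar2 \<eta>)\<^sup>2 / c) / 2)"
    if c: "0 < c" for c
  proof -
    have sets: "sets ((lborel :: real measure) \<Otimes>\<^sub>M fibre_haar) = sets borel"
      by (subst borel_prod[symmetric]) (intro sets_pair_measure_cong sets_lborel sets_fibre_haar)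
    have m: "Fx \<in> borel_measurable fibre_haar" "Fe \<in> borel_measurable fibre_haar"
      using square_integrable_measurable[OF fibre_fourier_square_integrable(1)[OF \<xi>]]
        square_integrable_measurable[OF fibre_fourier_square_integrable(1)[OF \<eta>]]
      unfolding Fx_def[abs_def] Fe_def[abs_def] by measurable
    have nn: "(\<integral>\<^sup>+y. ennreal ((cmod (fibre_fourier f y))\<^sup>2) \<partial>fibre_haar)
      \<le> ennreal (((2 * pi)\<^sup>2 * l2_norm haar2 f)\<^sup>2)"
      if f: "f \<in> Cc" for f
      unfolding nn_integral_square_integrable[OF fibre_fourier_square_integrable(1)[OF f]]
      by (intro ennreal_leI power_mono fibre_fourier_square_integrable(2) f) simp
    have "ennreal ((2 * pi) ^ 4 * cmod D)
      \<le> ennreal ?C * (ennreal (c / 2) * (\<integral>\<^sup>+y. ennreal ((Fx y)\<^sup>2) \<partial>fibre_haar)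
        + ennreal (1 / (2 * c)) * (\<integral>\<^sup>+y. ennreal ((Fe y)\<^sup>2) \<partial>fibre_haar))"
    proof (rule order_trans[OF le], rule schur_test[where ?k2.0 = k2])
      show "case_prod k1 \<in> borel_measurable (lborel \<Otimes>\<^sub>M fibre_haar)"
        unfolding k1_def case_prod_beta' by measurable
      show "case_prod k2 \<in> borel_measurable (lborel \<Otimes>\<^sub>M fibre_haar)"
        unfolding k2_def case_prod_beta' by measurable
      show "(\<lambda>(s, y). fibre_transport \<theta> s y) \<in> lborel \<Otimes>\<^sub>M fibre_haar \<rightarrow>\<^sub>M fibre_haar"
        unfolding case_prod_beta'
        by (subst measurable_cong_sets[OF sets sets_fibre_haar]) (rule measurable_fibre_transport)
      show "k1 s y = k2 s (fibre_transport \<theta> s y)" for s y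
      proof -
        have E: "exp (- s) * norm (?E (fibre_transport \<theta> s y)) = norm (?E y)"
          by (simp add: fibre_transport_def norm_grelaud_tau exp_minus)
        have Q: "norm (?Q (fibre_transport \<theta> s y)) = exp (- s) * norm (?Q y)"
          by (simp add: fibre_transport_def norm_grelaud_tau)
        show ?thesis unfolding k1_def k2_def E Q by (simp only: abs_minus_commute)
      qed
      show "(\<integral>\<^sup>+s. k1 s y \<partial>lborel) \<le> ennreal ?C" for y
        unfolding k1_def by (intro wt exp_window_integral_1 R L norm_ge_zero) measurable
      show "(\<integral>\<^sup>+s. k2 s y \<partial>lborel) \<le> ennreal ?C" for y
        unfolding k2_def by (intro wt exp_window_integral_2 R L norm_ge_zero) measurable
    qed (simp_all add: m c F0 sigma_finite_lborel sigma_finite_fibre_haar measurable_fibre_transport2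
      distr_fibre_transport)
    also have "\<dots> \<le> ennreal ?C * (ennreal (c / 2) * ennreal (((2 * pi)\<^sup>2 * l2_norm haar2 \<xi>)\<^sup>2)
        + ennreal (1 / (2 * c)) * ennreal (((2 * pi)\<^sup>2 * l2_norm haar2 \<eta>)\<^sup>2))"
      unfolding Fx_def Fe_def by (intro mult_left_mono add_mono nn \<xi> \<eta>) simp_all
    also have "\<dots> = ennreal (?C * (c / 2 * ((2 * pi)\<^sup>2 * l2_norm haar2 \<xi>)\<^sup>2 + 1 / (2 * c)
      * ((2 * pi)\<^sup>2 * l2_norm haar2 \<eta>)\<^sup>2))"
      using c C0 by (simp only: ennreal_mult[symmetric] ennreal_plus[symmetric] zero_le_power2
        mult_nonneg_nonneg add_nonneg_nonneg
          less_imp_le divide_nonneg_nonneg zero_le_numeral zero_le_one)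
    finally have "(2 * pi) ^ 4 * cmod D \<le> ?C
      * (c / 2 * ((2 * pi)\<^sup>2 * l2_norm haar2 \<xi>)\<^sup>2 + 1 / (2 * c) * ((2 * pi)\<^sup>2 * l2_norm haar2 \<eta>)\<^sup>2)"
      using c C0 by (subst (asm) ennreal_le_iff) simp_all
    moreover have "c / 2 * X + 1 / (2 * c) * Y = (c * X + Y / c) / 2" for X Y :: real
      using c by (simp add: field_simps)
    ultimately show ?thesis by (simp only:)
  qed
  have "cmod D \<le> ?C * l2_norm haar2 \<xi> * l2_norm haar2 \<eta>"
  proof -
    have "cmod D \<le> (sqrt ?C * l2_norm haar2 \<xi>) * (sqrt ?C * l2_norm haar2 \<eta>)"
    proof (rule le_mult_from_weighted_amgm)
      fix c :: real assume c: "0 < c"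
      \<comment> \<open>Each partial Fourier transform contributes \<open>(2 * pi)\<^sup>2\<close>
        to its norm, hence \<open>(2 * pi) ^ 4\<close> to the square, and this cancels the factor
        from Parseval's identity on the left.\<close>
      have "(2 * pi) ^ 4 * cmod D \<le> (2 * pi) ^ 4
        * (?C * ((c * (l2_norm haar2 \<xi>)\<^sup>2 + (l2_norm haar2 \<eta>)\<^sup>2 / c) / 2))"
      proof -
        have sq: "((2 * pi)\<^sup>2 * x)\<^sup>2 = (2 * pi) ^ 4 * x\<^sup>2" for x :: real
          unfolding power_mult_distrib[of "(2 * pi)\<^sup>2"] power_mult[symmetric] by simp
        have alg: "C' * ((c * (P * x) + P * y / c) / 2) = P * (C' * ((c * x + y / c) / 2))"
          for C' P x y :: real
          by (simp add: algebra_simps add_divide_distrib)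
        show ?thesis using amgm[OF c] unfolding sq alg .
      qed
      then have "cmod D \<le> ?C * ((c * (l2_norm haar2 \<xi>)\<^sup>2 + (l2_norm haar2 \<eta>)\<^sup>2 / c) / 2)"
        by (subst (asm) mult_le_cancel_left_pos) simp_all
      also have "\<dots> = (c * (sqrt ?C * l2_norm haar2 \<xi>)\<^sup>2 + (sqrt ?C * l2_norm haar2 \<eta>)\<^sup>2 / c) / 2"
        using C0 by (simp add: power_mult_distrib field_simps)
      finally show "cmod D \<le> (c * (sqrt ?C * l2_norm haar2 \<xi>)\<^sup>2 + (sqrt ?C * l2_norm haar2 \<eta>)\<^sup>2 / c) / 2" .
    qed (simp_all add: C0)
    also have "\<dots> = (sqrt ?C * sqrt ?C) * l2_norm haar2 \<xi> * l2_norm haar2 \<eta>" by (simp only: mult_ac)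
    also have "sqrt ?C * sqrt ?C = ?C" using C0 by simp
    finally show ?thesis .
  qed
  then show ?thesis by (simp only: D_def u_def K_def V_def)
qed

section \<open>Density of the continuous functions with compact support\<close>

lemma continuous_compactly_supported_cutoff:
  "(\<lambda>z :: 'a::euclidean_space. complex_of_real (max 0 (min 1 (r - norm z)))) \<in> Cc"
proof -
  have "closure {z :: 'a. complex_of_real (max 0 (min 1 (r - norm z))) \<noteq> 0} \<subseteq> cball 0 r"
    by (rule closure_minimal) (auto simp: max_def min_def split: if_splits)
  then have "compact (closure {z :: 'a. complex_of_real (max 0 (min 1 (r - norm z))) \<noteq> 0})"
    by (meson bounded_cball bounded_subset closed_closure compact_eq_bounded_closed)
  then show ?thesis
    unfolding Cc_def compactly_supported_def by (simp add: continuous_intros)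
qed

lemma haar2_eq_density:
  "haar2 = density lborel (\<lambda>z. ennreal (exp (- 2 * snd (fst z)) * exp (- 2 * snd (snd z))))"
proof -
  let ?d = "\<lambda>z :: (real^2) \<times> real. ennreal (exp (- 2 * snd z))"
  have d: "grelaud_haar = density lborel ?d"
    unfolding grelaud_haar_def case_prod_beta' ..
  have dm: "?d \<in> borel_measurable lborel" by measurable
  have "haar2 = density (lborel \<Otimes>\<^sub>M lborel) (\<lambda>(x, y). ?d x * ?d y)"
    unfolding d by (rule pair_measure_density[OF dm dm sigma_finite_lborel])
      (simp only: d[symmetric] sigma_finite_grelaud_haar)
  then show ?thesis
    by (simp only: lborel_prod case_prod_beta' ennreal_mult[OF exp_ge_zero exp_ge_zero, symmetric])
qed

lemma AE_haar2_if_AE_lborel: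
  assumes "AE z in lborel. P z"
  shows "AE z in haar2. P z"
proof -
  have m: "(\<lambda>z :: ((real^2) \<times> real) \<times> ((real^2) \<times> real). ennreal
    (exp (- 2 * snd (fst z)) * exp (- 2 * snd (snd z)))) \<in> borel_measurable lborel"
    by measurable
  show ?thesis unfolding haar2_eq_density AE_density[OF m] using assms by eventually_elim simp
qed

lemma l2_norm_tendsto_0:
  assumes f: "\<And>n. f n \<in> borel_measurable M" and g: "g \<in> borel_measurable M"
    and w: "integrable M w"
    and lim: "AE x in M. (\<lambda>n. f n x) \<longlonglongrightarrow> g x"
    and le: "\<And>n x. (cmod (g x - f n x))\<^sup>2 \<le> w x"
  shows "(\<lambda>n. l2_norm M (\<lambda>x. g x - f n x)) \<longlonglongrightarrow> 0"
proof -
  note [measurable] = f g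
  have "(\<lambda>n. LINT x|M. (cmod (g x - f n x))\<^sup>2) \<longlonglongrightarrow> (LINT x|M. 0)"
  proof (rule integral_dominated_convergence[where w = w])
    show "AE x in M. (\<lambda>n. (cmod (g x - f n x))\<^sup>2) \<longlonglongrightarrow> 0"
      using lim
    proof eventually_elim
      case (elim x)
      have "(\<lambda>n. (cmod (g x - f n x))\<^sup>2) \<longlonglongrightarrow> (cmod (g x - g x))\<^sup>2" by (intro tendsto_intros elim)
      then show ?case by simp
    qed
    show "AE x in M. norm ((cmod (g x - f n x))\<^sup>2) \<le> w x" for n by (intro AE_I2) (simp add: le)
  qed (use w in measurable)
  then have "(\<lambda>n. sqrt (LINT x|M. (cmod (g x - f n x))\<^sup>2)) \<longlonglongrightarrow> sqrt 0"
    by (intro tendsto_real_sqrt) simp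
  then show ?thesis by (simp add: l2_norm_def)
qed

text \<open>A measurable function is an almost everywhere limit of continuous ones. Clipping these
  to the disc of radius \<open>b\<close> and multiplying by a cutoff puts them into
  \<open>Cc\<close> and provides a common majorant, so dominated convergence gives convergence in
  norm.\<close>

lemma Cc_dense_bounded:
  assumes \<psi>: "\<psi> \<in> borel_measurable borel" and b: "\<And>z. cmod (\<psi> z) \<le> b" and b0: "0 < b"
    and supp: "\<And>z. r < norm z \<Longrightarrow> \<psi> z = 0"
  shows "\<exists>f. (\<forall>n. f n \<in> Cc) \<and> (\<lambda>n. l2_norm haar2 (\<lambda>z. \<psi> z - f n z)) \<longlonglongrightarrow> 0"
proof -
  have "\<psi> \<in> borel_measurable lebesgue"
    using \<psi> by (intro measurable_completion) simp
  then have "\<psi> measurable_on UNIV"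
    using lebesgue_measurable_imp_measurable_on[of \<psi> UNIV] by simp
  then obtain N g where N: "negligible N" and g: "\<And>n. continuous_on UNIV (g n)"
    and lim: "\<And>z. z \<notin> N \<Longrightarrow> (\<lambda>n. g n z) \<longlonglongrightarrow> \<psi> z"
    unfolding measurable_on_def by auto
  \<comment> \<open>The radial retraction onto the disc of radius \<open>b\<close>.\<close>
  define clip where "clip c = of_real (b / max b (cmod c)) * c" for c :: complex
  have clip_le: "cmod (clip c) \<le> b" for c
    using b0 by (simp add: clip_def norm_mult norm_divide max_def field_simps)
  have clip_id: "clip c = c" if "cmod c \<le> b" for c using that b0 by (simp add: clip_def max_def)
  have clip_cont: "continuous_on UNIV clip"
    unfolding clip_def[abs_def] using b0 by (intro continuous_intros) (auto simp: max_def)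
  \<comment> \<open>\<open>cut1\<close> is 1 on the ball of radius \<open>r\<close> and vanishes
    beyond radius \<open>r + 1\<close>; \<open>cut2\<close> is 1 on that larger ball and supplies
    the majorant.\<close>
  define cut1 where "cut1 z = complex_of_real (max 0 (min 1 (r + 1 - norm z)))"
    for z :: "((real^2) \<times> real) \<times> ((real^2) \<times> real)"
  define cut2 where "cut2 z = complex_of_real (max 0 (min 1 (r + 2 - norm z)))"
    for z :: "((real^2) \<times> real) \<times> ((real^2) \<times> real)"
  have cut1: "cut1 \<in> Cc" and cut2: "cut2 \<in> Cc"
    unfolding cut1_def[abs_def] cut2_def[abs_def] by (rule continuous_compactly_supported_cutoff)+
  define f where "f n z = clip (g n z) * cut1 z" for n z
  have fC: "f n \<in> Cc" for n
    unfolding f_def[abs_def]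
    by (rule Cc_mult[OF continuous_on_compose2[OF clip_cont g] cut1]) simp
  have "(\<lambda>n. l2_norm haar2 (\<lambda>z. \<psi> z - f n z)) \<longlonglongrightarrow> 0"
  proof (rule l2_norm_tendsto_0[where w = "\<lambda>z. (2 * b)\<^sup>2 * (cmod (cut2 z))\<^sup>2"])
    show "f n \<in> borel_measurable haar2" for n
      using Cc_measurable[OF fC] by (subst measurable_cong_sets[OF sets_haar2 refl])
    show "\<psi> \<in> borel_measurable haar2"
      using \<psi> by (subst measurable_cong_sets[OF sets_haar2 refl])
    show "integrable haar2 (\<lambda>z. (2 * b)\<^sup>2 * (cmod (cut2 z))\<^sup>2)"
      using square_integrable_integrable[OF Cc_square_integrable_haar2[OF cut2]] by simp
    have "AE z in lebesgue. z \<notin> N"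
      using N by (intro AE_not_in) (simp add: negligible_iff_null_sets)
    then have "AE z in lborel. z \<notin> N" by (simp add: AE_completion_iff)
    from AE_haar2_if_AE_lborel[OF this]
    show "AE z in haar2. (\<lambda>n. f n z) \<longlonglongrightarrow> \<psi> z"
    proof eventually_elim
      case (elim z)
      have "isCont clip (\<psi> z)" using clip_cont by (simp add: continuous_on_eq_continuous_at)
      then have "(\<lambda>n. clip (g n z)) \<longlonglongrightarrow> clip (\<psi> z)" by (rule isCont_tendsto_compose[OF _ lim[OF elim]])
      then have "(\<lambda>n. f n z) \<longlonglongrightarrow> clip (\<psi> z) * cut1 z" unfolding f_def by (intro tendsto_intros)
      moreover have "clip (\<psi> z) * cut1 z = \<psi> z"
      proof (cases "r < norm z")
        case True
        then show ?thesis by (simp add: supp clip_def)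
      next
        case False
        then have "cut1 z = 1" by (simp add: cut1_def)
        then show ?thesis by (simp add: clip_id b)
      qed
      ultimately show ?case by simp
    qed
    show "(cmod (\<psi> z - f n z))\<^sup>2 \<le> (2 * b)\<^sup>2 * (cmod (cut2 z))\<^sup>2" for n z
    proof (cases "r + 1 < norm z")
      case True
      then have "\<psi> z = 0" "cut1 z = 0" by (simp_all add: supp cut1_def)
      then show ?thesis by (simp add: f_def)
    next
      case False
      then have "cut2 z = 1" by (simp add: cut2_def)
      have "cmod (cut1 z) \<le> 1" by (simp add: cut1_def)
      then have "cmod (f n z) \<le> b * 1"
        unfolding f_def norm_mult using clip_le b0 by (intro mult_mono) simp_all
      then have "cmod (\<psi> z - f n z) \<le> 2 * b"
        using norm_triangle_ineq4[of "\<psi> z" "f n z"] b[of z] by linarith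
      then have "(cmod (\<psi> z - f n z))\<^sup>2 \<le> (2 * b)\<^sup>2" by (rule power_mono) simp
      then show ?thesis using \<open>cut2 z = 1\<close> by simp
    qed
  qed
  with fC show ?thesis by blast
qed

lemma Cc_dense_haar2:
  assumes \<xi>: "\<xi> \<in> square_integrable haar2" and e: "0 < e"
  shows "\<exists>f\<in>Cc. l2_norm haar2 (\<lambda>z. \<xi> z - f z) < e"
proof -
  have \<xi>m: "\<xi> \<in> borel_measurable haar2" by (rule square_integrable_measurable[OF \<xi>])
  then have \<xi>b [measurable]: "\<xi> \<in> borel_measurable borel"
    by (subst (asm) measurable_cong_sets[OF sets_haar2 refl])
  define \<psi> where "\<psi> n z = (if norm z \<le> real n \<and> cmod (\<xi> z) \<le> real n then \<xi> z else 0)" for n z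
  have \<psi>m: "\<psi> n \<in> borel_measurable borel" for n unfolding \<psi>_def[abs_def] by measurable
  have \<psi>h: "\<psi> n \<in> borel_measurable haar2" for n
    using \<psi>m by (subst measurable_cong_sets[OF sets_haar2 refl])
  have "(\<lambda>n. l2_norm haar2 (\<lambda>z. \<xi> z - \<psi> n z)) \<longlonglongrightarrow> 0"
  proof (rule l2_norm_tendsto_0[where w = "\<lambda>z. (cmod (\<xi> z))\<^sup>2", OF \<psi>h \<xi>m square_integrable_integrable[OF \<xi>]])
    show "AE z in haar2. (\<lambda>n. \<psi> n z) \<longlonglongrightarrow> \<xi> z"
    proof (rule AE_I2)
      fix z
      obtain N where N: "max (norm z) (cmod (\<xi> z)) \<le> real N" using real_arch_simple by blast
      have "\<forall>\<^sub>F n in sequentially. \<psi> n z = \<xi> z"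
        using eventually_ge_at_top[of N]
      proof eventually_elim
        case (elim n)
        then have "real N \<le> real n" by simp
        then show ?case using N by (simp add: \<psi>_def)
      qed
      then show "(\<lambda>n. \<psi> n z) \<longlonglongrightarrow> \<xi> z" by (rule tendsto_eventually)
    qed
    show "(cmod (\<xi> z - \<psi> n z))\<^sup>2 \<le> (cmod (\<xi> z))\<^sup>2" for n z by (simp add: \<psi>_def)
  qed
  from order_tendstoD(2)[OF this, of "e / 2"]
  have "\<forall>\<^sub>F n in sequentially. l2_norm haar2 (\<lambda>z. \<xi> z - \<psi> n z) < e / 2" using e by simp
  then obtain n where n: "l2_norm haar2 (\<lambda>z. \<xi> z - \<psi> n z) < e / 2"
    using eventually_happens trivial_limit_sequentially by blast
  \<comment> \<open>The bound is \<open>real n + 1\<close> because it has to be positive, also for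
    \<open>n = 0\<close>.\<close>
  have "\<exists>f. (\<forall>k. f k \<in> Cc) \<and> (\<lambda>k. l2_norm haar2 (\<lambda>z. \<psi> n z - f k z)) \<longlonglongrightarrow> 0"
    by (rule Cc_dense_bounded[where b = "real n + 1" and r = "real n", OF \<psi>m]) (simp_all add: \<psi>_def)
  then obtain f where f: "\<And>k. f k \<in> Cc" and fl: "(\<lambda>k. l2_norm haar2 (\<lambda>z. \<psi> n z - f k z)) \<longlonglongrightarrow> 0" by blast
  have "\<forall>\<^sub>F k in sequentially. l2_norm haar2 (\<lambda>z. \<psi> n z - f k z) < e / 2"
    using order_tendstoD(2)[OF fl, of "e / 2"] e by simp
  then obtain k where k: "l2_norm haar2 (\<lambda>z. \<psi> n z - f k z) < e / 2"
    using eventually_happens trivial_limit_sequentially by blast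
  have "\<psi> n \<in> square_integrable haar2"
  proof -
    have "integrable haar2 (\<lambda>z. (cmod (\<psi> n z))\<^sup>2)"
    proof (rule Bochner_Integration.integrable_bound[OF square_integrable_integrable[OF \<xi>]])
      show "(\<lambda>z. (cmod (\<psi> n z))\<^sup>2) \<in> borel_measurable haar2" using \<psi>h by measurable
    qed (simp add: \<psi>_def)
    then show ?thesis using \<psi>h by (simp add: square_integrable_def)
  qed
  from l2_norm_triangle_diff[OF \<xi> this Cc_square_integrable_haar2[OF f[of k]]]
  have "l2_norm haar2 (\<lambda>z. \<xi> z - f k z) < e" using n k by linarith
  with f show ?thesis by blast
qed

section \<open>Linearity of the difference quotients and extension from the dense subspace\<close>

lemma coefficient_add_left:
  assumes "f \<in> square_integrable haar2" "g \<in> square_integrable haar2" "\<eta> \<in> square_integrable haar2"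
  shows "coefficient (grelaud2 \<theta>) haar2 (\<lambda>x. f x + g x) \<eta>
    = (\<lambda>\<gamma>. coefficient (grelaud2 \<theta>) haar2 f \<eta> \<gamma> + coefficient (grelaud2 \<theta>) haar2 g \<eta> \<gamma>)"
  using l2_inner_add_left[OF left_regular_grelaud2(1)[OF assms(1)] left_regular_grelaud2(1)[OF assms(2)]
    assms(3)]
  unfolding coefficient_def left_regular_def by (intro ext)

lemma coefficient_scale_left:
  "coefficient G \<mu> (\<lambda>x. c * f x) \<eta> = (\<lambda>\<gamma>. c * coefficient G \<mu> f \<eta> \<gamma>)"
  unfolding coefficient_def left_regular_def l2_inner_scale_left ..

lemma coefficient_add_right:
  assumes "f \<in> square_integrable haar2" "\<eta> \<in> square_integrable haar2" "\<zeta> \<in> square_integrable haar2"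
  shows "coefficient (grelaud2 \<theta>) haar2 f (\<lambda>x. \<eta> x + \<zeta> x)
    = (\<lambda>\<gamma>. coefficient (grelaud2 \<theta>) haar2 f \<eta> \<gamma> + coefficient (grelaud2 \<theta>) haar2 f \<zeta> \<gamma>)"
  unfolding coefficient_def
  by (intro ext l2_inner_add_right assms left_regular_grelaud2)

lemma coefficient_scale_right:
  "coefficient G \<mu> f (\<lambda>x. c * \<eta> x) = (\<lambda>\<gamma>. cnj c * coefficient G \<mu> f \<eta> \<gamma>)"
  unfolding coefficient_def l2_inner_scale_right ..

text \<open>In coordinates the translated argument is a continuous function of the group element and
  the fibre coordinates together. The integrand is therefore jointly Borel, and a parameter integral
  of such a function is measurable.\<close>

lemma coefficient_antidiagonal_measurable:
  assumes \<xi>: "\<xi> \<in> square_integrable haar2" and \<eta>: "\<eta> \<in> square_integrable haar2"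
  shows "(\<lambda>g. coefficient (grelaud2 \<theta>) haar2 \<xi> \<eta> (g \<otimes>\<^bsub>grelaud \<theta>\<^esub> (w, 0), inv\<^bsub>grelaud \<theta>\<^esub> g)) \<in> borel_measurable
    borel"
proof -
  interpret sigma_finite_measure fibre_haar by (rule sigma_finite_fibre_haar)
  have b: "\<xi> \<in> borel_measurable borel" "\<eta> \<in> borel_measurable borel"
    using \<xi> \<eta> by (auto dest!: square_integrable_measurable simp: measurable_cong_sets[OF sets_haar2 refl])
  let ?\<Phi> = "\<lambda>z :: ((real^2) \<times> real) \<times> ((real \<times> real) \<times> ((real^2) \<times> (real^2))).
    ((grelaud_tau \<theta> (- snd (fst z)) *v (fst (snd (snd z))
      - (fst (fst z) + grelaud_tau \<theta> (snd (fst z)) *v w)), fst (fst (snd z)) - snd (fst z)),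
     (fst (fst z) + grelaud_tau \<theta> (snd (fst z)) *v snd (snd (snd z)), snd (fst (snd z)) + snd (fst z)))"
  have \<Phi>: "inv\<^bsub>grelaud2 \<theta>\<^esub> (g \<otimes>\<^bsub>grelaud \<theta>\<^esub> (w, 0), inv\<^bsub>grelaud \<theta>\<^esub> g) \<otimes>\<^bsub>grelaud2 \<theta>\<^esub> fibre_coord y = ?\<Phi> (g, y)" for g y
    by (cases g) (simp add: fibre_coord_def inv_mult_grelaud2 del: DirProd_def)
  have "?\<Phi> \<in> borel_measurable borel" by (intro borel_measurable_continuous_onI continuous_intros)
  from measurable_compose[OF this b(1)] have m1: "(\<lambda>z. \<xi> (?\<Phi> z)) \<in> borel_measurable borel" .
  have "(\<lambda>z :: ((real^2) \<times> real) \<times> ((real \<times> real) \<times> ((real^2) \<times> (real^2))). fibre_coord (snd z))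
    \<in> borel_measurable borel"
    unfolding fibre_coord_def by (intro borel_measurable_continuous_onI continuous_intros)
  from measurable_compose[OF this b(2)]
  have m2: "(\<lambda>z :: ((real^2) \<times> real) \<times> ((real \<times> real) \<times> ((real^2) \<times> (real^2))). cnj
    (\<eta> (fibre_coord (snd z)))) \<in> borel_measurable borel"
    by (rule borel_measurable_cnj)
  have sets: "sets ((borel :: ((real^2) \<times> real) measure) \<Otimes>\<^sub>M fibre_haar) = sets borel"
    by (subst borel_prod[symmetric]) (intro sets_pair_measure_cong refl sets_fibre_haar)
  have "(\<lambda>(g, y). \<xi> (?\<Phi> (g, y)) * cnj (\<eta> (fibre_coord y))) \<in> borel_measurable (borel \<Otimes>\<^sub>M fibre_haar)"
    using borel_measurable_times[OF m1 m2] unfolding case_prod_beta' prod.collapse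
    by (subst measurable_cong_sets[OF sets refl])
  from borel_measurable_lebesgue_integral[OF this]
  show ?thesis unfolding coefficient_eq_integral_fibre[OF \<xi> \<eta>] \<Phi> .
qed

text \<open>The bound grows like \<open>1 / \<bar>h\<bar>\<close>, but it holds for all
  square-integrable vectors. For each \<open>h\<close> it makes the form continuous, which is what
  the passage from \<open>Cc\<close> to the whole space needs.\<close>

lemma translated_difference_integrable:
  fixes \<theta> h :: real and w :: "real^2"
  assumes \<xi>: "\<xi> \<in> square_integrable haar2" and \<eta>: "\<eta> \<in> square_integrable haar2"
    and v: "integrable grelaud_haar v"
  defines "D \<equiv> (\<lambda>g. (coefficient (grelaud2 \<theta>) haar2 \<xi> \<eta> (g \<otimes>\<^bsub>grelaud \<theta>\<^esub> (h *\<^sub>R w, 0), inv\<^bsub>grelaud \<theta>\<^esub> g)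
      - coefficient (grelaud2 \<theta>) haar2 \<xi> \<eta> (g, inv\<^bsub>grelaud \<theta>\<^esub> g)) / complex_of_real h)"
  shows "integrable grelaud_haar (\<lambda>g. v g * D g)"
    and "cmod (LINT g|grelaud_haar. v g * D g)
      \<le> (LINT g|grelaud_haar. cmod (v g)) * (2 / \<bar>h\<bar>) * (l2_norm haar2 \<xi> * l2_norm haar2 \<eta>)"
proof -
  let ?B = "2 / \<bar>h\<bar> * (l2_norm haar2 \<xi> * l2_norm haar2 \<eta>)"
  have "g \<otimes>\<^bsub>grelaud \<theta>\<^esub> (0, 0) = g" for g by (cases g) simp
  with coefficient_antidiagonal_measurable[OF \<xi> \<eta>, of \<theta> 0]
    coefficient_antidiagonal_measurable[OF \<xi> \<eta>, of \<theta> "h *\<^sub>R w"]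
  have "D \<in> borel_measurable borel" unfolding D_def by simp
  then have Dm: "D \<in> borel_measurable grelaud_haar" by (simp cong: measurable_cong_sets)
  have Db: "cmod (D g) \<le> ?B" for g
  proof -
    have "cmod (D g) = cmod (coefficient (grelaud2 \<theta>) haar2 \<xi> \<eta> (g \<otimes>\<^bsub>grelaud \<theta>\<^esub> (h *\<^sub>R w, 0), inv\<^bsub>grelaud \<theta>\<^esub> g)
        - coefficient (grelaud2 \<theta>) haar2 \<xi> \<eta> (g, inv\<^bsub>grelaud \<theta>\<^esub> g)) / \<bar>h\<bar>"
      by (simp only: D_def norm_divide norm_of_real)
    also have "\<dots> \<le> (l2_norm haar2 \<xi> * l2_norm haar2 \<eta> + l2_norm haar2 \<xi> * l2_norm haar2 \<eta>) / \<bar>h\<bar>"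
      by (intro divide_right_mono order_trans[OF norm_triangle_ineq4] add_mono norm_coefficient_le \<xi> \<eta>) simp
    also have "\<dots> = ?B" by simp
    finally show ?thesis .
  qed
  have le: "norm (v g * D g) \<le> norm (?B * cmod (v g))" for g
  proof -
    have "cmod (D g) * cmod (v g) \<le> ?B * cmod (v g)" by (intro mult_right_mono Db) simp
    then show ?thesis by (simp add: norm_mult abs_mult mult.commute)
  qed
  have iB: "integrable grelaud_haar (\<lambda>g. ?B * cmod (v g))" using v by simp
  show int: "integrable grelaud_haar (\<lambda>g. v g * D g)"
    by (rule Bochner_Integration.integrable_bound[OF iB
          borel_measurable_times[OF borel_measurable_integrable[OF v] Dm]])
      (intro AE_I2 le)
  have "cmod (LINT g|grelaud_haar. v g * D g) \<le> (LINT g|grelaud_haar. norm (v g * D g))"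
    by (rule integral_norm_bound)
  also have "\<dots> \<le> (LINT g|grelaud_haar. ?B * cmod (v g))"
  proof (rule integral_mono[OF integrable_norm[OF int] iB])
    show "norm (v g * D g) \<le> ?B * cmod (v g)" for g using le[of g] by (simp add: abs_mult)
  qed
  also have "\<dots> = ?B * (LINT g|grelaud_haar. cmod (v g))" by (rule integral_mult_right_zero)
  finally show "cmod (LINT g|grelaud_haar. v g * D g)
      \<le> (LINT g|grelaud_haar. cmod (v g)) * (2 / \<bar>h\<bar>) * (l2_norm haar2 \<xi> * l2_norm haar2 \<eta>)"
    by (simp only: mult_ac)
qed

lemma translated_difference_add:
  assumes "integrable grelaud_haar (\<lambda>g. v g
    * ((u1 (g \<otimes>\<^bsub>grelaud \<theta>\<^esub> (h *\<^sub>R w, 0), inv\<^bsub>grelaud \<theta>\<^esub> g) - u1 (g, inv\<^bsub>grelaud \<theta>\<^esub> g)) / of_real h))"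
    and "integrable grelaud_haar (\<lambda>g. v g
      * ((u2 (g \<otimes>\<^bsub>grelaud \<theta>\<^esub> (h *\<^sub>R w, 0), inv\<^bsub>grelaud \<theta>\<^esub> g) - u2 (g, inv\<^bsub>grelaud \<theta>\<^esub> g)) / of_real h))"
  shows "translated_difference \<theta> v w h (\<lambda>\<gamma>. u1 \<gamma> + u2 \<gamma>)
    = translated_difference \<theta> v w h u1 + translated_difference \<theta> v w h u2"
  unfolding translated_difference_def Bochner_Integration.integral_add[OF assms, symmetric]
  by (intro Bochner_Integration.integral_cong refl)
    (simp add: diff_divide_distrib add_divide_distrib algebra_simps)

lemma translated_difference_scale:
  "translated_difference \<theta> v w h (\<lambda>\<gamma>. c * u \<gamma>) = c * translated_difference \<theta> v w h u"
  unfolding translated_difference_def integral_mult_right_zero[symmetric]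
  by (intro Bochner_Integration.integral_cong refl)
    (simp add: diff_divide_distrib algebra_simps)

text \<open>\<open>B\<close> makes \<open>T\<close> continuous, so the approximation errors vanish
  in the limit and the constant \<open>C\<close> of the dense set survives, whatever the size of
  \<open>B\<close>.\<close>

lemma bilinear_bound_from_dense:
  fixes T :: "('a \<Rightarrow> complex) \<Rightarrow> ('a \<Rightarrow> complex) \<Rightarrow> complex"
  assumes dense: "\<And>f e. f \<in> square_integrable M \<Longrightarrow> 0 < e \<Longrightarrow> \<exists>g\<in>D. l2_norm M (\<lambda>x. f x - g x) < e"
    and D: "D \<subseteq> square_integrable M"
    and add1: "\<And>f h \<eta>. f \<in> square_integrable M \<Longrightarrow> h \<in> square_integrable M \<Longrightarrow>
      \<eta> \<in> square_integrable M \<Longrightarrow> T (\<lambda>x. f x + h x) \<eta> = T f \<eta> + T h \<eta>"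
    and add2: "\<And>f \<eta> \<zeta>. f \<in> square_integrable M \<Longrightarrow> \<eta> \<in> square_integrable M \<Longrightarrow>
      \<zeta> \<in> square_integrable M \<Longrightarrow> T f (\<lambda>x. \<eta> x + \<zeta> x) = T f \<eta> + T f \<zeta>"
    and crude: "\<And>f \<eta>. f \<in> square_integrable M \<Longrightarrow> \<eta> \<in> square_integrable M \<Longrightarrow>
      cmod (T f \<eta>) \<le> B * (l2_norm M f * l2_norm M \<eta>)"
    and B: "0 \<le> B" and C: "0 \<le> C"
    and bound: "\<And>f \<eta>. f \<in> D \<Longrightarrow> \<eta> \<in> D \<Longrightarrow> cmod (T f \<eta>) \<le> C * l2_norm M f * l2_norm M \<eta>"
    and \<xi>: "\<xi> \<in> square_integrable M" and \<eta>: "\<eta> \<in> square_integrable M"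
  shows "cmod (T \<xi> \<eta>) \<le> C * l2_norm M \<xi> * l2_norm M \<eta>"
proof -
  let ?a = "l2_norm M \<xi>" and ?b = "l2_norm M \<eta>"
  have le: "cmod (T \<xi> \<eta>) \<le> C * (?a + e) * (?b + e) + B * (e * (?b + e)) + B * (?a * e)" if e: "0 < e" for e
  proof -
    obtain f where f: "f \<in> D" "l2_norm M (\<lambda>x. \<xi> x - f x) < e" using dense[OF \<xi> e] by blast
    obtain k where k: "k \<in> D" "l2_norm M (\<lambda>x. \<eta> x - k x) < e" using dense[OF \<eta> e] by blast
    have fs: "f \<in> square_integrable M" and ks: "k \<in> square_integrable M" using f k D by auto
    note df = square_integrable_diff[OF \<xi> fs] and dk = square_integrable_diff[OF \<eta> ks]
    have nf: "l2_norm M f \<le> ?a + e"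
      using l2_norm_triangle[OF \<xi> square_integrable_diff[OF fs \<xi>]] f(2)
      by (simp add: l2_norm_minus_commute[of M f])
    have nk: "l2_norm M k \<le> ?b + e"
      using l2_norm_triangle[OF \<eta> square_integrable_diff[OF ks \<eta>]] k(2)
      by (simp add: l2_norm_minus_commute[of M k])
    have eq: "T \<xi> \<eta> = T f k + T (\<lambda>x. \<xi> x - f x) k + T \<xi> (\<lambda>x. \<eta> x - k x)"
      using add1[OF fs df ks] add2[OF \<xi> ks dk] by simp
    have "cmod (T \<xi> \<eta>) \<le> cmod (T f k) + cmod (T (\<lambda>x. \<xi> x - f x) k) + cmod (T \<xi> (\<lambda>x. \<eta> x - k x))"
      unfolding eq
      using norm_triangle_ineq[of "T f k + T (\<lambda>x. \<xi> x - f x) k" "T \<xi> (\<lambda>x. \<eta> x - k x)"]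
        norm_triangle_ineq[of "T f k" "T (\<lambda>x. \<xi> x - f x) k"] by linarith
    also have "\<dots> \<le> C * (?a + e) * (?b + e) + B * (e * (?b + e)) + B * (?a * e)"
    proof (intro add_mono)
      show "cmod (T f k) \<le> C * (?a + e) * (?b + e)"
        using e C by (intro order_trans[OF bound[OF f(1) k(1)]] mult_mono mult_left_mono nf nk) simp_all
      show "cmod (T (\<lambda>x. \<xi> x - f x) k) \<le> B * (e * (?b + e))"
        using e B f(2) by (intro order_trans[OF crude[OF df ks]] mult_left_mono mult_mono nk) simp_all
      show "cmod (T \<xi> (\<lambda>x. \<eta> x - k x)) \<le> B * (?a * e)"
        using B k(2) by (intro order_trans[OF crude[OF \<xi> dk]] mult_left_mono) simp_all
    qed
    finally show ?thesis .
  qed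
  let ?R = "\<lambda>e. C * (?a + e) * (?b + e) + B * (e * (?b + e)) + B * (?a * e)"
  have "(\<lambda>n. ?R (inverse (real (Suc n)))) \<longlonglongrightarrow> ?R 0"
    by (intro tendsto_intros LIMSEQ_inverse_real_of_nat)
  then have "(\<lambda>n. ?R (inverse (real (Suc n)))) \<longlonglongrightarrow> C * ?a * ?b" by simp
  moreover have "\<exists>N. \<forall>n\<ge>N. cmod (T \<xi> \<eta>) \<le> ?R (inverse (real (Suc n)))"
    by (intro exI allI impI le) simp
  ultimately show ?thesis by (rule LIMSEQ_le_const)
qed

text \<open>The uniform bound is extended from \<open>Cc\<close> by density for each nonzero
  \<open>h\<close> and then used along \<open>h = 1 / (n + 1)\<close>. The operator is identified at
  those pairs of vectors for which the difference quotients converge.\<close>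

theorem ex_limit_operator:
  fixes \<theta> :: real and w :: "real^2"
  assumes v1: "integrable lborel v1" and R: "0 < R"
    and supp1: "\<And>p. R < norm p \<Longrightarrow> fourier_transform v1 p = 0"
    and M: "\<And>s. cmod (v2 s) \<le> M" and L: "0 \<le> L" and supp2: "\<And>s. L < \<bar>s\<bar> \<Longrightarrow> v2 s = 0"
    and v: "\<And>x s. v (x, s) = v1 x * v2 s" and vi: "integrable grelaud_haar v"
  shows "\<exists>S\<in>group_vN (grelaud2 \<theta>) haar2. \<forall>\<xi>\<in>square_integrable haar2. \<forall>\<eta>\<in>square_integrable haar2. \<forall>c.
    (\<lambda>n. translated_difference \<theta> v w (inverse (real (Suc n))) (coefficient (grelaud2 \<theta>) haar2 \<xi> \<eta>)) \<longlonglongrightarrow> c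
      \<longrightarrow> l2_inner haar2 (S \<xi>) \<eta> = c"
proof -
  let ?C = "exp L * M * (LINT x|lborel. cmod (v1 x)) * norm w * (6 * R * (L + 1))"
  have M0: "0 \<le> M" using M[of 0] norm_ge_zero order_trans by blast
  have C0: "0 \<le> ?C" using M0 R L by (intro mult_nonneg_nonneg integral_nonneg_AE) simp_all
  have add1: "translated_difference \<theta> v w h (coefficient (grelaud2 \<theta>) haar2 (\<lambda>x. f x + g x) \<eta>)
      = translated_difference \<theta> v w h (coefficient (grelaud2 \<theta>) haar2 f \<eta>)
      + translated_difference \<theta> v w h (coefficient (grelaud2 \<theta>) haar2 g \<eta>)"
    if "f \<in> square_integrable haar2" "g \<in> square_integrable haar2" "\<eta> \<in> square_integrable haar2" for f g \<eta> h
    unfolding coefficient_add_left[OF that]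
    by (intro translated_difference_add translated_difference_integrable(1) that vi)
  have add2: "translated_difference \<theta> v w h (coefficient (grelaud2 \<theta>) haar2 f (\<lambda>x. \<eta> x + \<zeta> x))
      = translated_difference \<theta> v w h (coefficient (grelaud2 \<theta>) haar2 f \<eta>)
      + translated_difference \<theta> v w h (coefficient (grelaud2 \<theta>) haar2 f \<zeta>)"
    if "f \<in> square_integrable haar2" "\<eta> \<in> square_integrable haar2" "\<zeta> \<in> square_integrable haar2" for f \<eta> \<zeta> h
    unfolding coefficient_add_right[OF that]
    by (intro translated_difference_add translated_difference_integrable(1) that vi)
  have bound: "cmod (translated_difference \<theta> v w h (coefficient (grelaud2 \<theta>) haar2 f \<eta>))
      \<le> ?C * l2_norm haar2 f * l2_norm haar2 \<eta>"
    if f: "f \<in> square_integrable haar2" and \<eta>: "\<eta> \<in> square_integrable haar2" and h: "h \<noteq> 0" for f \<eta> h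
  proof (rule bilinear_bound_from_dense[where D = Cc
        and B = "(LINT g|grelaud_haar. cmod (v g)) * (2 / \<bar>h\<bar>)"
        and T = "\<lambda>f \<eta>. translated_difference \<theta> v w h (coefficient (grelaud2 \<theta>) haar2 f \<eta>)"])
    show "cmod (translated_difference \<theta> v w h (coefficient (grelaud2 \<theta>) haar2 f \<eta>))
        \<le> (LINT g|grelaud_haar. cmod (v g)) * (2 / \<bar>h\<bar>) * (l2_norm haar2 f * l2_norm haar2 \<eta>)"
      if "f \<in> square_integrable haar2" "\<eta> \<in> square_integrable haar2" for f \<eta>
      unfolding translated_difference_def by (rule translated_difference_integrable(2)[OF that vi])
    show "cmod (translated_difference \<theta> v w h (coefficient (grelaud2 \<theta>) haar2 f \<eta>))
        \<le> ?C * l2_norm haar2 f * l2_norm haar2 \<eta>" if "f \<in> Cc" "\<eta> \<in> Cc" for f \<eta>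
      by (rule translated_difference_bound_Cc[OF v1 R supp1 M L supp2 v that h])
    show "\<exists>g\<in>Cc. l2_norm haar2 (\<lambda>x. f x - g x) < e" if "f \<in> square_integrable haar2" "0 < e" for f e
      by (rule Cc_dense_haar2[OF that])
    show "Cc \<subseteq> square_integrable haar2" using Cc_square_integrable_haar2 by blast
    show "0 \<le> (LINT g|grelaud_haar. cmod (v g)) * (2 / \<bar>h\<bar>)" by simp
  qed (fact add1 add2 C0 f \<eta>)+
  show ?thesis
  proof (rule group_vN_from_functionals[where C = ?C])
    fix n f \<eta> assume "f \<in> square_integrable haar2" "\<eta> \<in> square_integrable haar2"
    then show "cmod (translated_difference \<theta> v w (inverse (real (Suc n)))
      (coefficient (grelaud2 \<theta>) haar2 f \<eta>))
        \<le> ?C * l2_norm haar2 f * l2_norm haar2 \<eta>" by (rule bound) simp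
  next
    show "translated_difference \<theta> v w (inverse (real (Suc n)))
      (coefficient (grelaud2 \<theta>) haar2 (\<lambda>x. c * f x) \<eta>)
        = c * translated_difference \<theta> v w (inverse (real (Suc n)))
          (coefficient (grelaud2 \<theta>) haar2 f \<eta>)" for n c f \<eta>
      unfolding coefficient_scale_left by (rule translated_difference_scale)
    show "translated_difference \<theta> v w (inverse (real (Suc n)))
      (coefficient (grelaud2 \<theta>) haar2 f (\<lambda>x. c * \<eta> x))
        = cnj c * translated_difference \<theta> v w (inverse (real (Suc n)))
          (coefficient (grelaud2 \<theta>) haar2 f \<eta>)" for n c f \<eta>
      unfolding coefficient_scale_right by (rule translated_difference_scale)
  qed (fact carrier_grelaud2 left_regular_grelaud2(1) add1 add2 C0)+
qed

lemma integrable_grelaud_haar_product: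
  assumes v1: "integrable lborel v1" and v2: "v2 \<in> Cc"
    and v: "\<And>x s. v (x, s) = v1 x * v2 s"
  shows "integrable grelaud_haar v"
proof -
  have d: "grelaud_haar = density lborel (\<lambda>z. ennreal (exp (- 2 * snd z)))"
    unfolding grelaud_haar_def case_prod_beta' ..
  have v': "v = (\<lambda>z. v1 (fst z) * v2 (snd z))" using v by (intro ext) (metis prod.collapse)
  have e: "(\<lambda>s. complex_of_real (exp (- 2 * s)) * v2 s) \<in> Cc"
    by (rule Cc_mult[OF _ v2]) (intro continuous_intros)
  have "integrable (lborel \<Otimes>\<^sub>M lborel) (\<lambda>z. v1 (fst z) * (complex_of_real (exp (- 2 * snd z)) * v2 (snd z)))"
    by (rule lborel_pair.integrable_pair_mult[OF v1 Cc_integrable[OF e]])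
  then have int: "integrable lborel (\<lambda>z. exp (- 2 * snd z) *\<^sub>R v z)"
    by (simp add: lborel_prod v' scaleR_conv_of_real mult_ac)
  have vm: "v \<in> borel_measurable lborel"
  proof -
    have [measurable]: "v1 \<in> borel_measurable borel" "v2 \<in> borel_measurable borel"
      using borel_measurable_integrable[OF v1] Cc_measurable[OF v2] by simp_all
    show ?thesis unfolding v' by measurable
  qed
  have wm: "(\<lambda>z :: (real^2) \<times> real. exp (- 2 * snd z)) \<in> borel_measurable lborel" by measurable
  show ?thesis using int unfolding d by (subst integrable_density[OF vm wm]) simp_all
qed

section \<open>Calculus of test functions\<close>

text \<open>For the product rule, in which the undifferentiated factors must also have order
  \<open>k\<close>.\<close>

lemma Ck_Suc_imp: "Ck (Suc k) f \<Longrightarrow> Ck k f"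
proof (induction k arbitrary: f)
  case 0
  then show ?case
    by (auto intro: continuous_at_imp_continuous_on differentiable_imp_continuous_within)
next
  case (Suc k)
  have d: "\<And>x. f differentiable at x" and D: "\<And>v. Ck (Suc k) (\<lambda>x. frechet_derivative f (at x) v)"
    using Suc.prems unfolding Ck.simps(2)[of "Suc k"] by blast+
  have "Ck k (\<lambda>x. frechet_derivative f (at x) v)" for v by (rule Suc.IH[OF D])
  with d show ?case by simp
qed

lemma smooth_imp_continuous: "smooth f \<Longrightarrow> continuous_on UNIV f"
  unfolding smooth_def by (metis Ck.simps(1))

lemma smooth_differentiable: "smooth f \<Longrightarrow> f differentiable at x"
  unfolding smooth_def by (metis Ck.simps(2))

lemma smooth_frechet_derivative: "smooth f \<Longrightarrow> smooth (\<lambda>x. frechet_derivative f (at x) v)"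
  unfolding smooth_def by (metis Ck.simps(2))

lemma smooth_has_derivative: "smooth f \<Longrightarrow> (f has_derivative frechet_derivative f (at x)) (at x)"
  using smooth_differentiable frechet_derivative_works by blast

lemma Ck_add: "Ck k f \<Longrightarrow> Ck k g \<Longrightarrow> Ck k (\<lambda>x. f x + g x)"
proof (induction k arbitrary: f g)
  case 0
  then show ?case by (simp add: continuous_intros)
next
  case (Suc k)
  have df: "f differentiable at x" and dg: "g differentiable at x" for x using Suc.prems by simp_all
  have Df: "Ck k (\<lambda>x. frechet_derivative f (at x) v)" and Dg: "Ck k (\<lambda>x. frechet_derivative g (at x) v)" for v
    using Suc.prems by simp_all
  have eq: "frechet_derivative (\<lambda>x. f x + g x) (at x) v
    = frechet_derivative f (at x) v + frechet_derivative g (at x) v" for x v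
    using frechet_derivative_at[OF has_derivative_add[OF frechet_derivative_works[THEN iffD1, OF df]
          frechet_derivative_works[THEN iffD1, OF dg]], of x, symmetric] by simp
  have "Ck k (\<lambda>x. frechet_derivative (\<lambda>x. f x + g x) (at x) v)" for v
    unfolding eq by (rule Suc.IH[OF Df Dg])
  then show ?case using differentiable_add[OF df dg] by simp
qed

lemma Ck_mult:
  fixes f g :: "'a::euclidean_space \<Rightarrow> complex"
  shows "Ck k f \<Longrightarrow> Ck k g \<Longrightarrow> Ck k (\<lambda>x. f x * g x)"
proof (induction k arbitrary: f g)
  case 0
  then show ?case by (simp add: continuous_intros)
next
  case (Suc k)
  have df: "f differentiable at x" and dg: "g differentiable at x" for x using Suc.prems by simp_all
  have Df: "Ck k (\<lambda>x. frechet_derivative f (at x) v)" and Dg: "Ck k (\<lambda>x. frechet_derivative g (at x) v)" for v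
    using Suc.prems by simp_all
  have eq: "frechet_derivative (\<lambda>x. f x * g x) (at x) v
      = f x * frechet_derivative g (at x) v + frechet_derivative f (at x) v * g x" for x v
    using frechet_derivative_at[OF has_derivative_mult[OF frechet_derivative_works[THEN iffD1, OF df]
          frechet_derivative_works[THEN iffD1, OF dg]], of x, symmetric] by simp
  have "Ck k (\<lambda>x. frechet_derivative (\<lambda>x. f x * g x) (at x) v)" for v
    unfolding eq by (intro Ck_add Suc.IH Ck_Suc_imp[OF Suc.prems(1)] Ck_Suc_imp[OF Suc.prems(2)] Df Dg)
  then show ?case using differentiable_mult[OF df dg] by simp
qed

lemma smooth_add: "smooth f \<Longrightarrow> smooth g \<Longrightarrow> smooth (\<lambda>x. f x + g x)"
  by (simp add: smooth_def Ck_add)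

lemma smooth_mult:
  fixes f g :: "'a::euclidean_space \<Rightarrow> complex"
  shows "smooth f \<Longrightarrow> smooth g \<Longrightarrow> smooth (\<lambda>x. f x * g x)"
  by (simp add: smooth_def Ck_mult)

lemma smooth_const: "smooth (\<lambda>x :: 'a::euclidean_space. c :: 'b::real_normed_vector)"
proof -
  have "Ck k (\<lambda>x :: 'a. c)" for k and c :: 'b
    by (induction k arbitrary: c) simp_all
  then show ?thesis by (simp add: smooth_def)
qed

text \<open>The derivatives of \<open>exp s (\<alpha> cos (\<theta> s) + \<beta> sin (\<theta> s))\<close> are of the same form.\<close>

lemma smooth_exp_cos_sin:
  fixes l :: "'a::euclidean_space \<Rightarrow> real"
  assumes l: "bounded_linear l"
  shows "smooth (\<lambda>z. complex_of_real (exp (l z) * (\<alpha> * cos (l z * \<theta>) + \<beta> * sin (l z * \<theta>))))"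
proof -
  have "Ck k (\<lambda>z. complex_of_real (exp (l z) * (\<alpha> * cos (l z * \<theta>) + \<beta> * sin (l z * \<theta>))))" for k
  proof (induction k arbitrary: \<alpha> \<beta>)
    case 0
    have "continuous_on UNIV l" by (rule linear_continuous_on[OF l])
    then show ?case by (simp add: continuous_intros)
  next
    case (Suc k)
    have ld: "(l has_derivative l) (at x)" for x by (rule bounded_linear_imp_has_derivative[OF l])
    have d: "((\<lambda>z. complex_of_real (exp (l z) * (\<alpha> * cos (l z * \<theta>) + \<beta> * sin (l z * \<theta>)))) has_derivative
        (\<lambda>v. complex_of_real (exp (l x) * (l v * (\<alpha> + \<beta> * \<theta>) * cos (l x * \<theta>) + l v * (\<beta> - \<alpha> * \<theta>)
          * sin (l x * \<theta>))))) (at x)" for x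
      by (rule derivative_eq_intros refl ld)+ (simp add: fun_eq_iff algebra_simps)
    have eq: "frechet_derivative (\<lambda>z. complex_of_real
      (exp (l z) * (\<alpha> * cos (l z * \<theta>) + \<beta> * sin (l z * \<theta>)))) (at x) v
        = complex_of_real (exp (l x) * (l v * (\<alpha> + \<beta> * \<theta>) * cos (l x * \<theta>) + l v * (\<beta> - \<alpha> * \<theta>)
          * sin (l x * \<theta>)))" for x v
      using frechet_derivative_at[OF d, of x, symmetric] by simp
    have "(\<lambda>z. complex_of_real (exp (l z) * (\<alpha> * cos (l z * \<theta>) + \<beta> * sin (l z * \<theta>)))) differentiable at x"
      for x
      using d unfolding differentiable_def by blast
    then show ?case unfolding Ck.simps eq by (intro conjI allI Suc.IH)
  qed
  then show ?thesis by (simp add: smooth_def)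
qed

section \<open>Closure properties of test functions\<close>

lemma test_functions_Cc: "u \<in> test_functions \<Longrightarrow> u \<in> Cc"
  by (simp add: test_functions_def Cc_def smooth_imp_continuous)

lemma test_functions_smooth: "u \<in> test_functions \<Longrightarrow> smooth u"
  by (simp add: test_functions_def)

text \<open>The condition concerns the complement of the closed support, an open set. This suits
  derivatives, which vanish at a point if the function vanishes near it.\<close>

lemma compactly_supported_subset:
  assumes f: "compactly_supported f" and le: "\<And>x. x \<notin> closure {x. f x \<noteq> 0} \<Longrightarrow> g x = 0"
  shows "compactly_supported g"
proof -
  have "closure {x. g x \<noteq> 0} \<subseteq> closure {x. f x \<noteq> 0}"
    using le by (intro closure_minimal) auto
  then have "compact (closure {x. f x \<noteq> 0} \<inter> closure {x. g x \<noteq> 0}) \<Longrightarrow> compact (closure {x. g x \<noteq> 0})"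
    by (simp add: Int_absorb1)
  then show ?thesis
    using f compact_Int_closed[OF _ closed_closure, of "closure {x. f x \<noteq> 0}" "{x. g x \<noteq> 0}"]
    by (simp add: compactly_supported_def)
qed

lemma test_functions_mult:
  assumes "smooth a" "u \<in> test_functions"
  shows "(\<lambda>x. a x * u x) \<in> test_functions"
proof -
  have "compactly_supported (\<lambda>x. a x * u x)"
  proof (rule compactly_supported_subset)
    show "compactly_supported u" using assms(2) by (simp add: test_functions_def)
    show "a x * u x = 0" if "x \<notin> closure {x. u x \<noteq> 0}" for x
      using that subsetD[OF closure_subset, of x "{x. u x \<noteq> 0}"] by auto
  qed
  then show ?thesis using assms by (simp add: test_functions_def smooth_mult)
qed

lemma test_functions_add:
  assumes u: "u \<in> test_functions" and w: "w \<in> test_functions"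
  shows "(\<lambda>x. u x + w x) \<in> test_functions"
proof -
  have "{x. u x + w x \<noteq> 0} \<subseteq> {x. u x \<noteq> 0} \<union> {x. w x \<noteq> 0}" by auto
  then have sub: "closure {x. u x + w x \<noteq> 0} \<subseteq> closure {x. u x \<noteq> 0} \<union> closure {x. w x \<noteq> 0}"
    using closure_mono closure_Un by metis
  have "compact (closure {x. u x \<noteq> 0} \<union> closure {x. w x \<noteq> 0})"
    using u w by (simp add: test_functions_def compactly_supported_def compact_Un)
  from compact_Int_closed[OF this closed_closure, of "{x. u x + w x \<noteq> 0}"] sub
  have "compactly_supported (\<lambda>x. u x + w x)" by (simp add: compactly_supported_def Int_absorb1)
  then show ?thesis using u w by (simp add: test_functions_def smooth_add)
qed

lemma test_functions_frechet_derivative: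
  assumes u: "u \<in> test_functions"
  shows "(\<lambda>x. frechet_derivative u (at x) v) \<in> test_functions"
proof -
  have "compactly_supported (\<lambda>x. frechet_derivative u (at x) v)"
  proof (rule compactly_supported_subset)
    show "compactly_supported u" using u by (simp add: test_functions_def)
    fix x assume x: "x \<notin> closure {x. u x \<noteq> 0}"
    have "(u has_derivative (\<lambda>v. 0)) (at x)"
    proof (rule has_derivative_transform_within_open[OF has_derivative_const])
      show "open (- closure {x. u x \<noteq> 0})" by (simp add: open_Compl)
      show "x \<in> - closure {x. u x \<noteq> 0}" using x by simp
      show "0 = u y" if "y \<in> - closure {x. u x \<noteq> 0}" for y
        using that subsetD[OF closure_subset, of y "{x. u x \<noteq> 0}"] by auto
    qed
    from frechet_derivative_at[OF this] show "frechet_derivative u (at x) v = 0" by metis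
  qed
  then show ?thesis using u by (simp add: test_functions_def smooth_frechet_derivative)
qed

text \<open>The derivatives in the basis directions are again test functions, hence bounded, and the
  mean value inequality applies.\<close>

lemma test_functions_Lipschitz:
  assumes u: "u \<in> test_functions"
  shows "\<exists>K\<ge>0. \<forall>x y. cmod (u x - u y) \<le> K * norm (x - y)"
proof -
  have "\<exists>B\<ge>0. \<forall>x. cmod (frechet_derivative u (at x) b) \<le> B" for b
    by (rule Cc_bounded[OF test_functions_Cc[OF test_functions_frechet_derivative[OF u]]])
  then obtain B where B0: "\<And>b. 0 \<le> B b" and B: "\<And>b x. cmod (frechet_derivative u (at x) b) \<le> B b"
    by metis
  let ?K = "\<Sum>b\<in>Basis. B b"
  have K0: "0 \<le> ?K" by (intro sum_nonneg B0)
  have on: "onorm (frechet_derivative u (at x)) \<le> ?K" for x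
  proof (rule onorm_bound[OF K0])
    fix v
    interpret bounded_linear "frechet_derivative u (at x)"
      using smooth_has_derivative[OF test_functions_smooth[OF u]] by (rule has_derivative_bounded_linear)
    have "frechet_derivative u (at x) v = (\<Sum>b\<in>Basis. (v \<bullet> b) *\<^sub>R frechet_derivative u (at x) b)"
      by (subst euclidean_representation[of v, symmetric]) (simp only: sum scaleR)
    also have "norm \<dots> \<le> (\<Sum>b\<in>Basis. norm v * B b)"
    proof (rule sum_norm_le)
      fix b :: 'a assume b: "b \<in> Basis"
      have "\<bar>v \<bullet> b\<bar> * cmod (frechet_derivative u (at x) b) \<le> norm v * B b"
        by (intro mult_mono B Basis_le_norm b) simp_all
      then show "norm ((v \<bullet> b) *\<^sub>R frechet_derivative u (at x) b) \<le> norm v * B b" by simp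
    qed
    finally show "norm (frechet_derivative u (at x) v) \<le> ?K * norm v"
      unfolding sum_distrib_right by (simp only: mult.commute)
  qed
  have "cmod (u x - u y) \<le> ?K * norm (x - y)" for x y
    by (rule differentiable_bound[OF convex_UNIV, where f' = "\<lambda>x. frechet_derivative u (at x)", OF _ on])
      (simp_all add: smooth_has_derivative[OF test_functions_smooth[OF u]])
  with K0 show ?thesis by blast
qed

text \<open>Right multiplication by \<open>(t *\<^sub>R w, 0)\<close> moves along a straight line
  with direction \<open>grelaud_tau \<theta> s *v w\<close>, so the quotients converge pointwise.
  Where \<open>v\<close> does not vanish, the Lipschitz constant bounds them by
  \<open>K * (exp L * norm w)\<close>, and dominated convergence applies.\<close>

lemma translated_difference_tendsto:
  fixes \<theta> :: real and w :: "real^2"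
  assumes u: "u \<in> test_functions" and vi: "integrable grelaud_haar v"
    and L: "\<And>x s. L < \<bar>s\<bar> \<Longrightarrow> v (x, s) = 0"
  shows "(\<lambda>n. translated_difference \<theta> v w (inverse (real (Suc n))) u)
    \<longlonglongrightarrow> (LINT g|grelaud_haar. deriv_fst (grelaud \<theta>) (w, 0) u (g, inv\<^bsub>grelaud \<theta>\<^esub> g) * v g)"
proof -
  obtain K where K: "0 \<le> K" and Lip: "\<And>x y. cmod (u x - u y) \<le> K * norm (x - y)"
    using test_functions_Lipschitz[OF u] by blast
  let ?h = "\<lambda>n. inverse (real (Suc n))"
  define D where "D h g = (u (g \<otimes>\<^bsub>grelaud \<theta>\<^esub> (h *\<^sub>R w, 0), inv\<^bsub>grelaud \<theta>\<^esub> g) - u (g, inv\<^bsub>grelaud \<theta>\<^esub> g)) /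
    complex_of_real h" for h g
  have Dlim: "(\<lambda>n. D (?h n) g) \<longlonglongrightarrow> deriv_fst (grelaud \<theta>) (w, 0) u (g, inv\<^bsub>grelaud \<theta>\<^esub> g)" for g
  proof -
    obtain x s where g: "g = (x, s)" by (cases g)
    let ?\<delta> = "grelaud_tau \<theta> s *v w" and ?k = "inv\<^bsub>grelaud \<theta>\<^esub> g"
    have curve: "g \<otimes>\<^bsub>grelaud \<theta>\<^esub> (t *\<^sub>R w, 0) = (x + t *\<^sub>R ?\<delta>, s)" for t
      by (simp add: g matrix_vector_mult_scaleR)
    define f where "f t = u ((x + t *\<^sub>R ?\<delta>, s), ?k)" for t
    define F' where "F' = frechet_derivative u (at ((x, s), ?k)) ((?\<delta>, 0), 0)"
    have "((\<lambda>t :: real. ((x + t *\<^sub>R ?\<delta>, s), ?k)) has_derivative (\<lambda>t. ((t *\<^sub>R ?\<delta>, 0), 0))) (at 0)"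
      by (auto intro!: derivative_eq_intros)
    moreover have "(u has_derivative frechet_derivative u (at ((x, s), ?k))) (at ((x + 0 *\<^sub>R ?\<delta>, s), ?k))"
      using smooth_has_derivative[OF test_functions_smooth[OF u]] by simp
    ultimately have fd: "(f has_derivative (\<lambda>t. frechet_derivative u (at ((x, s), ?k)) ((t *\<^sub>R ?\<delta>, 0), 0)))
      (at 0)"
      unfolding f_def by (rule has_derivative_compose)
    have lin: "linear (frechet_derivative u (at ((x, s), ?k)))"
      using smooth_has_derivative[OF test_functions_smooth[OF u]] has_derivative_linear by blast
    have "(\<lambda>t. frechet_derivative u (at ((x, s), ?k)) ((t *\<^sub>R ?\<delta>, 0), 0)) = (\<lambda>t. t *\<^sub>R F')"
      unfolding F'_def linear_scale[OF lin, symmetric] by simp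
    with fd have fv: "(f has_vector_derivative F') (at 0)" by (simp add: has_vector_derivative_def)
    have "deriv_fst (grelaud \<theta>) (w, 0) u (g, ?k) = F'"
      using vector_derivative_at[OF fv]
      by (simp add: deriv_fst_def lie_exp_grelaud curve f_def[abs_def] del: grelaud_simps(2))
    moreover have "(\<lambda>n. D (?h n) g) \<longlonglongrightarrow> F'"
    proof -
      have "((\<lambda>t. norm (f (0 + t) - f 0 - t *\<^sub>R F') / norm t) \<longlongrightarrow> 0) (at 0)"
        using fv unfolding has_vector_derivative_def has_derivative_at by blast
      moreover have "filterlim ?h (at 0) sequentially"
        by (intro filterlim_atI LIMSEQ_inverse_real_of_nat) simp
      ultimately have "(\<lambda>n. norm (f (0 + ?h n) - f 0 - ?h n *\<^sub>R F') / norm (?h n)) \<longlonglongrightarrow> 0"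
        by (rule filterlim_compose)
      moreover have "norm (f (0 + ?h n) - f 0 - ?h n *\<^sub>R F') / norm (?h n) = norm (D (?h n) g - F')" for n
      proof -
        have h0: "complex_of_real (?h n) \<noteq> 0" by (simp del: of_nat_Suc)
        have "D (?h n) g - F' = (f (0 + ?h n) - f 0 - ?h n *\<^sub>R F') / complex_of_real (?h n)"
          using h0 unfolding D_def curve f_def scaleR_conv_of_real[of "?h n" F']
          by (simp add: g diff_divide_distrib del: of_nat_Suc)
        then show ?thesis by (simp only: norm_divide norm_of_real real_norm_def)
      qed
      ultimately show ?thesis by (simp only: tendsto_norm_zero_iff LIM_zero_iff)
    qed
    ultimately show ?thesis by simp
  qed
  have ginv: "inv\<^bsub>grelaud \<theta>\<^esub> g = (- (grelaud_tau \<theta> (- snd g) *v fst g), - snd g)" for g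
    by (cases g) (simp add: grelaud_inv)
  have gmul: "g \<otimes>\<^bsub>grelaud \<theta>\<^esub> (h *\<^sub>R w, 0) = (fst g + grelaud_tau \<theta> (snd g) *v (h *\<^sub>R w), snd g)" for g h
    by (cases g) simp
  have Dm: "(\<lambda>g. v g * D (?h n) g) \<in> borel_measurable grelaud_haar" for n
  proof -
    have "continuous_on UNIV (D (?h n))"
      unfolding D_def ginv gmul
      by (intro continuous_intros continuous_on_compose2[OF
        smooth_imp_continuous[OF test_functions_smooth[OF u]]])
        (simp_all del: of_nat_Suc)
    from borel_measurable_continuous_onI[OF this]
    have "D (?h n) \<in> borel_measurable grelaud_haar" by (simp cong: measurable_cong_sets)
    then show ?thesis by (rule borel_measurable_times[OF borel_measurable_integrable[OF vi]])
  qed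
  let ?W = "K * (exp L * norm w)"
  have W0: "0 \<le> ?W" using K by simp
  have Db: "cmod (v g * D (?h n) g) \<le> ?W * cmod (v g)" for g n
  proof (cases "L < \<bar>snd g\<bar>")
    case True
    then show ?thesis using L[of "snd g" "fst g"] by simp
  next
    case False
    let ?z = "(fst g + grelaud_tau \<theta> (snd g) *v (?h n *\<^sub>R w), snd g)"
    have "cmod (u (?z, inv\<^bsub>grelaud \<theta>\<^esub> g) - u (g, inv\<^bsub>grelaud \<theta>\<^esub> g))
      \<le> K * norm ((?z, inv\<^bsub>grelaud \<theta>\<^esub> g) - (g, inv\<^bsub>grelaud \<theta>\<^esub> g))"
      by (rule Lip)
    also have "(?z, inv\<^bsub>grelaud \<theta>\<^esub> g) - (g, inv\<^bsub>grelaud \<theta>\<^esub> g) = ((grelaud_tau \<theta> (snd g) *v (?h n *\<^sub>R w), 0), 0)"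
      by (cases g) simp
    also have "norm ((grelaud_tau \<theta> (snd g) *v (?h n *\<^sub>R w), 0 :: real), 0 :: (real^2) \<times> real)
      = exp (snd g) * (?h n * norm w)"
      by (simp add: norm_Pair norm_grelaud_tau)
    also have "K * (exp (snd g) * (?h n * norm w)) \<le> K * (exp L * (?h n * norm w))"
      using False K by (intro mult_left_mono mult_right_mono) simp_all
    finally have "cmod (D (?h n) g) \<le> K * (exp L * (?h n * norm w)) / ?h n"
      unfolding D_def gmul norm_divide norm_of_real
      by (subst abs_of_nonneg) (simp_all only: divide_right_mono inverse_nonnegative_iff_nonnegative
        of_nat_0_le_iff)
    also have "\<dots> = ?W" by simp
    finally show ?thesis unfolding norm_mult by (subst mult.commute) (rule mult_right_mono, simp_all)
  qed
  have lim: "(\<lambda>n. v g * D (?h n) g) \<longlonglongrightarrow> deriv_fst (grelaud \<theta>) (w, 0) u (g, inv\<^bsub>grelaud \<theta>\<^esub> g) * v g" for g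
    unfolding mult.commute[of "deriv_fst (grelaud \<theta>) (w, 0) u (g, inv\<^bsub>grelaud \<theta>\<^esub> g)"]
    by (intro tendsto_intros Dlim)
  have "(\<lambda>n. LINT g|grelaud_haar. v g * D (?h n) g)
      \<longlonglongrightarrow> (LINT g|grelaud_haar. deriv_fst (grelaud \<theta>) (w, 0) u (g, inv\<^bsub>grelaud \<theta>\<^esub> g) * v g)"
  proof (rule integral_dominated_convergence[where w = "\<lambda>g. ?W * cmod (v g)"])
    show "AE g in grelaud_haar. (\<lambda>n. v g * D (?h n) g) \<longlonglongrightarrow> deriv_fst (grelaud \<theta>) (w, 0) u
      (g, inv\<^bsub>grelaud \<theta>\<^esub> g) * v g"
      by (intro AE_I2 lim)
    show "(\<lambda>g. deriv_fst (grelaud \<theta>) (w, 0) u (g, inv\<^bsub>grelaud \<theta>\<^esub> g) * v g) \<in> borel_measurable grelaud_haar"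
      by (rule borel_measurable_LIMSEQ_metric[OF Dm lim])
    show "integrable grelaud_haar (\<lambda>g. ?W * cmod (v g))" using vi by simp
    show "AE g in grelaud_haar. norm (v g * D (?h n) g) \<le> ?W * cmod (v g)" for n
      by (intro AE_I2 Db)
  qed (rule Dm)
  then show ?thesis by (simp only: translated_difference_def D_def)
qed

section \<open>Test functions and the Fourier algebra\<close>

text \<open>Since \<open>\<phi> 0 = \<integral>exp_kernel t * (2 * \<phi> t - \<phi>' t) dt\<close>, the operator \<open>2 - X\<close> is inverted by averaging along
  the flow of \<open>X\<close>. The rate 2 makes the kernel square-integrable even against the modular function
  \<open>exp (2 * t)\<close>.\<close>

definition exp_kernel :: "real \<Rightarrow> complex" where
  "exp_kernel t = of_real (indicator {0<..} t * exp (- 2 * t))"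

lemma exp_kernel_measurable [measurable]: "exp_kernel \<in> borel_measurable borel"
  unfolding exp_kernel_def[abs_def] by measurable

lemma exp_minus_2_tendsto: "((\<lambda>t :: real. exp (- 2 * t)) \<longlongrightarrow> 0) at_top"
  by (rule filterlim_compose[OF exp_at_bot]
      filterlim_tendsto_neg_mult_at_bot[OF tendsto_const _ filterlim_ident])+ simp

lemma exp_kernel_integrable: "integrable lborel exp_kernel"
proof (rule integrableI_bounded)
  have "(\<integral>\<^sup>+t. ennreal (exp (- 2 * t)) * indicator {0..} t \<partial>lborel) = ennreal (0 - (- exp (- 2 * 0) / 2))"
  proof (rule nn_integral_FTC_atLeast)
    show "((\<lambda>t. - exp (- 2 * t) / 2) has_real_derivative exp (- 2 * t)) (at t)" for t :: real
      by (auto intro!: derivative_eq_intros)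
    show "((\<lambda>t :: real. - exp (- 2 * t) / 2) \<longlongrightarrow> 0) at_top"
      using tendsto_divide[OF tendsto_minus[OF exp_minus_2_tendsto] tendsto_const[of 2]] by simp
  qed simp_all
  moreover have "(\<integral>\<^sup>+t. ennreal (norm (exp_kernel t)) \<partial>lborel)
    \<le> (\<integral>\<^sup>+t. ennreal (exp (- 2 * t)) * indicator {0..} t \<partial>lborel)"
    by (intro nn_integral_mono) (simp add: exp_kernel_def indicator_def)
  ultimately have "(\<integral>\<^sup>+t. ennreal (norm (exp_kernel t)) \<partial>lborel) \<le> ennreal (0 - (- exp (- 2 * 0) / 2))"
    by (simp only:)
  from le_less_trans[OF this ennreal_less_top]
  show "(\<integral>\<^sup>+t. ennreal (norm (exp_kernel t)) \<partial>lborel) < \<infinity>"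
    by (simp only: infinity_ennreal_def)
qed measurable

text \<open>\<open>exp (- 2 * t) * (2 * \<phi> t - \<phi>' t)\<close> is the derivative of
  \<open>- exp (- 2 * t) * \<phi> t\<close>, which tends to 0 at infinity because
  \<open>\<phi>\<close> is bounded.\<close>

lemma exp_kernel_integral:
  fixes \<phi> \<phi>' :: "real \<Rightarrow> complex"
  assumes d: "\<And>t. (\<phi> has_vector_derivative \<phi>' t) (at t)" and c: "continuous_on UNIV \<phi>'"
    and b: "\<And>t. cmod (\<phi> t) \<le> B" and b': "\<And>t. cmod (\<phi>' t) \<le> B'"
  shows "\<phi> 0 = (LINT t|lborel. exp_kernel t * (2 * \<phi> t - \<phi>' t))"
proof -
  let ?F = "\<lambda>t. - (exp (- 2 * t) *\<^sub>R \<phi> t)"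
  let ?f = "\<lambda>t. exp (- 2 * t) *\<^sub>R (2 * \<phi> t - \<phi>' t)"
  have \<phi>c: "continuous_on UNIV \<phi>"
    using has_vector_derivative_continuous[OF d] by (simp add: continuous_at_imp_continuous_on)
  have eq: "exp_kernel t * (2 * \<phi> t - \<phi>' t) = indicator (einterval 0 \<infinity>) t *\<^sub>R ?f t" for t
    by (simp add: exp_kernel_def einterval_def indicator_def scaleR_conv_of_real zero_ereal_def)
  have int: "set_integrable lborel (einterval 0 \<infinity>) ?f"
    unfolding set_integrable_def eq[symmetric]
  proof (rule Bochner_Integration.integrable_bound)
    show "integrable lborel (\<lambda>t. exp_kernel t * of_real (2 * B + B'))"
      using exp_kernel_integrable by simp
    have "(\<lambda>t. 2 * \<phi> t - \<phi>' t) \<in> borel_measurable borel"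
      by (intro borel_measurable_continuous_onI continuous_intros \<phi>c c)
    then show "(\<lambda>t. exp_kernel t * (2 * \<phi> t - \<phi>' t)) \<in> borel_measurable lborel" by measurable
    show "AE t in lborel. norm (exp_kernel t * (2 * \<phi> t - \<phi>' t)) \<le> norm (exp_kernel t * of_real (2 * B + B'))"
    proof (rule AE_I2)
      fix t
      have "cmod (2 * \<phi> t - \<phi>' t) \<le> 2 * B + B'"
        using norm_triangle_ineq4[of "2 * \<phi> t" "\<phi>' t"] b[of t] b'[of t] by (simp add: norm_mult)
      also have "\<dots> \<le> \<bar>2 * B + B'\<bar>" by simp
      finally show "norm (exp_kernel t * (2 * \<phi> t - \<phi>' t)) \<le> norm (exp_kernel t * of_real (2 * B + B'))"
        unfolding norm_mult norm_of_real by (rule mult_left_mono) simp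
    qed
  qed
  have "(LBINT t=0..\<infinity>. ?f t) = 0 - (- \<phi> 0)"
  proof (rule interval_integral_FTC_integrable[where F = ?F])
    show "(?F has_vector_derivative ?f t) (at t)" for t
      by (rule derivative_eq_intros d refl)+ (simp add: algebra_simps scaleR_conv_of_real)
    show "isCont ?f t" for t
      using \<phi>c c by (intro continuous_intros) (simp_all add: continuous_on_eq_continuous_at)
    have F0: "(?F \<longlongrightarrow> - \<phi> 0) (at_right 0)"
    proof -
      have "continuous_on UNIV ?F" by (intro continuous_intros \<phi>c)
      then have "isCont ?F 0" by (simp add: continuous_on_eq_continuous_at)
      then have "(?F \<longlongrightarrow> ?F 0) (at 0)" by (simp only: isCont_def)
      then show ?thesis by (rule filterlim_mono) (simp_all add: at_le)
    qed
    then show "((?F \<circ> real_of_ereal) \<longlongrightarrow> - \<phi> 0) (at_right 0)"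
      unfolding zero_ereal_def ereal_tendsto_simps by simp
    have "((\<lambda>t :: real. exp (- 2 * t) * B) \<longlongrightarrow> 0) at_top"
      using tendsto_mult[OF exp_minus_2_tendsto tendsto_const[of B]] by simp
    then have "(?F \<longlongrightarrow> 0) at_top"
      by (rule Lim_null_comparison[rotated]) (simp add: b)
    then show "((?F \<circ> real_of_ereal) \<longlongrightarrow> 0) (at_left \<infinity>)"
      unfolding ereal_tendsto_simps by simp
  qed (use int in simp_all)
  then show ?thesis
    by (simp add: interval_lebesgue_integral_def set_lebesgue_integral_def eq)
qed

lemma exp_kernel_flow:
  fixes u w :: "'a::euclidean_space \<Rightarrow> complex"
  assumes u: "u \<in> Cc" and w: "w \<in> Cc" and \<rho>: "continuous_on UNIV \<rho>"
    and d: "\<And>t. ((\<lambda>t. u (\<rho> t)) has_vector_derivative w (\<rho> t)) (at t)"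
  shows "u (\<rho> 0) = (LINT t|lborel. exp_kernel t * (2 * u (\<rho> t) - w (\<rho> t)))"
proof -
  obtain B where B: "\<And>x. cmod (u x) \<le> B" using Cc_bounded[OF u] by blast
  obtain B' where B': "\<And>x. cmod (w x) \<le> B'" using Cc_bounded[OF w] by blast
  show ?thesis
    by (rule exp_kernel_integral[OF d _ B B'])
      (rule continuous_on_compose2[OF Cc_continuous[OF w] \<rho>], simp)
qed

text \<open>The operator \<open>2 - X\<close> for the left-invariant vector field \<open>X\<close> of a direction \<open>c\<close> of one of the
  two planes; \<open>l\<close> reads off the real coordinate of the factor and \<open>j\<close> embeds its plane.\<close>

definition shifted_field ::
  "real \<Rightarrow> ('a::euclidean_space \<Rightarrow> real) \<Rightarrow> (real^2 \<Rightarrow> 'a) \<Rightarrow> real^2 \<Rightarrow> ('a \<Rightarrow> complex) \<Rightarrow> 'a \<Rightarrow> complex" where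
  "shifted_field \<theta> l j c u z = 2 * u z - frechet_derivative u (at z) (j (grelaud_tau \<theta> (l z) *v c))"

text \<open>The direction varies with \<open>z\<close>, but its coordinates are combinations of
  \<open>exp (l z) * cos (l z * \<theta>)\<close> and
  \<open>exp (l z) * sin (l z * \<theta>)\<close>. The derivative is thus a combination of
  derivatives in constant directions with smooth coefficients.\<close>

lemma field_test_functions:
  fixes l :: "'a::euclidean_space \<Rightarrow> real"
  assumes l: "bounded_linear l" and j: "bounded_linear j" and u: "u \<in> test_functions"
  shows "(\<lambda>z. frechet_derivative u (at z) (j (grelaud_tau \<theta> (l z) *v c))) \<in> test_functions"
proof -
  let ?a = "\<lambda>z. complex_of_real (exp (l z) * (c $ 1 * cos (l z * \<theta>) + (- c $ 2) * sin (l z * \<theta>)))"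
  let ?b = "\<lambda>z. complex_of_real (exp (l z) * (c $ 2 * cos (l z * \<theta>) + c $ 1 * sin (l z * \<theta>)))"
  have eq: "frechet_derivative u (at z) (j (grelaud_tau \<theta> (l z) *v c))
      = ?a z * frechet_derivative u (at z) (j (axis 1 1)) + ?b z * frechet_derivative u (at z)
        (j (axis 2 1))" for z
  proof -
    interpret j: bounded_linear j by (rule j)
    interpret du: bounded_linear "frechet_derivative u (at z)"
      using smooth_has_derivative[OF test_functions_smooth[OF u]] by (rule has_derivative_bounded_linear)
    let ?x = "exp (l z) * (c $ 1 * cos (l z * \<theta>) + (- c $ 2) * sin (l z * \<theta>))"
    let ?y = "exp (l z) * (c $ 2 * cos (l z * \<theta>) + c $ 1 * sin (l z * \<theta>))"
    have "grelaud_tau \<theta> (l z) *v c = ?x *\<^sub>R axis 1 1 + ?y *\<^sub>R axis 2 1"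
      by (simp add: grelaud_tau_mult vec_eq_iff forall_2 axis_def algebra_simps)
    then have "frechet_derivative u (at z) (j (grelaud_tau \<theta> (l z) *v c))
        = ?x *\<^sub>R frechet_derivative u (at z) (j (axis 1 1)) + ?y *\<^sub>R frechet_derivative u (at z) (j (axis 2 1))"
      by (simp only: j.add j.scaleR du.add du.scaleR)
    then show ?thesis by (simp only: scaleR_conv_of_real)
  qed
  show ?thesis unfolding eq
    by (intro test_functions_add test_functions_mult smooth_exp_cos_sin l test_functions_frechet_derivative u)
qed

lemma shifted_field_test_functions:
  assumes "bounded_linear l" "bounded_linear j" "u \<in> test_functions"
  shows "shifted_field \<theta> l j c u \<in> test_functions"
proof -
  have "(\<lambda>z. 2 * u z + (-1) * frechet_derivative u (at z) (j (grelaud_tau \<theta> (l z) *v c))) \<in> test_functions"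
    by (intro test_functions_add test_functions_mult smooth_const field_test_functions assms)
  then show ?thesis by (simp add: shifted_field_def[abs_def])
qed

text \<open>\<open>l\<close> vanishes on the image of \<open>j\<close>, so the field is constant
  along its own flow lines, which are therefore straight.\<close>

lemma shifted_field_integral:
  fixes l :: "'a::euclidean_space \<Rightarrow> real"
  assumes l: "bounded_linear l" and j: "bounded_linear j" and lj: "\<And>x. l (j x) = 0"
    and u: "u \<in> test_functions"
  shows "u z = (LINT t|lborel. exp_kernel t *
    shifted_field \<theta> l j c u (z + j (grelaud_tau \<theta> (l z) *v (t *\<^sub>R c))))"
proof -
  interpret l: bounded_linear l by (rule l)
  interpret j: bounded_linear j by (rule j)
  let ?v = "j (grelaud_tau \<theta> (l z) *v c)"
  let ?w = "\<lambda>z. frechet_derivative u (at z) (j (grelaud_tau \<theta> (l z) *v c))"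
  have \<rho>: "z + j (grelaud_tau \<theta> (l z) *v (t *\<^sub>R c)) = z + t *\<^sub>R ?v" for t
    by (simp add: matrix_vector_mult_scaleR j.scaleR)
  have lz: "l (z + t *\<^sub>R ?v) = l z" for t by (simp add: l.add l.scaleR lj)
  have "u (z + 0 *\<^sub>R ?v) = (LINT t|lborel. exp_kernel t * (2 * u (z + t *\<^sub>R ?v) - ?w (z + t *\<^sub>R ?v)))"
  proof (rule exp_kernel_flow)
    show "u \<in> Cc" "?w \<in> Cc" by (intro test_functions_Cc u field_test_functions l j)+
    show "continuous_on UNIV (\<lambda>t. z + t *\<^sub>R ?v)" by (intro continuous_intros)
    fix t :: real
    have "((\<lambda>t. z + t *\<^sub>R ?v) has_derivative (\<lambda>s. s *\<^sub>R ?v)) (at t)"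
      by (auto intro!: derivative_eq_intros)
    from has_derivative_compose[OF this smooth_has_derivative[OF test_functions_smooth[OF u]]]
    have "((\<lambda>t. u (z + t *\<^sub>R ?v)) has_derivative (\<lambda>s. frechet_derivative u (at (z + t *\<^sub>R ?v)) (s *\<^sub>R ?v)))
      (at t)" .
    moreover have "linear (frechet_derivative u (at (z + t *\<^sub>R ?v)))"
      using smooth_has_derivative[OF test_functions_smooth[OF u]] has_derivative_linear by blast
    ultimately show "((\<lambda>t. u (z + t *\<^sub>R ?v)) has_vector_derivative ?w (z + t *\<^sub>R ?v)) (at t)"
      unfolding has_vector_derivative_def lz by (simp add: linear_scale)
  qed
  then show ?thesis unfolding \<rho> shifted_field_def lz by simp
qed

text \<open>The analogue for a constant direction, used for the real coordinate: right
  multiplication by \<open>(0, t)\<close> only adds \<open>t\<close> to \<open>s\<close>.\<close>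

definition shifted_derivative :: "'a \<Rightarrow> ('a::euclidean_space \<Rightarrow> complex) \<Rightarrow> 'a \<Rightarrow> complex" where
  "shifted_derivative v u z = 2 * u z - frechet_derivative u (at z) v"

lemma shifted_derivative_test_functions:
  assumes "u \<in> test_functions"
  shows "shifted_derivative v u \<in> test_functions"
proof -
  have "(\<lambda>z. 2 * u z + (-1) * frechet_derivative u (at z) v) \<in> test_functions"
    by (intro test_functions_add test_functions_mult smooth_const test_functions_frechet_derivative assms)
  then show ?thesis by (simp add: shifted_derivative_def[abs_def])
qed

lemma shifted_derivative_integral:
  assumes u: "u \<in> test_functions"
  shows "u z = (LINT t|lborel. exp_kernel t * shifted_derivative v u (z + t *\<^sub>R v))"
proof -
  let ?w = "\<lambda>z. frechet_derivative u (at z) v"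
  have "u (z + 0 *\<^sub>R v) = (LINT t|lborel. exp_kernel t * (2 * u (z + t *\<^sub>R v) - ?w (z + t *\<^sub>R v)))"
  proof (rule exp_kernel_flow)
    show "u \<in> Cc" "?w \<in> Cc" by (intro test_functions_Cc u test_functions_frechet_derivative)+
    show "continuous_on UNIV (\<lambda>t. z + t *\<^sub>R v)" by (intro continuous_intros)
    fix t :: real
    have "((\<lambda>t. z + t *\<^sub>R v) has_derivative (\<lambda>s. s *\<^sub>R v)) (at t)"
      by (auto intro!: derivative_eq_intros)
    from has_derivative_compose[OF this smooth_has_derivative[OF test_functions_smooth[OF u]]]
    have "((\<lambda>t. u (z + t *\<^sub>R v)) has_derivative (\<lambda>s. frechet_derivative u (at (z + t *\<^sub>R v)) (s *\<^sub>R v)))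
      (at t)" .
    moreover have "linear (frechet_derivative u (at (z + t *\<^sub>R v)))"
      using smooth_has_derivative[OF test_functions_smooth[OF u]] has_derivative_linear by blast
    ultimately show "((\<lambda>t. u (z + t *\<^sub>R v)) has_vector_derivative ?w (z + t *\<^sub>R v)) (at t)"
      unfolding has_vector_derivative_def by (simp add: linear_scale)
  qed
  then show ?thesis unfolding shifted_derivative_def by simp
qed

section \<open>Test functions as averages over right translations\<close>

definition plane_kernel :: "real^2 \<Rightarrow> complex" where
  "plane_kernel a = exp_kernel (a $ 1) * exp_kernel (a $ 2)"

lemma Basis_real_2: "(Basis :: (real^2) set) = {axis 1 1, axis 2 1}"
  by (auto simp: Basis_vec_def UNIV_2)

lemma axis_1_neq_2: "axis 1 1 \<noteq> (axis 2 1 :: real^2)"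
  by (simp add: axis_eq_axis)

text \<open>Joins two successive line integrals into one integral over the plane.\<close>

lemma lborel_real_2: "(lborel :: (real^2) measure)
  = distr (lborel \<Otimes>\<^sub>M lborel) borel (\<lambda>(x, y). x *\<^sub>R axis 1 1 + y *\<^sub>R axis 2 1)"
proof (rule lborel_eqI)
  let ?T = "\<lambda>(x, y). x *\<^sub>R axis 1 1 + y *\<^sub>R axis 2 1 :: real^2"
  have T: "?T \<in> lborel \<Otimes>\<^sub>M lborel \<rightarrow>\<^sub>M borel" by measurable
  fix l u :: "real^2" assume le: "\<And>b. b \<in> Basis \<Longrightarrow> l \<bullet> b \<le> u \<bullet> b"
  have le': "l $ 1 \<le> u $ 1" "l $ 2 \<le> u $ 2"
    using le[of "axis 1 1"] le[of "axis 2 1"] by (simp_all add: Basis_real_2 inner_axis)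
  have "?T -` box l u \<inter> space (lborel \<Otimes>\<^sub>M lborel) = {l $ 1 <..< u $ 1} \<times> {l $ 2 <..< u $ 2}"
    by (auto simp: mem_box_cart forall_2 space_pair_measure axis_def)
  then have "emeasure (distr (lborel \<Otimes>\<^sub>M lborel) borel ?T) (box l u)
      = emeasure (lborel \<Otimes>\<^sub>M lborel) ({l $ 1 <..< u $ 1} \<times> {l $ 2 <..< u $ 2})"
    by (subst emeasure_distr[OF T]) simp_all
  also have "\<dots> = ennreal (u $ 1 - l $ 1) * ennreal (u $ 2 - l $ 2)"
    using le' by (simp add: lborel.emeasure_pair_measure_Times)
  also have "\<dots> = ennreal (\<Prod>b\<in>Basis. (u - l) \<bullet> b)"
    using le' axis_1_neq_2 by (simp add: Basis_real_2 inner_axis ennreal_mult)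
  finally show "emeasure (distr (lborel \<Otimes>\<^sub>M lborel) borel ?T) (box l u) = ennreal (\<Prod>b\<in>Basis. (u - l) \<bullet> b)" .
qed simp

lemma integrable_mult_bounded:
  fixes f g :: "'a \<Rightarrow> complex"
  assumes f: "integrable M f" and g: "g \<in> borel_measurable M" and B: "\<And>x. cmod (g x) \<le> B"
  shows "integrable M (\<lambda>x. f x * g x)"
proof (rule Bochner_Integration.integrable_bound)
  show "integrable M (\<lambda>x. f x * of_real B)" using f by simp
  show "(\<lambda>x. f x * g x) \<in> borel_measurable M"
    by (rule borel_measurable_times[OF borel_measurable_integrable[OF f] g])
  have "norm (f x * g x) \<le> norm (f x * of_real B)" for x
    unfolding norm_mult norm_of_real using B[of x] by (intro mult_left_mono) simp_all
  then show "AE x in M. norm (f x * g x) \<le> norm (f x * of_real B)" by simp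
qed

lemma plane_kernel_integrable: "integrable lborel plane_kernel"
proof -
  have "plane_kernel = (\<lambda>a. \<Prod>b\<in>Basis. exp_kernel (a \<bullet> b))"
    using axis_1_neq_2 by (simp add: plane_kernel_def fun_eq_iff Basis_real_2 inner_axis)
  with lborel_integral_prod_Basis(1)[where 'a = "real^2" and \<phi> = "\<lambda>b. exp_kernel", OF exp_kernel_integrable]
  show ?thesis by simp
qed

text \<open>The operators for the two basis directions are inverted one after the other. The first
  motion leaves \<open>l z\<close> unchanged, so the two displacements add up to the image of one
  point \<open>a\<close> of the plane under the same matrix.\<close>

lemma plane_field_integral:
  fixes l :: "'a::euclidean_space \<Rightarrow> real" and \<theta> :: real
  assumes l: "bounded_linear l" and j: "bounded_linear j" and lj: "\<And>x. l (j x) = 0"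
    and u: "u \<in> test_functions"
  defines "w \<equiv> shifted_field \<theta> l j (axis 2 1) (shifted_field \<theta> l j (axis 1 1) u)"
  shows "u z = (LINT a|lborel. plane_kernel a * w (z + j (grelaud_tau \<theta> (l z) *v a)))"
proof -
  interpret l: bounded_linear l by (rule l)
  interpret j: bounded_linear j by (rule j)
  let ?u1 = "shifted_field \<theta> l j (axis 1 1) u"
  let ?T = "\<lambda>(x, y). x *\<^sub>R axis 1 1 + y *\<^sub>R axis 2 1 :: real^2"
  have u1: "?u1 \<in> test_functions" by (rule shifted_field_test_functions[OF l j u])
  have w: "w \<in> Cc" unfolding w_def by (intro test_functions_Cc shifted_field_test_functions l j u1)
  obtain B where B: "\<And>x. cmod (w x) \<le> B" using Cc_bounded[OF w] by blast
  have T: "?T \<in> lborel \<Otimes>\<^sub>M lborel \<rightarrow>\<^sub>M borel" by measurable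
  let ?G = "\<lambda>a. w (z + j (grelaud_tau \<theta> (l z) *v a))"
  have Gm: "?G \<in> borel_measurable borel"
    by (intro borel_measurable_continuous_onI continuous_on_compose2[OF Cc_continuous[OF w]] continuous_intros
        j.continuous_on) simp
  have pm: "(\<lambda>a. plane_kernel a * ?G a) \<in> borel_measurable borel"
    using borel_measurable_times[OF borel_measurable_integrable[OF plane_kernel_integrable], of ?G] Gm by simp
  have step: "exp_kernel t * ?u1 (z + j (grelaud_tau \<theta> (l z) *v (t *\<^sub>R axis 1 1)))
      = (LINT r|lborel. plane_kernel (?T (t, r)) * ?G (?T (t, r)))" for t
  proof -
    let ?z = "z + j (grelaud_tau \<theta> (l z) *v (t *\<^sub>R axis 1 1))"
    have lz: "l ?z = l z" by (simp add: l.add lj)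
    have "?u1 ?z = (LINT r|lborel. exp_kernel r * w (?z + j (grelaud_tau \<theta> (l z) *v (r *\<^sub>R axis 2 1))))"
      using shifted_field_integral[OF l j lj u1, of ?z \<theta> "axis 2 1"] unfolding w_def lz .
    then have "exp_kernel t * ?u1 ?z = (LINT r|lborel. exp_kernel t
      * (exp_kernel r * w (?z + j (grelaud_tau \<theta> (l z) *v (r *\<^sub>R axis 2 1)))))"
      by (simp only: integral_mult_right_zero)
    also have "\<dots> = (LINT r|lborel. plane_kernel (?T (t, r)) * ?G (?T (t, r)))"
      by (simp add: plane_kernel_def axis_def matrix_vector_right_distrib j.add add.assoc mult.assoc)
    finally show ?thesis .
  qed
  have int: "integrable lborel (\<lambda>a. plane_kernel a * ?G a)"
    using Gm by (intro integrable_mult_bounded[OF plane_kernel_integrable _ B]) simp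
  have "u z = (LINT t|lborel. exp_kernel t * ?u1 (z + j (grelaud_tau \<theta> (l z) *v (t *\<^sub>R axis 1 1))))"
    by (rule shifted_field_integral[OF l j lj u])
  also have "\<dots> = (LINT t|lborel. LINT r|lborel. plane_kernel (?T (t, r)) * ?G (?T (t, r)))"
    by (simp only: step)
  also have "\<dots> = (LINT p|(lborel \<Otimes>\<^sub>M lborel). plane_kernel (?T p) * ?G (?T p))"
  proof (rule lborel_pair.integral_fst')
    have "integrable (distr (lborel \<Otimes>\<^sub>M lborel) borel ?T) (\<lambda>a. plane_kernel a * ?G a)"
      using int unfolding lborel_real_2[symmetric] .
    then show "integrable (lborel \<Otimes>\<^sub>M lborel) (\<lambda>p. plane_kernel (?T p) * ?G (?T p))"
      by (rule integrable_distr[OF T])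
  qed
  also have "\<dots> = (LINT a|distr (lborel \<Otimes>\<^sub>M lborel) borel ?T. plane_kernel a * ?G a)"
    by (rule integral_distr[OF T pm, symmetric])
  finally show ?thesis unfolding lborel_real_2[symmetric] .
qed

definition factor_kernel :: "(real^2) \<times> real \<Rightarrow> complex" where
  "factor_kernel p = plane_kernel (fst p) * exp_kernel (snd p)"

lemma factor_kernel_integrable: "integrable lborel factor_kernel"
  using lborel_pair.integrable_pair_mult[OF plane_kernel_integrable exp_kernel_integrable]
  by (simp add: factor_kernel_def[abs_def] lborel_prod)

text \<open>The plane comes before the real line because \<open>(a, t)\<close> is the product of
  \<open>(a, 0)\<close> and \<open>(0, t)\<close> in this order. If \<open>l\<close> and
  \<open>j\<close> belong to a factor of the product group and \<open>v\<close> is its unit vector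
  in the real direction, the argument of \<open>w\<close> is \<open>z\<close> multiplied on the
  right by \<open>p\<close> in that factor.\<close>

lemma factor_integral:
  fixes l :: "'a::euclidean_space \<Rightarrow> real"
  assumes l: "bounded_linear l" and j: "bounded_linear j" and lj: "\<And>x. l (j x) = 0"
    and u: "u \<in> test_functions"
  shows "\<exists>w\<in>test_functions. \<forall>z. u z = (LINT p|lborel. factor_kernel p *
    w (z + j (grelaud_tau \<theta> (l z) *v fst p) + snd p *\<^sub>R v))"
proof -
  interpret j: bounded_linear j by (rule j)
  define w1 where "w1 = shifted_field \<theta> l j (axis 2 1) (shifted_field \<theta> l j (axis 1 1) u)"
  have w1: "w1 \<in> test_functions" unfolding w1_def by (intro shifted_field_test_functions l j u)
  define w where "w = shifted_derivative v w1"
  have w: "w \<in> test_functions" unfolding w_def by (rule shifted_derivative_test_functions[OF w1])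
  have wC: "w \<in> Cc" by (rule test_functions_Cc[OF w])
  obtain B where B: "\<And>x. cmod (w x) \<le> B" using Cc_bounded[OF wC] by blast
  have "u z = (LINT p|lborel. factor_kernel p * w (z + j (grelaud_tau \<theta> (l z) *v fst p) + snd p *\<^sub>R v))" for z
  proof -
    let ?G = "\<lambda>p. w (z + j (grelaud_tau \<theta> (l z) *v fst p) + snd p *\<^sub>R v)"
    have Gm: "?G \<in> borel_measurable borel"
      by (intro borel_measurable_continuous_onI continuous_on_compose2[OF Cc_continuous[OF wC]]
        continuous_intros
          j.continuous_on) simp
    have int: "integrable lborel (\<lambda>p. factor_kernel p * ?G p)"
      using Gm by (intro integrable_mult_bounded[OF factor_kernel_integrable _ B]) simp
    have "u z = (LINT a|lborel. plane_kernel a * w1 (z + j (grelaud_tau \<theta> (l z) *v a)))"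
      unfolding w1_def by (rule plane_field_integral[OF l j lj u])
    also have "\<dots> = (LINT a|lborel. LINT t|lborel. factor_kernel (a, t) * ?G (a, t))"
    proof (intro Bochner_Integration.integral_cong refl)
      fix a
      have "w1 (z + j (grelaud_tau \<theta> (l z) *v a))
        = (LINT t|lborel. exp_kernel t * w (z + j (grelaud_tau \<theta> (l z) *v a) + t *\<^sub>R v))"
        unfolding w_def by (rule shifted_derivative_integral[OF w1])
      then show "plane_kernel a * w1 (z + j (grelaud_tau \<theta> (l z) *v a))
        = (LINT t|lborel. factor_kernel (a, t) * ?G (a, t))"
        by (simp only: factor_kernel_def fst_conv snd_conv integral_mult_right_zero mult.assoc)
    qed
    also have "\<dots> = (LINT p|(lborel \<Otimes>\<^sub>M lborel). factor_kernel p * ?G p)"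
      by (rule lborel_pair.integral_fst') (use int in \<open>simp only: lborel_prod\<close>)
    finally show ?thesis by (simp only: lborel_prod)
  qed
  with w show ?thesis by blast
qed

text \<open>A test function \<open>u\<close> has the form \<open>u z = \<integral>K p * F (z \<otimes> p) dp\<close> for a test function \<open>F\<close> and a product
  \<open>K\<close> of six copies of \<open>exp_kernel\<close>, hence is the coefficient of \<open>K\<close>, divided by the
  density of the Haar measure, and the conjugate of \<open>F\<close>.\<close>

lemma test_functions_subset_fourier_algebra:
  assumes u: "u \<in> test_functions"
  shows "u \<in> fourier_algebra (grelaud2 \<theta>) haar2"
proof -
  let ?j1 = "\<lambda>a :: real^2. ((a, 0 :: real), 0 :: (real^2) \<times> real)"
  let ?j2 = "\<lambda>a :: real^2. (0 :: (real^2) \<times> real, (a, 0 :: real))"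
  let ?v1 = "((0 :: real^2, 1 :: real), 0 :: (real^2) \<times> real)"
  let ?v2 = "(0 :: (real^2) \<times> real, (0 :: real^2, 1 :: real))"
  let ?l1 = "\<lambda>z :: ((real^2) \<times> real) \<times> ((real^2) \<times> real). snd (fst z)"
  let ?l2 = "\<lambda>z :: ((real^2) \<times> real) \<times> ((real^2) \<times> real). snd (snd z)"
  have bl: "bounded_linear ?j1" "bounded_linear ?j2" "bounded_linear ?l1" "bounded_linear ?l2"
    by (intro bounded_linear_intros)+
  have "\<exists>w\<in>test_functions. \<forall>z. u z = (LINT p|lborel. factor_kernel p *
      w (z + ?j1 (grelaud_tau \<theta> (?l1 z) *v fst p) + snd p *\<^sub>R ?v1))"
    by (rule factor_integral[OF bl(3,1) _ u]) simp
  then obtain w where w: "w \<in> test_functions" and uw: "\<And>z. u z = (LINT p|lborel. factor_kernel p *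
      w (z + ?j1 (grelaud_tau \<theta> (?l1 z) *v fst p) + snd p *\<^sub>R ?v1))" by blast
  have "\<exists>F\<in>test_functions. \<forall>z. w z = (LINT p|lborel. factor_kernel p *
      F (z + ?j2 (grelaud_tau \<theta> (?l2 z) *v fst p) + snd p *\<^sub>R ?v2))"
    by (rule factor_integral[OF bl(4,2) _ w]) simp
  then obtain F where F: "F \<in> test_functions" and wF: "\<And>z. w z = (LINT p|lborel. factor_kernel p *
      F (z + ?j2 (grelaud_tau \<theta> (?l2 z) *v fst p) + snd p *\<^sub>R ?v2))" by blast
  have FC: "F \<in> Cc" by (rule test_functions_Cc[OF F])
  obtain B where B: "\<And>x. cmod (F x) \<le> B" using Cc_bounded[OF FC] by blast
  define K where "K z = factor_kernel (fst z) * factor_kernel (snd z)" for z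
  have K: "integrable lborel K"
    using lborel_pair.integrable_pair_mult[OF factor_kernel_integrable factor_kernel_integrable]
    by (simp add: K_def[abs_def] lborel_prod)
  have Km: "K \<in> borel_measurable lborel" by (rule borel_measurable_integrable[OF K])
  define D where "D z = exp (- 2 * snd (fst z)) * exp (- 2 * snd (snd z))"
    for z :: "((real^2) \<times> real) \<times> ((real^2) \<times> real)"
  have Dc: "continuous_on UNIV D" unfolding D_def[abs_def] by (intro continuous_intros)
  have Dm: "D \<in> borel_measurable lborel" using borel_measurable_continuous_onI[OF Dc] by simp
  have D0: "0 < D z" for z by (simp add: D_def)
  define \<xi> where "\<xi> z = of_real (1 / D z) * K z" for z
  have \<xi>m: "\<xi> \<in> borel_measurable lborel"
    unfolding \<xi>_def[abs_def] using Dm Km by measurable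
  have haar: "haar2 = density lborel (\<lambda>z. ennreal (D z))" unfolding D_def by (rule haar2_eq_density)
  \<comment> \<open>The displacements from the two applications of \<open>factor_integral\<close>
    together amount to right multiplication in the product group.\<close>
  have mult: "z \<otimes>\<^bsub>grelaud2 \<theta>\<^esub> p = z + ?j1 (grelaud_tau \<theta> (?l1 z) *v fst (fst p)) + snd (fst p) *\<^sub>R ?v1
      + ?j2 (grelaud_tau \<theta> (?l2 z) *v fst (snd p)) + snd (snd p) *\<^sub>R ?v2" for z p
    by (cases z; cases p) (auto simp: DirProd_def split: prod.splits)
  have uK: "u z = (LINT p|lborel. K p * F (z \<otimes>\<^bsub>grelaud2 \<theta>\<^esub> p))" for z
  proof -
    have "continuous_on UNIV (\<lambda>p. F (z \<otimes>\<^bsub>grelaud2 \<theta>\<^esub> p))"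
      unfolding mult by (intro continuous_on_compose2[OF Cc_continuous[OF FC]] continuous_intros) simp
    from borel_measurable_continuous_onI[OF this]
    have int: "integrable lborel (\<lambda>p. K p * F (z \<otimes>\<^bsub>grelaud2 \<theta>\<^esub> p))"
      by (intro integrable_mult_bounded[OF K _ B]) simp
    have "u z = (LINT p|lborel. LINT q|lborel. K (p, q) * F (z \<otimes>\<^bsub>grelaud2 \<theta>\<^esub> (p, q)))"
      unfolding uw[of z]
    proof (intro Bochner_Integration.integral_cong refl)
      fix p :: "(real^2) \<times> real"
      let ?z = "z + ?j1 (grelaud_tau \<theta> (?l1 z) *v fst p) + snd p *\<^sub>R ?v1"
      have "?l2 ?z = ?l2 z" by simp
      then have "factor_kernel p * w ?z = (LINT q|lborel. factor_kernel p * (factor_kernel q *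
          F (?z + ?j2 (grelaud_tau \<theta> (?l2 z) *v fst q) + snd q *\<^sub>R ?v2)))"
        unfolding wF[of ?z] by (simp only: integral_mult_right_zero)
      then show "factor_kernel p * w ?z = (LINT q|lborel. K (p, q) * F (z \<otimes>\<^bsub>grelaud2 \<theta>\<^esub> (p, q)))"
        by (simp only: K_def mult fst_conv snd_conv mult.assoc)
    qed
    also have "\<dots> = (LINT p|(lborel \<Otimes>\<^sub>M lborel). K p * F (z \<otimes>\<^bsub>grelaud2 \<theta>\<^esub> p))"
      by (rule lborel_pair.integral_fst') (use int in \<open>simp only: lborel_prod\<close>)
    finally show ?thesis by (simp only: lborel_prod)
  qed
  have \<xi>sq: "\<xi> \<in> square_integrable haar2"
  proof -
    \<comment> \<open>Squaring doubles the rate of decay to 4; 2 of it are spent on the factor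
      \<open>exp (2 * t)\<close> from \<open>1 / D\<close>, and the kernel itself is left.\<close>
    have ek: "(cmod (exp_kernel t))\<^sup>2 * exp (2 * t) = cmod (exp_kernel t)"
      "(cmod (exp_kernel t))\<^sup>2 \<le> cmod (exp_kernel t)" for t
    proof -
      have "exp (- 2 * t) * exp (- 2 * t) * exp (2 * t) = exp (- 2 * t)"
        unfolding exp_add[symmetric] by simp
      then show "(cmod (exp_kernel t))\<^sup>2 * exp (2 * t) = cmod (exp_kernel t)"
        by (simp add: exp_kernel_def indicator_def power2_eq_square)
      have "cmod (exp_kernel t) \<le> 1" by (simp add: exp_kernel_def indicator_def)
      then show "(cmod (exp_kernel t))\<^sup>2 \<le> cmod (exp_kernel t)"
        by (simp add: power2_eq_square mult_left_le)
    qed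
    have fk: "(cmod (factor_kernel p))\<^sup>2 * exp (2 * snd p) \<le> cmod (factor_kernel p)" for p
    proof -
      have "(cmod (plane_kernel (fst p)))\<^sup>2 \<le> cmod (plane_kernel (fst p))"
        unfolding plane_kernel_def norm_mult power_mult_distrib by (intro mult_mono ek) simp_all
      then have "(cmod (plane_kernel (fst p)))\<^sup>2 * ((cmod (exp_kernel (snd p)))\<^sup>2 * exp (2 * snd p))
          \<le> cmod (plane_kernel (fst p)) * cmod (exp_kernel (snd p))"
        unfolding ek(1) by (rule mult_right_mono) simp
      then show ?thesis unfolding factor_kernel_def norm_mult power_mult_distrib by (simp only: mult.assoc)
    qed
    have le: "D z * (cmod (\<xi> z))\<^sup>2 \<le> cmod (K z)" for z
    proof -
      have "D z * (cmod (\<xi> z))\<^sup>2 = (1 / D z) * (cmod (K z))\<^sup>2"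
        using D0[of z] by (simp add: \<xi>_def norm_mult norm_divide power_mult_distrib power_divide
          power2_eq_square)
      also have "1 / D z = exp (2 * snd (fst z)) * exp (2 * snd (snd z))"
        by (simp add: D_def exp_minus field_simps)
      also have "exp (2 * snd (fst z)) * exp (2 * snd (snd z)) * (cmod (K z))\<^sup>2
          = ((cmod (factor_kernel (fst z)))\<^sup>2 * exp (2 * snd (fst z)))
            * ((cmod (factor_kernel (snd z)))\<^sup>2 * exp (2 * snd (snd z)))"
        unfolding K_def norm_mult power_mult_distrib by (simp only: mult_ac)
      also have "\<dots> \<le> cmod (factor_kernel (fst z)) * cmod (factor_kernel (snd z))"
        by (intro mult_mono fk) simp_all
      finally show ?thesis by (simp only: K_def norm_mult)
    qed
    have "integrable lborel (\<lambda>z. D z *\<^sub>R (cmod (\<xi> z))\<^sup>2)"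
    proof (rule Bochner_Integration.integrable_bound[OF integrable_norm[OF K]])
      show "(\<lambda>z. D z *\<^sub>R (cmod (\<xi> z))\<^sup>2) \<in> borel_measurable lborel" using Dm \<xi>m by measurable
      show "AE z in lborel. norm (D z *\<^sub>R (cmod (\<xi> z))\<^sup>2) \<le> norm (norm (K z))"
        using le D0[THEN less_imp_le] by (intro AE_I2) (simp add: abs_mult abs_of_nonneg)
    qed
    moreover have "(\<lambda>z. (cmod (\<xi> z))\<^sup>2) \<in> borel_measurable lborel" using \<xi>m by measurable
    ultimately have "integrable haar2 (\<lambda>z. (cmod (\<xi> z))\<^sup>2)"
      unfolding haar using D0[THEN less_imp_le] by (subst integrable_density[OF _ Dm]) simp_all
    moreover have "\<xi> \<in> borel_measurable haar2"
      using \<xi>m by (simp only: haar measurable_density_eq1 measurable_lborel1)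
    ultimately show ?thesis by (simp add: square_integrable_def)
  qed
  have \<eta>: "(\<lambda>z. cnj (F z)) \<in> square_integrable haar2"
    by (intro Cc_square_integrable_haar2 Cc_cnj FC)
  have "u z = l2_inner haar2 (left_regular (grelaud2 \<theta>) z \<xi>) (\<lambda>z. cnj (F z))" for z
  proof -
    interpret group "grelaud2 \<theta>" by (rule DirProd_group[OF grelaud_group grelaud_group])
    let ?T = "\<lambda>p. z \<otimes>\<^bsub>grelaud2 \<theta>\<^esub> p"
    let ?f = "\<lambda>y. left_regular (grelaud2 \<theta>) z \<xi> y * F y"
    have fm: "?f \<in> borel_measurable haar2"
      using borel_measurable_integrable[OF integrable_l2_product[OF left_regular_grelaud2(1)[OF \<xi>sq] \<eta>]]
        by simp
    have cancel: "left_regular (grelaud2 \<theta>) z \<xi> (?T p) = \<xi> p" for p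
    proof -
      have C: "x \<in> carrier (grelaud2 \<theta>)" for x by (simp only: carrier_grelaud2 UNIV_I)
      show ?thesis
        unfolding left_regular_def by (simp only: m_assoc[OF inv_closed[OF C] C C, symmetric] l_inv[OF C]
          l_one[OF C])
    qed
    \<comment> \<open>By left invariance the integration variable may be replaced by its product
      with \<open>z\<close>, which moves the translation from \<open>\<xi>\<close> to
      \<open>F\<close>.\<close>
    have "l2_inner haar2 (left_regular (grelaud2 \<theta>) z \<xi>) (\<lambda>z. cnj (F z))
      = (LINT y|distr haar2 haar2 ?T. ?f y)"
      by (simp add: l2_inner_def distr_haar2)
    also have "\<dots> = (LINT p|haar2. ?f (?T p))"
      by (rule integral_distr[OF measurable_grelaud2_mult fm])
    also have "\<dots> = (LINT p|haar2. \<xi> p * F (?T p))" by (simp only: cancel)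
    also have "\<dots> = (LINT p|lborel. D p *\<^sub>R (\<xi> p * F (?T p)))"
    proof -
      have "continuous_on UNIV (\<lambda>p. F (?T p))"
        unfolding mult by (intro continuous_on_compose2[OF Cc_continuous[OF FC]] continuous_intros) simp
      from borel_measurable_continuous_onI[OF this] have "(\<lambda>p. F (?T p)) \<in> borel_measurable lborel" by simp
      from borel_measurable_times[OF \<xi>m this] show ?thesis
        unfolding haar using D0[THEN less_imp_le] by (intro integral_density[OF _ Dm]) simp_all
    qed
    also have "\<dots> = (LINT p|lborel. K p * F (?T p))"
    proof (intro Bochner_Integration.integral_cong refl)
      fix p
      show "D p *\<^sub>R (\<xi> p * F (?T p)) = K p * F (?T p)"
        using D0[of p] by (simp add: \<xi>_def scaleR_conv_of_real)
    qed
    finally show ?thesis by (simp only: uK)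
  qed
  with \<xi>sq \<eta> have "represents (grelaud2 \<theta>) haar2 \<xi> (\<lambda>z. cnj (F z)) u"
    by (simp add: represents_def)
  then show ?thesis unfolding fourier_algebra_def by blast
qed

lemma span_grelaud_X: "X \<in> span {grelaud_X 1, grelaud_X 2} \<Longrightarrow> X = (fst X, 0)"
  by (induction rule: span_induct_alt) (auto simp: grelaud_X_def prod_eq_iff)

lemma compactly_supportedE:
  fixes f :: "'a::euclidean_space \<Rightarrow> 'b::zero"
  assumes "compactly_supported f"
  obtains R where "0 < R" "\<And>x. R < norm x \<Longrightarrow> f x = 0"
proof -
  have "bounded {x. f x \<noteq> 0}"
    using assms bounded_closure_image compact_imp_bounded bounded_subset closure_subset
    unfolding compactly_supported_def by metis
  then obtain R where R: "0 < R" "\<forall>x\<in>{x. f x \<noteq> 0}. norm x \<le> R"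
    unfolding bounded_pos by blast
  show thesis
    by (rule that[OF R(1)]) (use R(2) in force)
qed

theorem theorem2p8:
  fixes \<theta> :: real and v1 :: "real^2 \<Rightarrow> complex" and v2 :: "real \<Rightarrow> complex"
    and v :: "(real^2) \<times> real \<Rightarrow> complex" and X :: "(real^2) \<times> real"
  assumes "\<theta> > 0"
    and "integrable lborel v1"
    and "fourier_transform v1 \<in> fourier_algebra_c additive_group lborel"
    and "continuous_on UNIV v2" and "compactly_supported v2"
    and "\<And>x s. v (x, s) = v1 x * v2 s"
    and "X \<in> span {grelaud_X 1, grelaud_X 2}"
  shows "\<exists>S \<in> group_vN (grelaud \<theta> \<times>\<times> grelaud \<theta>) (grelaud_haar \<Otimes>\<^sub>M grelaud_haar).
    \<forall>u \<in> test_functions.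
      vN_pairing (grelaud \<theta> \<times>\<times> grelaud \<theta>) (grelaud_haar \<Otimes>\<^sub>M grelaud_haar) S u =
        (LINT g|grelaud_haar. deriv_fst (grelaud \<theta>) X u (g, inv\<^bsub>grelaud \<theta>\<^esub> g) * v g)"
proof -
  define w where "w = fst X"
  have X: "X = (w, 0)" unfolding w_def by (rule span_grelaud_X[OF assms(7)])
  have "compactly_supported (fourier_transform v1)"
    using assms(3) by (simp add: fourier_algebra_c_def)
  then obtain R where R: "0 < R" "\<And>p. R < norm p \<Longrightarrow> fourier_transform v1 p = 0"
    by (rule compactly_supportedE) blast
  obtain L where "0 < L" "\<And>s. L < norm s \<Longrightarrow> v2 s = 0"
    by (rule compactly_supportedE[OF assms(5)]) blast
  note L = this[unfolded real_norm_def]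
  have v2: "v2 \<in> Cc" using assms(4,5) by (simp add: Cc_def)
  obtain M where M: "\<And>s. cmod (v2 s) \<le> M" using Cc_bounded[OF v2] by blast
  have vi: "integrable grelaud_haar v"
    by (rule integrable_grelaud_haar_product[OF assms(2) v2 assms(6)])
  obtain S where S: "S \<in> group_vN (grelaud2 \<theta>) haar2"
    and lim: "\<And>\<xi> \<eta> c. \<xi> \<in> square_integrable haar2 \<Longrightarrow> \<eta> \<in> square_integrable haar2 \<Longrightarrow>
      (\<lambda>n. translated_difference \<theta> v w (inverse (real (Suc n))) (coefficient (grelaud2 \<theta>) haar2 \<xi> \<eta>))
        \<longlonglongrightarrow> c \<Longrightarrow> l2_inner haar2 (S \<xi>) \<eta> = c"
    using ex_limit_operator[OF assms(2) R M less_imp_le[OF L(1)] L(2) assms(6) vi, of \<theta> w] by blast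
  have "vN_pairing (grelaud2 \<theta>) haar2 S u =
      (LINT g|grelaud_haar. deriv_fst (grelaud \<theta>) X u (g, inv\<^bsub>grelaud \<theta>\<^esub> g) * v g)"
    if u: "u \<in> test_functions" for u
  proof (rule vN_pairing_eqI[OF test_functions_subset_fourier_algebra[OF u]])
    fix \<xi> \<eta> assume rep: "represents (grelaud2 \<theta>) haar2 \<xi> \<eta> u"
    \<comment> \<open>The carrier is the whole type, so a representation determines \<open>u\<close>
      as a function, and the limit computed for \<open>u\<close> applies to every representing
      pair.\<close>
    have ueq: "u = coefficient (grelaud2 \<theta>) haar2 \<xi> \<eta>"
      using rep by (simp add: represents_def coefficient_def fun_eq_iff)
    have v0: "v (x, s) = 0" if "L < \<bar>s\<bar>" for x s
      using L(2)[OF that] by (simp add: assms(6))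
    show "l2_inner haar2 (S \<xi>) \<eta> =
        (LINT g|grelaud_haar. deriv_fst (grelaud \<theta>) X u (g, inv\<^bsub>grelaud \<theta>\<^esub> g) * v g)"
    proof (rule lim)
      show "\<xi> \<in> square_integrable haar2" "\<eta> \<in> square_integrable haar2"
        using rep by (simp_all add: represents_def)
      show "(\<lambda>n. translated_difference \<theta> v w (inverse (real (Suc n))) (coefficient (grelaud2 \<theta>) haar2 \<xi> \<eta>))
          \<longlonglongrightarrow> (LINT g|grelaud_haar. deriv_fst (grelaud \<theta>) X u (g, inv\<^bsub>grelaud \<theta>\<^esub> g) * v g)"
        unfolding X ueq[symmetric] by (rule translated_difference_tendsto[OF u vi v0])
    qed
  qed
  with S show ?thesis by blast
qed

end
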